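(* Let $q$ be a prime power. (1) No smooth, space-filling surface of degree $q+1$ in $\mathbb{P}^3$ (defined over $\mathbb{F}_q$) is line-transverse-free. (2) If $n$ is odd and $k$ is even with $2\le k\le n-1$, then every smooth, space-filling hypersurface of degree $q+1$ in $\mathbb{P}^n$ (defined over $\mathbb{F}_q$) is $k$-flat-transverse-free. (3) For every $n\ge 2$, every smooth, space-filling hypersurface of degree $q+2$ in $\mathbb{P}^n$ (defined over $\mathbb{F}_q$) is line-transverse-free. (4) If $q$ is odd, then no smooth, space-filling hypersurface of degree $q+2$ in $\mathbb{P}^3$ (defined over $\mathbb{F}_q$) is plane-transverse-free.
   Context: $\mathbb{P}^n$ is projective $n$-space over the algebraic closure $\overline{\mathbb{F}_q}$; $\mathbb{P}^n(\mathbb{F}_q)$ is its set of $\mathbb{F}_q$-points. All hypersurfaces and flats are defined over $\mathbb{F}_q$ but are regarded as sets of $\overline{\mathbb{F}_q}$-points. A degree $d$ hypersurface is $S_f=\{P\in\mathbb{P}^n: f(P)=0\}$ for a nonzero homogeneous $f\in\mathbb{F}_q[x_0,\dots,x_n]$ of degree $d\ge1$. $S_f$ is smooth at $P\in S_f$ if $\nabla f(P)\ne0$, singular at $P$ otherwise; it is smooth if it is smooth at every $P\in S_f$ (over $\overline{\mathbb{F}_q}$). The tangent space $T_PS_f$ is the hyperplane $\sum_i \frac{\partial f}{\partial x_i}(P)x_i=0$ if $S_f$ is smooth at $P$, and $T_PS_f=\mathbb{P}^n$ if singular at $P$. For $1\le k\le n-1$, a $k$-flat is a $k$-dimensional projective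 linear subspace of $\mathbb{P}^n$ cut out by $n-k$ linearly independent linear forms over $\mathbb{F}_q$; lines are $1$-flats and planes are $2$-flats. A $k$-flat $\pi$ is tangent to $S$ if there is a point $P\in S\cap\pi$ (over $\overline{\mathbb{F}_q}$) with $\pi\subset T_PS$. $S$ is $k$-flat-transverse-free if every $k$-flat defined over $\mathbb{F}_q$ is tangent to $S$; line-transverse-free means $k=1$, plane-transverse-free means $k=2$. $S$ is space-filling if $\mathbb{P}^n(\mathbb{F}_q)\subset S$. *)

theory Defs
  imports "HOL-Algebra.Algebraic_Closure_Type" "HOL-Library.Poly_Mapping"
    "HOL-Library.Cardinality"
begin

text \<open>
  Throughout, \<open>'a\<close> is the base field (\<open>F\<^sub>q\<close> when it is finite with \<open>q\<close> elements),
  \<open>'a alg_closure\<close> its algebraic closure, and \<open>to_ac\<close> the embedding.  The dimension \<open>n\<close> of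
  projective space is a natural number, so coordinate vectors are functions on \<open>nat\<close> that
  vanish beyond index \<open>n\<close>.
\<close>

section \<open>Homogeneous polynomials\<close>

text \<open>A monomial is a finitely supported exponent vector, a polynomial a finitely supported
  family of coefficients; the variable \<open>x\<^sub>i\<close> is indexed by \<open>i\<close>.\<close>

type_synonym 'a mpoly = "(nat \<Rightarrow>\<^sub>0 nat) \<Rightarrow>\<^sub>0 'a"

definition homogeneous_form :: "nat \<Rightarrow> nat \<Rightarrow> 'a::field mpoly \<Rightarrow> bool" where
  "homogeneous_form n d f \<longleftrightarrow>
     (\<forall>m\<in>Poly_Mapping.keys f.
        Poly_Mapping.keys m \<subseteq> {..n} \<and>
        (\<Sum>i\<in>Poly_Mapping.keys m. Poly_Mapping.lookup m i) = d)"

definition mpoly_eval :: "'a::field mpoly \<Rightarrow> (nat \<Rightarrow> 'a alg_closure) \<Rightarrow> 'a alg_closure" where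
  "mpoly_eval f x =
     (\<Sum>m\<in>Poly_Mapping.keys f. to_ac (Poly_Mapping.lookup f m) *
        (\<Prod>i\<in>Poly_Mapping.keys m. x i ^ Poly_Mapping.lookup m i))"

text \<open>If \<open>x\<^sub>i\<close> does not occur in the monomial \<open>m\<close>, the subtraction truncates, but then the
  coefficient is zero.\<close>

definition mpoly_pderiv :: "nat \<Rightarrow> 'a::field mpoly \<Rightarrow> 'a mpoly" where
  "mpoly_pderiv i f =
     (\<Sum>m\<in>Poly_Mapping.keys f.
        Poly_Mapping.single (m - Poly_Mapping.single i 1)
          (of_nat (Poly_Mapping.lookup m i) * Poly_Mapping.lookup f m))"

section \<open>Projective space\<close>

definition coord_vectors :: "nat \<Rightarrow> (nat \<Rightarrow> 'k::field) set" where
  "coord_vectors n = {x. (\<exists>i\<le>n. x i \<noteq> 0) \<and> (\<forall>i>n. x i = 0)}"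

text \<open>A projective point is the set of all its homogeneous coordinate vectors.\<close>

definition proj_point :: "(nat \<Rightarrow> 'k::field) \<Rightarrow> (nat \<Rightarrow> 'k) set" where
  "proj_point x = {(\<lambda>i. c * x i) | c. c \<noteq> 0}"

type_synonym 'a ppoint = "(nat \<Rightarrow> 'a alg_closure) set"

definition proj_space :: "nat \<Rightarrow> 'a::field ppoint set" where
  "proj_space n = proj_point ` coord_vectors n"

definition rational_points :: "nat \<Rightarrow> 'a::field ppoint set" where
  "rational_points n = (\<lambda>v :: nat \<Rightarrow> 'a. proj_point (\<lambda>i. to_ac (v i))) ` coord_vectors n"

section \<open>Hypersurfaces\<close>

text \<open>
  Degree, smoothness and tangent spaces depend on the form \<open>f\<close> and not just on the point set
  \<open>S\<^sub>f\<close>, so these notions take \<open>f\<close> as argument.  All conditions on coordinate vectors below are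
  invariant under rescaling, because \<open>f\<close> and its partial derivatives are homogeneous; it is
  immaterial whether they are required for one or for all representatives of a point.
\<close>

definition hypersurface_form :: "nat \<Rightarrow> nat \<Rightarrow> 'a::field mpoly \<Rightarrow> bool" where
  "hypersurface_form n d f \<longleftrightarrow> d \<ge> 1 \<and> f \<noteq> 0 \<and> homogeneous_form n d f"

definition hypersurface :: "nat \<Rightarrow> 'a::field mpoly \<Rightarrow> 'a ppoint set" where
  "hypersurface n f = {P \<in> proj_space n. \<forall>x\<in>P. mpoly_eval f x = 0}"

definition smooth_at :: "nat \<Rightarrow> 'a::field mpoly \<Rightarrow> 'a ppoint \<Rightarrow> bool" where
  "smooth_at n f P \<longleftrightarrow> (\<forall>x\<in>P. \<exists>i\<le>n. mpoly_eval (mpoly_pderiv i f) x \<noteq> 0)"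

definition smooth_hypersurface :: "nat \<Rightarrow> 'a::field mpoly \<Rightarrow> bool" where
  "smooth_hypersurface n f \<longleftrightarrow> (\<forall>P\<in>hypersurface n f. smooth_at n f P)"

definition tangent_space :: "nat \<Rightarrow> 'a::field mpoly \<Rightarrow> 'a ppoint \<Rightarrow> 'a ppoint set" where
  "tangent_space n f P =
     (if smooth_at n f P
      then {Q \<in> proj_space n. \<forall>x\<in>P. \<forall>y\<in>Q. (\<Sum>i\<le>n. mpoly_eval (mpoly_pderiv i f) x * y i) = 0}
      else proj_space n)"

definition space_filling :: "nat \<Rightarrow> 'a::field mpoly \<Rightarrow> bool" where
  "space_filling n f \<longleftrightarrow> rational_points n \<subseteq> hypersurface n f"

section \<open>Flats over the base field\<close>

text \<open>The family \<open>l\<close> consists of the \<open>n - k\<close> linear forms \<open>l j 0 * x\<^sub>0 + \<dots> + l j n * x\<^sub>n\<close>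
  with \<open>j < n - k\<close>.\<close>

definition lin_indep_forms :: "nat \<Rightarrow> nat \<Rightarrow> (nat \<Rightarrow> nat \<Rightarrow> 'a::field) \<Rightarrow> bool" where
  "lin_indep_forms n r l \<longleftrightarrow>
     (\<forall>c. (\<forall>i\<le>n. (\<Sum>j<r. c j * l j i) = 0) \<longrightarrow> (\<forall>j<r. c j = 0))"

definition is_flat :: "nat \<Rightarrow> nat \<Rightarrow> 'a::field ppoint set \<Rightarrow> bool" where
  "is_flat n k \<pi> \<longleftrightarrow> 1 \<le> k \<and> k \<le> n - 1 \<and>
     (\<exists>l :: nat \<Rightarrow> nat \<Rightarrow> 'a. lin_indep_forms n (n - k) l \<and>
        \<pi> = {P \<in> proj_space n. \<forall>x\<in>P. \<forall>j<n - k. (\<Sum>i\<le>n. to_ac (l j i) * x i) = 0})"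

definition tangent_flat :: "nat \<Rightarrow> 'a::field mpoly \<Rightarrow> 'a ppoint set \<Rightarrow> bool" where
  "tangent_flat n f \<pi> \<longleftrightarrow> (\<exists>P \<in> hypersurface n f \<inter> \<pi>. \<pi> \<subseteq> tangent_space n f P)"

definition flat_transverse_free :: "nat \<Rightarrow> nat \<Rightarrow> 'a::field mpoly \<Rightarrow> bool" where
  "flat_transverse_free n k f \<longleftrightarrow> (\<forall>\<pi>. is_flat n k \<pi> \<longrightarrow> tangent_flat n f \<pi>)"

abbreviation line_transverse_free :: "nat \<Rightarrow> 'a::field mpoly \<Rightarrow> bool" where
  "line_transverse_free n \<equiv> flat_transverse_free n 1"

abbreviation plane_transverse_free :: "nat \<Rightarrow> 'a::field mpoly \<Rightarrow> bool" where
  "plane_transverse_free n \<equiv> flat_transverse_free n 2"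

end

theory Submission
  imports Defs
begin

text \<open>
  Restrict a space-filling form \<open>f\<close> to the line through two rational points \<open>u, v\<close>.  The resulting
  polynomial \<open>p(t) = f(u + t v)\<close> vanishes on \<open>F\<^sub>q\<close> and has degree at most \<open>q + 1\<close>, so it is
  \<open>(t\<^sup>q - t)(\<alpha> t + \<beta>)\<close>.  In degree \<open>q + 1\<close> we have \<open>\<alpha> = 0\<close>, and comparing the coefficients of \<open>t\<close> and
  \<open>t\<^sup>q\<close> shows that \<open>A(h, x) = \<nabla>f(x) \<cdot> h\<close> is an alternating bilinear form on rational vectors.  A line
  spanned by \<open>u, v\<close> with \<open>A(u, v) \<noteq> 0\<close> is transverse, and on an odd-dimensional subspace \<open>A\<close> is
  degenerate, which produces a rational point of tangency.  In degree \<open>q + 2\<close> the root of \<open>\<alpha> t + \<beta>\<close>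
  (or \<open>v\<close>, if \<open>\<alpha> = 0\<close>) is a point of tangency of the line.

  For planes in degree \<open>q + 2\<close> and \<open>q\<close> odd, \<open>f(x) = T(x\<^sup>q, x, x)\<close> for a trilinear form \<open>T\<close> over \<open>F\<^sub>q\<close>
  that is symmetric in its last two arguments and whose cyclic sums vanish.  A plane section is
  \<open>det (x, x\<^sup>q, B x)\<close> with a \<open>3 \<times> 3\<close> matrix \<open>B\<close> over \<open>F\<^sub>q\<close>; a singular point over the closure forces a
  rational eigenvalue of \<open>B\<close>, and an eigenvector is a rational singular point.  Hence if every plane
  is tangent, then the Gauss map \<open>x \<mapsto> T(\<cdot>, x, x)\<close> is onto, so bijective, on rational points.
  Injectivity and polarisation make every quadratic form \<open>T(y, \<cdot>, \<cdot>)\<close> nondegenerate, while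
  bijectivity gives it exactly \<open>q\<^sup>3\<close> zeros in \<open>F\<^sub>q\<^sup>4\<close>.  It also vanishes at \<open>y\<close>, and a nondegenerate
  isotropic form in four variables never has \<open>q\<^sup>3\<close> zeros.
\<close>

section \<open>Finite fields and their algebraic closure\<close>

lemma card_field_ge_2: "CARD('a :: {field, finite}) \<ge> 2"
proof -
  have "card {0, 1 :: 'a} \<le> CARD('a)"
    by (intro card_mono) auto
  then show ?thesis by simp
qed

text \<open>Multiplication by a nonzero \<open>x\<close> permutes the nonzero elements, so their
  product absorbs the factor \<open>x ^ (q - 1)\<close>, which must be 1; here and below q stands
  for \<open>CARD('a)\<close>.\<close>

lemma finite_field_power_card:
  fixes x :: "'a :: {field, finite}"
  shows "x ^ CARD('a) = x"
proof (cases "x = 0")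
  case True
  then show ?thesis using card_field_ge_2[where 'a='a] by (simp add: zero_power)
next
  case False
  have "(\<Prod>y\<in>UNIV - {0}. x * y) = (\<Prod>y\<in>UNIV - {0}. y)"
    using False
    by (intro prod.reindex_bij_witness[where i = "\<lambda>y. y / x" and j = "\<lambda>y. x * y"]) auto
  then have "x ^ (CARD('a) - 1) * (\<Prod>y\<in>UNIV - {0}. y) = (\<Prod>y\<in>UNIV - {0::'a}. y)"
    by (simp add: prod.distrib)
  then have "x ^ (CARD('a) - 1) = 1" by simp
  moreover have "x ^ CARD('a) = x ^ (CARD('a) - 1) * x"
    by (simp flip: power_Suc2)
  ultimately show ?thesis by simp
qed

text \<open>Translation by 1 permutes the field, so the sum of all \<open>y + 1\<close> equals the
  sum of all \<open>y\<close>.\<close>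

lemma of_nat_card_field: "of_nat CARD('a) = (0 :: 'a :: {field, finite})"
proof -
  have "(\<Sum>y\<in>UNIV. y + 1) = (\<Sum>y\<in>UNIV. y :: 'a)"
    by (intro sum.reindex_bij_witness[where i = "\<lambda>y. y - 1" and j = "\<lambda>y. y + 1"]) auto
  then show ?thesis by (simp add: sum.distrib)
qed

lemma of_nat_card_alg_closure: "of_nat CARD('a) = (0 :: 'a :: {field, finite} alg_closure)"
  using of_nat_card_field[where 'a='a] by (metis to_ac_0 to_ac_of_nat)

lemma infinite_UNIV_alg_closed: "infinite (UNIV :: 'a :: alg_closed_field set)"
proof
  assume fin: "finite (UNIV :: 'a set)"
  define p :: "'a poly" where "p = (\<Prod>a\<in>UNIV. [:-a, 1:]) + 1"
  have ev: "poly p x = 1" for x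
  proof -
    have "poly (\<Prod>a\<in>UNIV. [:-a, 1:]) x = 0"
      using fin by (auto simp: poly_prod intro!: prod_zero)
    then show ?thesis by (simp add: p_def)
  qed
  have "degree (\<Prod>a\<in>UNIV. [:-a, 1 :: 'a:]) > 0"
    by (subst degree_prod_sum_eq) (use fin in \<open>auto simp: card_gt_0_iff\<close>)
  then have "degree p > 0"
    unfolding p_def by (subst degree_add_eq_left) auto
  then obtain x where "poly p x = 0"
    using alg_closed_imp_poly_has_root by blast
  with ev show False by simp
qed

lemma poly_eqI_infinite:
  fixes p q :: "'a :: {comm_ring_1, ring_no_zero_divisors} poly"
  assumes "infinite A" "\<And>x. x \<in> A \<Longrightarrow> poly p x = poly q x"
  shows "p = q"
proof (rule ccontr)
  assume "p \<noteq> q"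
  then have "finite {x. poly (p - q) x = 0}"
    by (intro poly_roots_finite) simp
  moreover have "A \<subseteq> {x. poly (p - q) x = 0}" using assms by auto
  ultimately show False using assms(1) finite_subset by blast
qed

section \<open>The q-power map on the algebraic closure\<close>

lemma card_range_to_ac: "card (range (to_ac :: 'a :: {field,finite} \<Rightarrow> _)) = CARD('a)"
  by (simp add: card_image inj_to_ac)

text \<open>Additivity follows from counting roots, without writing q as a prime power: in
  \<open>(1 + X)^q - X^q\<close> the leading terms cancel, and the value is 1 at the q elements of
  the base field, so the polynomial is constant. Evaluating at \<open>x / y\<close> and clearing
  denominators gives the general case.\<close>

lemma power_card_add:
  fixes x y :: "'a :: {field, finite} alg_closure"
  shows "(x + y) ^ CARD('a) = x ^ CARD('a) + y ^ CARD('a)"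
proof (cases "y = 0")
  case True
  then show ?thesis using card_field_ge_2[where 'a='a] by (simp add: zero_power)
next
  case False
  let ?q = "CARD('a)"
  define p :: "'a alg_closure poly" where "p = [:1, 1:] ^ ?q - monom 1 ?q"
  have q: "?q > 0" by simp
  have deg: "degree p < ?q"
  proof -
    have "degree p \<le> ?q" unfolding p_def
      by (intro degree_diff_le) (auto simp: degree_power_eq degree_monom_le)
    moreover have "coeff p ?q = 0"
      using coeff_linear_power[of "1::'a alg_closure" ?q] by (simp add: p_def)
    ultimately show ?thesis
      using q by (metis degree_0 leading_coeff_0_iff order_le_less)
  qed
  have "p = 1"
  proof (rule poly_eqI_degree[where A = "range to_ac"])
    fix z :: "'a alg_closure" assume "z \<in> range to_ac"
    then obtain a where a: "z = to_ac a" by auto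
    have "(1 + a) ^ ?q - a ^ ?q = 1" by (simp only: finite_field_power_card) simp
    then have "to_ac ((1 + a) ^ ?q - a ^ ?q) = 1" by simp
    then show "poly p z = poly 1 z" by (simp add: p_def a poly_monom)
  qed (use deg in \<open>auto simp: card_range_to_ac\<close>)
  then have "poly p (x / y) = 1" by simp
  then have "(1 + x / y) ^ ?q = (x / y) ^ ?q + 1" by (simp add: p_def poly_monom algebra_simps)
  moreover have "(x + y) ^ ?q = y ^ ?q * (1 + x / y) ^ ?q"
    using False by (simp flip: power_mult_distrib add: algebra_simps)
  ultimately show ?thesis using False by (simp add: algebra_simps power_divide)
qed

lemma power_card_to_ac [simp]: "to_ac (a :: 'a :: {field, finite}) ^ CARD('a) = to_ac a"
  by (metis to_ac_power finite_field_power_card)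

text \<open>\<open>X^q - X\<close> has at most q roots, and the embedded base field already supplies
  q of them.\<close>

lemma power_card_eq_self_imp_range:
  fixes x :: "'a :: {field, finite} alg_closure"
  assumes "x ^ CARD('a) = x"
  shows "x \<in> range to_ac"
proof (rule ccontr)
  assume x: "x \<notin> range to_ac"
  let ?q = "CARD('a)"
  define p :: "'a alg_closure poly" where "p = monom 1 ?q - [:0, 1:]"
  have "coeff p ?q = 1"
    using card_field_ge_2[where 'a='a] by (auto simp: p_def coeff_pCons split: nat.splits)
  then have "p \<noteq> 0" by auto
  have "degree p \<le> ?q"
    unfolding p_def using card_field_ge_2[where 'a='a] by (intro degree_diff_le) (auto simp: degree_monom_le)
  have "insert x (range to_ac) \<subseteq> {z. poly p z = 0}"
    using assms by (auto simp: p_def poly_monom)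
  then have "card (insert x (range to_ac)) \<le> card {z. poly p z = 0}"
    by (intro card_mono poly_roots_finite \<open>p \<noteq> 0\<close>)
  also have "\<dots> \<le> degree p" by (rule card_poly_roots_bound[OF \<open>p \<noteq> 0\<close>])
  also note \<open>degree p \<le> ?q\<close>
  finally show False using x by (simp add: card_range_to_ac)
qed

section \<open>Power sums over the base field\<close>

text \<open>Rescaling by a nonzero \<open>g\<close> with \<open>g ^ e \<noteq> 1\<close> permutes
  the summands and multiplies the sum by \<open>g ^ e\<close>. Such a \<open>g\<close> exists
  because \<open>X^e - 1\<close> has at most \<open>e < q - 1\<close> roots. For
  \<open>e = 0\<close> the convention \<open>0 ^ 0 = 1\<close> makes the sum equal to q, which is
  0.\<close>

lemma sum_power_card:
  fixes e :: nat
  assumes "e < CARD('a) - 1"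
  shows "(\<Sum>x\<in>UNIV. x ^ e) = (0 :: 'a :: {field, finite})"
proof (cases "e = 0")
  case True
  then show ?thesis by (simp add: of_nat_card_field)
next
  case False
  define p :: "'a poly" where "p = monom 1 e - 1"
  have "coeff p e = 1" using False by (simp add: p_def)
  then have "p \<noteq> 0" by auto
  have "card {z. poly p z = 0} \<le> degree p" by (rule card_poly_roots_bound[OF \<open>p \<noteq> 0\<close>])
  also have "degree p \<le> e" unfolding p_def by (intro degree_diff_le) (auto simp: degree_monom_le)
  also have "e < card (UNIV - {0 :: 'a})" using assms by simp
  finally have "\<not> (UNIV - {0 :: 'a}) \<subseteq> {z. poly p z = 0}"
    by (metis card_mono finite leD)
  then obtain g :: 'a where g: "g \<noteq> 0" "g ^ e \<noteq> 1" by (auto simp: p_def poly_monom)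
  have "(\<Sum>x\<in>UNIV. (g * x) ^ e) = (\<Sum>x\<in>UNIV. x ^ e)"
    using g(1) by (intro sum.reindex_bij_witness[where i = "\<lambda>y. y / g" and j = "\<lambda>y.
        g * y"]) auto
  then have "g ^ e * (\<Sum>x\<in>UNIV. x ^ e) = (\<Sum>x\<in>UNIV. x ^ e)"
    by (simp add: power_mult_distrib sum_distrib_left)
  then show ?thesis using g by simp
qed

lemma sum_power_card_minus_1: "(\<Sum>x\<in>UNIV. x ^ (CARD('a) - 1)) = (-1 :: 'a :: {field, finite})"
proof -
  have *: "x ^ (CARD('a) - 1) = (if x = 0 then 0 else 1)" for x :: 'a
  proof (cases "x = 0")
    case False
    have "x ^ (CARD('a) - 1) * x = 1 * x"
      using finite_field_power_card[of x]
      by (simp flip: power_Suc2)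
    with False show ?thesis by simp
  qed (use card_field_ge_2[where 'a='a] in \<open>auto simp: zero_power\<close>)
  have "(\<Sum>x\<in>UNIV. x ^ (CARD('a) - 1)) = (\<Sum>x\<in>UNIV - {0 :: 'a}. 1 :: 'a)"
    unfolding * by (rule sum.mono_neutral_cong_right) auto
  also have "\<dots> = of_nat (CARD('a) - 1)" by simp
  also have "\<dots> = -1" by (subst of_nat_diff) (auto simp: of_nat_card_field Suc_le_eq)
  finally show ?thesis .
qed

section \<open>Vectors over a finite field\<close>

text \<open>Coordinates run from 0 to \<open>n\<close>, so the dimension is \<open>n + 1\<close>;
  this is \<open>coord_vectors n\<close> with the zero vector added.\<close>

definition vecs :: "nat \<Rightarrow> (nat \<Rightarrow> 'k::field) set" where
  "vecs n = {x. \<forall>i>n. x i = 0}"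

definition dot :: "nat \<Rightarrow> (nat \<Rightarrow> 'k::field) \<Rightarrow> (nat \<Rightarrow>
    'k) \<Rightarrow> 'k" where
  "dot n g x = (\<Sum>i\<le>n. g i * x i)"

definition unit_vec :: "nat \<Rightarrow> nat \<Rightarrow> 'k::field" where
  "unit_vec i j = (if j = i then 1 else 0)"

definition lin_subspace :: "(nat \<Rightarrow> 'k::field) set \<Rightarrow> bool" where
  "lin_subspace W \<longleftrightarrow> (\<lambda>_. 0) \<in> W \<and> (\<forall>x\<in>W.
      \<forall>y\<in>W. \<forall>c. (\<lambda>i. x i + c * y i) \<in> W)"

text \<open>Additivity and homogeneity are merged into one equation. It ranges over all sequences
  rather than a subspace, so that applying it needs no membership conditions.\<close>

definition lin_functional :: "((nat \<Rightarrow> 'k::field) \<Rightarrow> 'k) \<Rightarrow> bool" where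
  "lin_functional g \<longleftrightarrow> (\<forall>x y c. g (\<lambda>i. x i + c * y i) = g x + c * g y)"

lemma lin_functional_zero:
  assumes "lin_functional g"
  shows "g (\<lambda>_. 0) = 0"
  using assms[unfolded lin_functional_def, rule_format, of "\<lambda>_. 0" "-1" "\<lambda>_. 0"] by simp

lemma lin_functional_scale:
  assumes "lin_functional g"
  shows "g (\<lambda>i. c * x i) = c * g x"
  using assms[unfolded lin_functional_def, rule_format, of "\<lambda>_. 0" c x]
    lin_functional_zero[OF assms] by simp

lemma lin_functional_dot: "lin_functional (dot n g)"
  by (simp add: lin_functional_def dot_def sum.distrib sum_distrib_left algebra_simps)

lemma lin_subspaceD:
  assumes "lin_subspace W"
  shows "(\<lambda>_. 0) \<in> W" "x \<in> W \<Longrightarrow> y \<in> W \<Longrightarrow>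
      (\<lambda>i. x i + c * y i) \<in> W"
  using assms by (auto simp: lin_subspace_def)

lemma lin_subspace_scale:
  assumes "lin_subspace W" "x \<in> W"
  shows "(\<lambda>i. c * x i) \<in> W"
  using lin_subspaceD(2)[OF assms(1) lin_subspaceD(1)[OF assms(1)] assms(2), of c] by simp

lemma lin_subspace_vecs: "lin_subspace (vecs n)"
  by (auto simp: lin_subspace_def vecs_def)

lemma lin_subspace_kernel:
  assumes "lin_subspace W" "lin_functional g"
  shows "lin_subspace {w \<in> W. g w = 0}"
  using assms by (auto simp: lin_subspace_def lin_functional_zero) (auto simp: lin_functional_def)

lemma dot_unit_vec: "i \<le> n \<Longrightarrow> dot n g (unit_vec i) = g i"
  by (simp add: dot_def unit_vec_def if_distrib[of "\<lambda>u. _ * u"] cong: if_cong)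

lemma unit_vec_in_vecs: "i \<le> n \<Longrightarrow> unit_vec i \<in> vecs n"
  by (simp add: vecs_def unit_vec_def)

lemma unit_vec_nonzero: "unit_vec i \<noteq> (\<lambda>_. 0)"
  using fun_cong[of "unit_vec i" "\<lambda>_. 0" i] by (auto simp: unit_vec_def)

lemma card_vecs: "finite (vecs n :: (nat \<Rightarrow> 'k::{field, finite}) set)
    \<and> card (vecs n :: (nat \<Rightarrow> 'k) set) = CARD('k) ^ (n + 1)"
proof -
  have "bij_betw (\<lambda>x. restrict x {..n}) (vecs n :: (nat \<Rightarrow> 'k) set) ({..n}
      \<rightarrow>\<^sub>E UNIV)"
  proof (rule bij_betw_byWitness[where f' = "\<lambda>y i. if i \<le> n then y i else 0"])
    show "(\<lambda>x. restrict x {..n}) ` vecs n \<subseteq> ({..n} \<rightarrow>\<^sub>E (UNIV ::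
        'k set))" by (auto simp: restrict_def split: if_splits)
  qed (auto simp: vecs_def fun_eq_iff PiE_def extensional_def)
  then show ?thesis
    by (auto dest: bij_betw_same_card bij_betw_finite simp: card_PiE finite_PiE)
qed

lemma finite_vecs [simp]: "finite (vecs n :: (nat \<Rightarrow> 'k::{field, finite}) set)"
  using card_vecs by blast

section \<open>Cardinalities of kernels and solution spaces\<close>

text \<open>A vector \<open>e\<close> with \<open>g e = 1\<close> splits \<open>W\<close> into the
  kernel and the line of \<open>e\<close>: \<open>x\<close> corresponds to the pair of
  \<open>g x\<close> and \<open>x - g x * e\<close>.\<close>

lemma card_kernel:
  fixes W :: "(nat \<Rightarrow> 'k::{field, finite}) set"
  assumes W: "lin_subspace W" and g: "lin_functional g" and w: "w \<in> W" "g w \<noteq> 0"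
  shows "card W = CARD('k) * card {w \<in> W. g w = 0}"
proof -
  define e where "e = (\<lambda>i. inverse (g w) * w i)"
  have e: "e \<in> W" unfolding e_def by (rule lin_subspace_scale[OF W w(1)])
  have ge: "g e = 1" unfolding e_def by (subst lin_functional_scale[OF g]) (use w in auto)
  have lin: "g (\<lambda>i. x i + c * y i) = g x + c * g y" for x y c
    using g by (simp add: lin_functional_def)
  have "bij_betw (\<lambda>(c, u). (\<lambda>i. u i + c * e i)) (UNIV \<times> {w \<in> W. g w = 0}) W"
    by (rule bij_betw_byWitness[where f' = "\<lambda>x. (g x, \<lambda>i. x i + (- g x) * e i)"])
       (use lin ge in \<open>auto simp: lin simp del: mult_minus_left intro!: lin_subspaceD(2)[OF
           W] e\<close>, auto)
  then show ?thesis by (auto dest: bij_betw_same_card simp: card_cartesian_product)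
qed

text \<open>The rational vector space under the flat cut out by the first \<open>r\<close> forms of
  \<open>l\<close>. Dimensions of such spaces are always measured by their cardinality.\<close>

definition solutions :: "nat \<Rightarrow> nat \<Rightarrow> (nat \<Rightarrow> nat \<Rightarrow>
    'k::field) \<Rightarrow> (nat \<Rightarrow> 'k) set" where
  "solutions n r l = {x \<in> vecs n. \<forall>j<r. dot n (l j) x = 0}"

lemma lin_subspace_solutions: "lin_subspace (solutions n r l)"
proof (induction r)
  case 0
  then show ?case using lin_subspace_vecs by (simp add: solutions_def)
next
  case (Suc r)
  have "solutions n (Suc r) l = {x \<in> solutions n r l. dot n (l r) x = 0}"
    by (auto simp: solutions_def less_Suc_eq)
  then show ?case using lin_subspace_kernel[OF Suc lin_functional_dot] by simp
qed

lemma solutions_Suc: "solutions n (Suc r) l = {x \<in> solutions n r l. dot n (l r) x = 0}"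
  by (auto simp: solutions_def less_Suc_eq)

text \<open>Double annihilator, by induction on the number of forms: a suitable multiple of the last
  form is subtracted from \<open>g\<close> so that the remainder vanishes on the larger solution
  space of the other forms.\<close>

lemma vanish_on_solutions_imp_combination:
  assumes "\<And>x. x \<in> solutions n r l \<Longrightarrow> dot n g x = 0"
  shows "\<exists>c. \<forall>i\<le>n. g i = (\<Sum>j<r. c j * l j i)"
  using assms
proof (induction r arbitrary: g)
  case 0
  have "g i = 0" if "i \<le> n" for i
    using 0[of "unit_vec i"] that by (simp add: solutions_def unit_vec_in_vecs dot_unit_vec)
  then show ?case by simp
next
  case (Suc r)
  show ?case
  proof (cases "\<forall>x\<in>solutions n r l. dot n (l r) x = 0")
    case True
    then obtain c where c: "\<forall>i\<le>n. g i = (\<Sum>j<r. c j * l j i)"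
      using Suc.IH[of g] Suc.prems by (auto simp: solutions_Suc)
    then show ?thesis by (intro exI[of _ "\<lambda>j. if j < r then c j else 0"]) auto
  next
    case False
    then obtain w where w: "w \<in> solutions n r l" "dot n (l r) w \<noteq> 0" by auto
    define e where "e = (\<lambda>i. inverse (dot n (l r) w) * w i)"
    have e: "e \<in> solutions n r l"
      unfolding e_def by (rule lin_subspace_scale[OF lin_subspace_solutions w(1)])
    have le: "dot n (l r) e = 1"
      unfolding e_def by (subst lin_functional_scale[OF lin_functional_dot]) (use w in auto)
    have lin: "dot n h (\<lambda>i. x i + c * y i) = dot n h x + c * dot n h y" for x y c h
      using lin_functional_dot[of n h] by (simp add: lin_functional_def)
    define g' where "g' = (\<lambda>i. g i - dot n g e * l r i)"
    have dg': "dot n g' x = dot n g x - dot n g e * dot n (l r) x" for x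
      by (simp add: dot_def g'_def sum_subtractf sum_distrib_left algebra_simps)
    have "dot n g' x = 0" if x: "x \<in> solutions n r l" for x
    proof -
      \<comment> \<open>As \<open>e\<close> solves the first \<open>r\<close> equations and has
        value 1 under \<open>l r\<close>, this correction moves \<open>x\<close> into the kernel of
        \<open>l r\<close> and keeps the other equations.\<close>
      have "(\<lambda>i. x i + (- dot n (l r) x) * e i) \<in> solutions n (Suc r) l"
        unfolding solutions_Suc mem_Collect_eq lin
        using lin_subspaceD(2)[OF lin_subspace_solutions x e, of "- dot n (l r) x"] le by simp
      from Suc.prems[OF this] have "dot n g x - dot n (l r) x * dot n g e = 0"
        unfolding lin by simp
      then show ?thesis by (simp add: dg')
    qed
    then obtain c where c: "\<forall>i\<le>n. g' i = (\<Sum>j<r. c j * l j i)" using Suc.IH[of g'] by auto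
    have "g i = (\<Sum>j<Suc r. (if j < r then c j else dot n g e) * l j i)" if "i \<le> n" for i
      using c that by (auto simp: g'_def algebra_simps)
    then show ?thesis by (intro exI[of _ "\<lambda>j. if j < r then c j else dot n g e"]) auto
  qed
qed

text \<open>Each new form divides the count by q, since a form vanishing on the previous solutions
  would be a combination of the earlier forms.\<close>

lemma card_solutions:
  fixes l :: "nat \<Rightarrow> nat \<Rightarrow> 'k::{field, finite}"
  assumes "lin_indep_forms n r l" "r \<le> n + 1"
  shows "card (solutions n r l) = CARD('k) ^ (n + 1 - r)"
  using assms
proof (induction r)
  case 0
  then show ?case by (simp add: solutions_def card_vecs)
next
  case (Suc r)
  have ind: "lin_indep_forms n r l"
    unfolding lin_indep_forms_def
  proof (intro allI impI)
    fix c j assume c: "\<forall>i\<le>n. (\<Sum>j<r. c j * l j i) = 0" and "j < r"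
    have "\<forall>i\<le>n. (\<Sum>j<Suc r. (if j < r then c j else 0) * l j i) = 0"
      using c by simp
    with Suc.prems(1)[unfolded lin_indep_forms_def, rule_format, of "\<lambda>j. if j < r then c j else 0"]
    have "\<forall>j<Suc r. (if j < r then c j else 0) = 0" by blast
    with \<open>j < r\<close> show "c j = 0" by (auto dest: spec[of _ j])
  qed
  have "\<exists>w\<in>solutions n r l. dot n (l r) w \<noteq> 0"
  proof (rule ccontr)
    assume "\<not> ?thesis"
    then obtain c where c: "\<forall>i\<le>n. l r i = (\<Sum>j<r. c j * l j i)"
      using vanish_on_solutions_imp_combination[of n r l "l r"] by auto
    \<comment> \<open>The coefficient -1 at \<open>l r\<close> turns the combination into a
      nontrivial relation.\<close>
    have "\<forall>i\<le>n. (\<Sum>j<Suc r. (if j < r then c j else -1) * l j i) = 0"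
      using c by simp
    with Suc.prems(1)[unfolded lin_indep_forms_def, rule_format, of "\<lambda>j. if j < r then c j else -1"]
    have "\<forall>j<Suc r. (if j < r then c j else -1) = 0" by blast
    then show False by (auto dest: spec[of _ r])
  qed
  then obtain w where w: "w \<in> solutions n r l" "dot n (l r) w \<noteq> 0" by auto
  have "CARD('k) * CARD('k) ^ (n - r) = CARD('k) * card (solutions n (Suc r) l)"
    using card_kernel[OF lin_subspace_solutions lin_functional_dot w] Suc.IH[OF ind] Suc.prems(2)
    by (simp add: solutions_Suc Suc_diff_le)
  then show ?case by simp
qed

section \<open>Alternating forms and parity of the dimension\<close>

text \<open>A hyperbolic pair \<open>u\<close>, \<open>v\<close> is split off: its orthogonal
  complement \<open>W2\<close> is again nondegenerate and smaller by a factor of q squared, so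
  induction gives an even exponent.\<close>

lemma card_nondegenerate_alternating:
  fixes W :: "(nat \<Rightarrow> 'k::{field, finite}) set"
  assumes "finite W" and "lin_subspace W"
    and "\<And>x. lin_functional (A x)"
    and "\<And>x y. x \<in> W \<Longrightarrow> y \<in> W \<Longrightarrow> A x y = - A y x" and
        "\<And>x. x \<in> W \<Longrightarrow> A x x = 0"
    and "\<And>x. x \<in> W \<Longrightarrow> x \<noteq> (\<lambda>_. 0) \<Longrightarrow>
        \<exists>y\<in>W. A x y \<noteq> 0"
  shows "\<exists>j. card W = CARD('k) ^ (2 * j)"
  using assms
proof (induction "card W" arbitrary: W rule: less_induct)
  case less
  show ?case
  proof (cases "W = {\<lambda>_. 0}")
    case True
    then show ?thesis by (intro exI[of _ 0]) simp
  next
    case False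
    then obtain u where u: "u \<in> W" "u \<noteq> (\<lambda>_. 0)"
      using lin_subspaceD(1)[OF less.prems(2)] by auto
    then obtain v where v: "v \<in> W" "A u v \<noteq> 0" using less.prems(6) by blast
    define W1 where "W1 = {w \<in> W. A u w = 0}"
    define W2 where "W2 = {w \<in> W1. A v w = 0}"
    have s1: "lin_subspace W1"
      unfolding W1_def by (rule lin_subspace_kernel[OF less.prems(2,3)])
    have s2: "lin_subspace W2"
      unfolding W2_def by (rule lin_subspace_kernel[OF s1 less.prems(3)])
    have Avu: "A v u = - A u v" by (rule less.prems(4)[OF v(1) u(1)])
    have c1: "card W = CARD('k) * card W1"
      unfolding W1_def by (rule card_kernel[OF less.prems(2,3) v])
    \<comment> \<open>The vector \<open>u\<close> lies in \<open>W1\<close> because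
      \<open>A u u = 0\<close>, and it shows that \<open>A v\<close> does not vanish on
      \<open>W1\<close>.\<close>
    have c2: "card W1 = CARD('k) * card W2"
      unfolding W2_def
      by (rule card_kernel[OF s1 less.prems(3), of u]) (use u v Avu less.prems(5) in \<open>auto
          simp: W1_def\<close>)
    have sub: "W2 \<subseteq> W" by (auto simp: W2_def W1_def)
    have fin: "finite W2" using finite_subset[OF sub less.prems(1)] .
    have "card W2 < card W"
      using v sub less.prems(1) by (intro psubset_card_mono) (auto simp: W2_def W1_def)
    then have "\<exists>j. card W2 = CARD('k) ^ (2 * j)"
    proof (rule less.hyps[OF _ fin s2 less.prems(3)])
      fix x assume x: "x \<in> W2" "x \<noteq> (\<lambda>_. 0)"
      obtain y where y: "y \<in> W" "A x y \<noteq> 0" using less.prems(6) x sub by blast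
      have lin: "A a (\<lambda>i. x i + c * y i) = A a x + c * A a y" for x y c a
        using less.prems(3)[of a] by (simp add: lin_functional_def)
      have xu: "A x u = 0" "A x v = 0"
        using x u v less.prems(4)[of x u] less.prems(4)[of x v] by (auto simp: W2_def W1_def)
      \<comment> \<open>The projection of \<open>y\<close> to the complement of \<open>u\<close> and
        \<open>v\<close>; pairing with \<open>x\<close> is unchanged because \<open>x\<close> is
        orthogonal to both.\<close>
      define z where "z = (\<lambda>i. (y i + (A v y / A u v) * u i) + (- A u y / A u v) * v i)"
      have "z \<in> W"
        unfolding z_def
        by (rule lin_subspaceD(2)[OF less.prems(2) lin_subspaceD(2)[OF less.prems(2) y(1) u(1)] v(1)])
      moreover have "A u z = 0" "A v z = 0" "A x z = A x y"
        unfolding z_def lin using u v less.prems(5) xu by (simp_all add: Avu)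
      ultimately show "\<exists>y\<in>W2. A x y \<noteq> 0" using y by (auto simp: W2_def W1_def)
    qed (use sub less.prems(4,5) in blast)+
    then obtain j where "card W2 = CARD('k) ^ (2 * j)" by blast
    then have "card W = CARD('k) ^ (2 * Suc j)" by (simp add: c1 c2)
    then show ?thesis by blast
  qed
qed

text \<open>Counting replaces dimension theory: the q multiples of \<open>u\<close> cannot fill
  \<open>W\<close>, and the q squared combinations of independent \<open>u\<close> and
  \<open>v\<close> must.\<close>

lemma two_dim_subspace_basis:
  fixes W :: "(nat \<Rightarrow> 'k::{field, finite}) set"
  assumes W: "lin_subspace W" and card: "card W = CARD('k) ^ 2"
  obtains u v where "u \<in> W" "v \<in> W"
    "\<forall>s t. (\<lambda>i. s * u i + t * v i) = (\<lambda>_. 0) \<longrightarrow> s = 0 \<and> t = 0"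
    "\<forall>w\<in>W. \<exists>s t. w = (\<lambda>i. s * u i + t * v i)"
proof -
  have q: "CARD('k) < card W" "1 < CARD('k)" "0 < CARD('k)"
    using card_field_ge_2[where 'a='k] by (auto simp: card power2_eq_square)
  then have fin: "finite W" by (intro card_ge_0_finite) auto
  have "\<not> W \<subseteq> {\<lambda>_. 0}"
    using card_mono[of "{\<lambda>_. 0}" W] q by auto
  then obtain u where u: "u \<in> W" "u \<noteq> (\<lambda>_. 0)" by auto
  have "\<not> W \<subseteq> range (\<lambda>c i. c * u i)"
  proof
    assume "W \<subseteq> range (\<lambda>c i. c * u i)"
    then have "card W \<le> card (range (\<lambda>c i. c * u i))" by (intro card_mono) auto
    also have "\<dots> \<le> CARD('k)" by (intro card_image_le) auto
    finally show False using q by simp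
  qed
  then obtain v where v: "v \<in> W" "\<And>c. v \<noteq> (\<lambda>i. c * u i)" by blast
  have indep: "s = 0 \<and> t = 0" if "(\<lambda>i. s * u i + t * v i) = (\<lambda>_. 0)" for s t
  proof -
    have *: "s * u i + t * v i = 0" for i using that by (metis (no_types))
    have "t = 0"
    proof (rule ccontr)
      assume "t \<noteq> 0"
      then have "v i = (- s / t) * u i" for i using *[of i]
        by (simp add: field_simps add_eq_0_iff)
      with v(2)[of "- s / t"] show False by auto
    qed
    with * u(2) show ?thesis by auto
  qed
  let ?F = "\<lambda>(s, t). (\<lambda>i. s * u i + t * v i)"
  have sub: "range ?F \<subseteq> W"
  proof -
    have "(\<lambda>i. s * u i + t * v i) \<in> W" for s t
      using lin_subspaceD(2)[OF W lin_subspace_scale[OF W u(1)] v(1)] .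
    then show ?thesis by auto
  qed
  have "inj ?F"
  proof (rule injI, clarsimp)
    fix s t s' t' assume eq: "(\<lambda>i. s * u i + t * v i) = (\<lambda>i. s' * u i + t' * v i)"
    have "(\<lambda>i. (s - s') * u i + (t - t') * v i) = (\<lambda>_. 0)"
      using fun_cong[OF eq] by (auto simp: algebra_simps fun_eq_iff)
    from indep[OF this] show "s = s' \<and> t = t'" by simp
  qed
  then have "card (range ?F) = CARD('k) ^ 2"
    by (simp add: card_image power2_eq_square)
  then have "range ?F = W" using card_subset_eq[OF fin sub] card by simp
  then have "\<exists>s t. w = (\<lambda>i. s * u i + t * v i)" if "w \<in> W" for w
    using that by (auto simp: image_iff)
  with u v indep show thesis by (intro that[of u v]) auto
qed

section \<open>Restriction of forms to lines\<close>

definition monomial_eval :: "(nat \<Rightarrow> 'k::comm_ring_1) \<Rightarrow> (nat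
    \<Rightarrow>\<^sub>0 nat) \<Rightarrow> 'k" where
  "monomial_eval x m = (\<Prod>i\<in>Poly_Mapping.keys m. x i ^ Poly_Mapping.lookup m i)"

lemma monomial_eval_superset:
  assumes "finite A" "Poly_Mapping.keys m \<subseteq> A"
  shows "monomial_eval x m = (\<Prod>i\<in>A. x i ^ Poly_Mapping.lookup m i)"
  unfolding monomial_eval_def
  by (rule prod.mono_neutral_left) (use assms in \<open>auto simp: in_keys_iff\<close>)

lemma monomial_eval_add: "monomial_eval x (m + m') = monomial_eval x m * monomial_eval x m'"
proof -
  let ?A = "Poly_Mapping.keys m \<union> Poly_Mapping.keys m'"
  have "Poly_Mapping.keys (m + m') \<subseteq> ?A" by (rule keys_add)
  then show ?thesis
    by (simp add: monomial_eval_superset[where A = ?A] lookup_add power_add prod.distrib)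
qed

lemma monomial_eval_single: "monomial_eval x (Poly_Mapping.single i e) = x i ^ e"
  by (simp add: monomial_eval_superset[where A = "{i}"])

lemma mpoly_eval_superset:
  assumes "finite A" "Poly_Mapping.keys f \<subseteq> A"
  shows "mpoly_eval f x = (\<Sum>m\<in>A. to_ac (Poly_Mapping.lookup f m) * monomial_eval x m)"
  unfolding mpoly_eval_def monomial_eval_def
  by (rule sum.mono_neutral_left) (use assms in \<open>auto simp: in_keys_iff\<close>)

lemma mpoly_eval_alt:
  "mpoly_eval f x = (\<Sum>m\<in>Poly_Mapping.keys f. to_ac (Poly_Mapping.lookup f m) * monomial_eval x m)"
  by (rule mpoly_eval_superset) auto

lemma mpoly_eval_0 [simp]: "mpoly_eval 0 x = 0"
  by (simp add: mpoly_eval_def)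

lemma mpoly_eval_add: "mpoly_eval (f + g) x = mpoly_eval f x + mpoly_eval g x"
proof -
  let ?A = "Poly_Mapping.keys f \<union> Poly_Mapping.keys g"
  have "Poly_Mapping.keys (f + g) \<subseteq> ?A" by (rule keys_add)
  then show ?thesis
    by (simp add: mpoly_eval_superset[where A = ?A] lookup_add sum.distrib algebra_simps)
qed

lemma mpoly_eval_sum: "mpoly_eval (\<Sum>j\<in>A. f j) x = (\<Sum>j\<in>A. mpoly_eval (f j) x)"
  by (induction A rule: infinite_finite_induct) (simp_all add: mpoly_eval_add)

lemma mpoly_eval_single: "mpoly_eval (Poly_Mapping.single m c) x = to_ac c * monomial_eval x m"
  by (simp add: mpoly_eval_superset[where A = "{m}"])

lemma mpoly_eval_pderiv:
  "mpoly_eval (mpoly_pderiv i f) x = (\<Sum>m\<in>Poly_Mapping.keys f. to_ac (Poly_Mapping.lookup f m) *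
     (of_nat (Poly_Mapping.lookup m i) * monomial_eval x (m - Poly_Mapping.single i 1)))"
  by (simp add: mpoly_pderiv_def mpoly_eval_sum mpoly_eval_single algebra_simps)

section \<open>Directional derivatives and restriction to a line\<close>

definition dir_deriv :: "nat \<Rightarrow> 'a::field mpoly \<Rightarrow> (nat \<Rightarrow> 'a
    alg_closure) \<Rightarrow> (nat \<Rightarrow> 'a alg_closure) \<Rightarrow> 'a alg_closure" where
  "dir_deriv n f x h = (\<Sum>i\<le>n. mpoly_eval (mpoly_pderiv i f) x * h i)"

text \<open>The restriction of \<open>f\<close> to the line \<open>x + t h\<close> as a genuine
  polynomial in \<open>t\<close>, so that its degree, coefficients and formal derivative become
  available.\<close>

definition line_poly :: "'a::field mpoly \<Rightarrow> (nat \<Rightarrow> 'a alg_closure)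
    \<Rightarrow> (nat \<Rightarrow> 'a alg_closure) \<Rightarrow> 'a alg_closure poly" where
  "line_poly f x h = (\<Sum>m\<in>Poly_Mapping.keys f. smult (to_ac (Poly_Mapping.lookup f m))
     (\<Prod>i\<in>Poly_Mapping.keys m. [:x i, h i:] ^ Poly_Mapping.lookup m i))"

lemma poly_line_poly: "poly (line_poly f x h) t = mpoly_eval f (\<lambda>i. x i + t * h i)"
  by (simp add: line_poly_def mpoly_eval_def poly_sum poly_prod)

lemma monomial_eval_pderiv:
  assumes "i \<in> Poly_Mapping.keys m"
  shows "monomial_eval x (m - Poly_Mapping.single i 1) =
    x i ^ (Poly_Mapping.lookup m i - 1) * (\<Prod>j\<in>Poly_Mapping.keys m - {i}. x j ^
        Poly_Mapping.lookup m j)"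
proof -
  have "Poly_Mapping.keys (m - Poly_Mapping.single i 1) \<subseteq> Poly_Mapping.keys m"
    by (auto simp: in_keys_iff lookup_minus)
  then have "monomial_eval x (m - Poly_Mapping.single i 1) =
    (\<Prod>j\<in>Poly_Mapping.keys m. x j ^ Poly_Mapping.lookup (m - Poly_Mapping.single i 1) j)"
    by (intro monomial_eval_superset) auto
  also have "\<dots> = x i ^ (Poly_Mapping.lookup m i - 1) *
     (\<Prod>j\<in>Poly_Mapping.keys m - {i}. x j ^ Poly_Mapping.lookup (m - Poly_Mapping.single i 1) j)"
    using assms by (subst prod.remove[of _ i]) (auto simp: lookup_minus)
  also have "(\<Prod>j\<in>Poly_Mapping.keys m - {i}. x j ^ Poly_Mapping.lookup (m -
      Poly_Mapping.single i 1) j) =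
      (\<Prod>j\<in>Poly_Mapping.keys m - {i}. x j ^ Poly_Mapping.lookup m j)"
    by (intro prod.cong) (auto simp: lookup_minus lookup_single)
  finally show ?thesis .
qed

lemma poly_pderiv_monomial:
  "poly (pderiv (\<Prod>i\<in>Poly_Mapping.keys m. [:x i, h i:] ^ Poly_Mapping.lookup m i)) t =
     (\<Sum>i\<in>Poly_Mapping.keys m. of_nat (Poly_Mapping.lookup m i) *
        monomial_eval (\<lambda>i. x i + t * h i) (m - Poly_Mapping.single i 1) * h i)"
  unfolding pderiv_prod poly_sum
proof (rule sum.cong)
  fix i assume i: "i \<in> Poly_Mapping.keys m"
  then show "poly (prod (\<lambda>i. [:x i, h i:] ^ Poly_Mapping.lookup m i) (Poly_Mapping.keys m - {i}) *
         pderiv ([:x i, h i:] ^ Poly_Mapping.lookup m i)) t =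
      of_nat (Poly_Mapping.lookup m i) * monomial_eval (\<lambda>i. x i + t * h i) (m -
          Poly_Mapping.single i 1) * h i"
    by (subst monomial_eval_pderiv) (simp_all add: pderiv_power pderiv_pCons poly_prod)
qed simp

lemma homogeneous_formD:
  assumes "homogeneous_form n d f" "m \<in> Poly_Mapping.keys f"
  shows "Poly_Mapping.keys m \<subseteq> {..n}" "(\<Sum>i\<in>Poly_Mapping.keys m.
      Poly_Mapping.lookup m i) = d"
  using assms by (auto simp: homogeneous_form_def)

lemma poly_pderiv_line_poly:
  assumes "homogeneous_form n d f"
  shows "poly (pderiv (line_poly f x h)) t = dir_deriv n f (\<lambda>i. x i + t * h i) h"
proof -
  let ?y = "\<lambda>i. x i + t * h i"
  let ?D = "\<lambda>m i. of_nat (Poly_Mapping.lookup m i) * monomial_eval ?y (m -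
      Poly_Mapping.single i 1) * h i"
  have "poly (pderiv (line_poly f x h)) t =
      (\<Sum>m\<in>Poly_Mapping.keys f. to_ac (Poly_Mapping.lookup f m) *
          (\<Sum>i\<in>Poly_Mapping.keys m. ?D m i))"
    unfolding line_poly_def
    by (simp add: higher_pderiv_sum[of 1, simplified] pderiv_smult poly_sum poly_pderiv_monomial)
  \<comment> \<open>Variables outside the monomial contribute nothing, because their exponent 0
    appears as a factor.\<close>
  also have "\<dots> = (\<Sum>m\<in>Poly_Mapping.keys f. to_ac (Poly_Mapping.lookup f m) *
      (\<Sum>i\<le>n. ?D m i))"
    using homogeneous_formD(1)[OF assms]
    by (intro sum.cong refl arg_cong2[where f = "(*)"] sum.mono_neutral_left) (auto simp: in_keys_iff)
  also have "\<dots> = (\<Sum>i\<le>n. \<Sum>m\<in>Poly_Mapping.keys f. to_ac (Poly_Mapping.lookup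
      f m) * ?D m i)"
    by (simp add: sum_distrib_left) (rule sum.swap)
  also have "\<dots> = dir_deriv n f ?y h"
    by (simp add: dir_deriv_def mpoly_eval_pderiv sum_distrib_right sum_distrib_left mult_ac)
  finally show ?thesis .
qed

lemma monomial_eval_scale:
  "monomial_eval (\<lambda>i. c * x i) m = c ^ (\<Sum>i\<in>Poly_Mapping.keys m.
      Poly_Mapping.lookup m i) * monomial_eval x m"
  by (simp add: monomial_eval_def power_mult_distrib prod.distrib power_sum)

lemma mpoly_eval_scale:
  assumes "homogeneous_form n d f"
  shows "mpoly_eval f (\<lambda>i. c * x i) = c ^ d * mpoly_eval f x"
  unfolding mpoly_eval_alt sum_distrib_left
  by (intro sum.cong) (auto simp: monomial_eval_scale homogeneous_formD(2)[OF assms])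

lemma sum_lookup_minus_single:
  fixes m :: "'b \<Rightarrow>\<^sub>0 nat"
  assumes "i \<in> Poly_Mapping.keys m"
  shows "(\<Sum>j\<in>Poly_Mapping.keys (m - Poly_Mapping.single i 1). Poly_Mapping.lookup (m -
      Poly_Mapping.single i 1) j)
     = (\<Sum>j\<in>Poly_Mapping.keys m. Poly_Mapping.lookup m j) - 1"
proof -
  let ?m = "m - Poly_Mapping.single i 1"
  have "(\<Sum>j\<in>Poly_Mapping.keys ?m. Poly_Mapping.lookup ?m j) =
      (\<Sum>j\<in>Poly_Mapping.keys m. Poly_Mapping.lookup ?m j)"
    by (rule sum.mono_neutral_left) (auto simp: in_keys_iff lookup_minus)
  also have "\<dots> = Poly_Mapping.lookup m i - 1 + (\<Sum>j\<in>Poly_Mapping.keys m - {i}.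
      Poly_Mapping.lookup ?m j)"
    using assms by (subst sum.remove[of _ i]) (auto simp: lookup_minus)
  also have "(\<Sum>j\<in>Poly_Mapping.keys m - {i}. Poly_Mapping.lookup ?m j) =
      (\<Sum>j\<in>Poly_Mapping.keys m - {i}. Poly_Mapping.lookup m j)"
    by (intro sum.cong) (auto simp: lookup_minus lookup_single)
  also have "Poly_Mapping.lookup m i - 1 + (\<Sum>j\<in>Poly_Mapping.keys m - {i}. Poly_Mapping.lookup m j) =
      Poly_Mapping.lookup m i + (\<Sum>j\<in>Poly_Mapping.keys m - {i}. Poly_Mapping.lookup m j) - 1"
    using assms by (auto simp: in_keys_iff)
  also have "\<dots> = (\<Sum>j\<in>Poly_Mapping.keys m. Poly_Mapping.lookup m j) - 1"
    using assms by (subst (2) sum.remove[of _ i]) auto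
  finally show ?thesis .
qed

text \<open>Every term of a partial derivative has degree \<open>d - 1\<close>; where the exponent
  subtraction truncates, the factor \<open>lookup m i\<close> is 0 and both sides vanish.\<close>

lemma dir_deriv_scale:
  assumes "homogeneous_form n d f"
  shows "dir_deriv n f (\<lambda>i. c * x i) h = c ^ (d - 1) * dir_deriv n f x h"
proof -
  have *: "of_nat (Poly_Mapping.lookup m i) * monomial_eval (\<lambda>i. c * x i) (m -
      Poly_Mapping.single i 1) =
      c ^ (d - 1) * (of_nat (Poly_Mapping.lookup m i) * monomial_eval x (m - Poly_Mapping.single i 1))"
    if m: "m \<in> Poly_Mapping.keys f" for m i
  proof (cases "i \<in> Poly_Mapping.keys m")
    case True
    then show ?thesis
      by (simp only: monomial_eval_scale sum_lookup_minus_single[OF True] homogeneous_formD(2)[OF assms m])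
         simp
  qed (simp add: in_keys_iff)
  show ?thesis
    unfolding dir_deriv_def mpoly_eval_pderiv sum_distrib_left sum_distrib_right
    by (intro sum.cong refl) (simp only: *, simp only: mult_ac)
qed

text \<open>All multiples of \<open>x\<close> are zeros of \<open>f\<close>, so the restriction to
  the line from \<open>x\<close> in direction \<open>x\<close> is the zero polynomial, and so is its
  derivative.\<close>

lemma dir_deriv_self:
  assumes f: "homogeneous_form n d f" and x: "mpoly_eval f x = 0"
  shows "dir_deriv n f x x = 0"
proof -
  have "line_poly f x x = 0"
  proof (rule poly_eqI_infinite[OF infinite_UNIV_alg_closed])
    fix t
    have "mpoly_eval f (\<lambda>i. (1 + t) * x i) = 0" by (simp only: mpoly_eval_scale[OF f] x) simp
    then show "poly (line_poly f x x) t = poly 0 t" by (simp add: poly_line_poly algebra_simps)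
  qed
  with poly_pderiv_line_poly[OF f, of x x 0] show ?thesis by simp
qed

lemma degree_line_poly:
  assumes f: "homogeneous_form n d f"
  shows "degree (line_poly f x h) \<le> d"
  unfolding line_poly_def
proof (intro degree_sum_le order.trans[OF degree_smult_le])
  fix m assume m: "m \<in> Poly_Mapping.keys f"
  have "degree (\<Prod>i\<in>Poly_Mapping.keys m. [:x i, h i:] ^ Poly_Mapping.lookup m i) \<le>
      (\<Sum>i\<in>Poly_Mapping.keys m. degree ([:x i, h i:] ^ Poly_Mapping.lookup m i))"
    using degree_prod_sum_le[OF finite_keys] by (simp add: o_def)
  also have "\<dots> \<le> (\<Sum>i\<in>Poly_Mapping.keys m. Poly_Mapping.lookup m i)"
  proof (rule sum_mono)
    fix i
    have "degree ([:x i, h i:] ^ Poly_Mapping.lookup m i) \<le> degree [:x i, h i:] * Poly_Mapping.lookup m i"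
      by (rule degree_power_le)
    also have "\<dots> \<le> 1 * Poly_Mapping.lookup m i" by (intro mult_right_mono) auto
    finally show "degree ([:x i, h i:] ^ Poly_Mapping.lookup m i) \<le> Poly_Mapping.lookup m i" by simp
  qed
  finally show "degree (\<Prod>i\<in>Poly_Mapping.keys m. [:x i, h i:] ^ Poly_Mapping.lookup m i) \<le> d"
    by (simp add: homogeneous_formD(2)[OF f m])
qed auto

text \<open>By homogeneity \<open>f(x + t h)\<close> equals \<open>t^d f(h + x / t)\<close>, so
  exchanging base point and direction reverses the coefficients. This gives access to the
  coefficients near the top degree.\<close>

lemma line_poly_reverse:
  assumes f: "homogeneous_form n d f" and "k \<le> d"
  shows "coeff (line_poly f x h) k = coeff (line_poly f h x) (d - k)"
proof -
  define p where "p = line_poly f h x"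
  define r where "r = (\<Sum>k\<le>d. monom (coeff p (d - k)) k)"
  have "line_poly f x h = r"
  proof (rule poly_eqI_infinite[of "UNIV - {0}"])
    fix t :: "'a alg_closure" assume t: "t \<in> UNIV - {0}"
    have "poly p (inverse t) = (\<Sum>k\<le>d. coeff p k * inverse t ^ k)"
      unfolding poly_altdef using degree_line_poly[OF f, of h x]
      by (intro sum.mono_neutral_left) (auto simp: p_def coeff_eq_0)
    then have "t ^ d * poly p (inverse t) = (\<Sum>k\<le>d. coeff p k * t ^ (d - k))"
      using t by (auto simp: sum_distrib_left power_diff field_simps intro!: sum.cong)
    also have "\<dots> = (\<Sum>k\<le>d. coeff p (d - k) * t ^ k)"
      by (rule sum.reindex_bij_witness[where i = "\<lambda>k. d - k" and j = "\<lambda>k. d - k"]) auto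
    also have "\<dots> = poly r t" by (simp add: r_def poly_sum poly_monom)
    finally have "poly r t = t ^ d * mpoly_eval f (\<lambda>i. h i + inverse t * x i)"
      by (simp add: p_def poly_line_poly)
    also have "\<dots> = mpoly_eval f (\<lambda>i. t * (h i + inverse t * x i))"
      by (rule mpoly_eval_scale[OF f, symmetric])
    also have "(\<lambda>i. t * (h i + inverse t * x i)) = (\<lambda>i. x i + t * h i)"
      using t by (auto simp: algebra_simps)
    finally show "poly (line_poly f x h) t = poly r t" by (simp add: poly_line_poly)
  qed (use infinite_UNIV_alg_closed in auto)
  with assms(2) show ?thesis by (simp add: r_def p_def coeff_sum)
qed

lemma coeff_line_poly_0: "coeff (line_poly f x h) 0 = mpoly_eval f x"
  using poly_line_poly[of f x h 0] by (simp add: poly_0_coeff_0)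

lemma coeff_line_poly_1:
  assumes f: "homogeneous_form n d f"
  shows "coeff (line_poly f x h) 1 = dir_deriv n f x h"
proof -
  have "coeff (line_poly f x h) 1 = poly (pderiv (line_poly f x h)) 0"
    by (simp add: poly_0_coeff_0 coeff_pderiv)
  then show ?thesis using poly_pderiv_line_poly[OF f, of x h 0] by simp
qed

lemma coeff_line_poly_top:
  assumes f: "homogeneous_form n d f"
  shows "coeff (line_poly f x h) d = mpoly_eval f h"
  using line_poly_reverse[OF f, of d x h] by (simp add: coeff_line_poly_0)

lemma coeff_line_poly_subtop:
  assumes f: "homogeneous_form n d f" and "d \<ge> 1"
  shows "coeff (line_poly f x h) (d - 1) = dir_deriv n f h x"
  using line_poly_reverse[OF f, of "d - 1" x h] assms by (simp add: coeff_line_poly_1[OF f, symmetric])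

section \<open>Polynomials vanishing on the base field\<close>

lemma poly_vanish_on_base_field:
  fixes p :: "'a::{field, finite} alg_closure poly"
  assumes deg: "degree p \<le> CARD('a) + 1" and van: "\<And>a :: 'a. poly p (to_ac a) = 0"
  shows "p = (monom 1 CARD('a) - [:0, 1:]) * [:- coeff p 1, coeff p (CARD('a) + 1):]"
proof -
  let ?q = "CARD('a)"
  define v :: "'a alg_closure poly" where "v = monom 1 ?q - [:0, 1:]"
  have q: "?q \<ge> 2" by (rule card_field_ge_2)
  have cv: "coeff v ?q = 1" "coeff v 0 = 0" "coeff v 1 = -1"
    using q by (auto simp: v_def coeff_pCons split: nat.splits)
  have dv: "degree v = ?q"
  proof (rule antisym)
    show "degree v \<le> ?q" unfolding v_def
      using q by (intro degree_diff_le) (auto simp: degree_monom_le)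
  qed (use cv in \<open>auto intro: le_degree\<close>)
  have v0: "v \<noteq> 0" using cv by auto
  \<comment> \<open>The remainder has degree below q but vanishes at q points.\<close>
  have "p mod v = 0"
  proof (rule poly_eqI_degree[where A = "range to_ac"])
    fix z :: "'a alg_closure" assume "z \<in> range to_ac"
    then obtain a where a: "z = to_ac a" by auto
    have "poly v z = 0" by (simp add: v_def a poly_monom)
    moreover have "p = v * (p div v) + p mod v" by simp
    ultimately have "poly p z = poly (p mod v) z"
      by (metis add_0 mult_zero_left poly_add poly_mult)
    then show "poly (p mod v) z = poly 0 z" using van a by simp
  next
    show "degree (p mod v) < card (range (to_ac :: 'a \<Rightarrow> _))"
      using degree_mod_less[OF v0, of p] dv q by (auto simp: card_range_to_ac)
  qed (use q in \<open>auto simp: card_range_to_ac\<close>)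
  then obtain g where g: "p = v * g" by (metis dvdE mod_0_imp_dvd)
  have "degree g \<le> 1"
    using deg v0 by (cases "g = 0") (auto simp: g degree_mult_eq dv)
  then have "g = [:coeff g 0, coeff g 1:]"
    by (intro poly_eqI) (auto simp: coeff_pCons coeff_eq_0 split: nat.splits)
  then obtain a b where ab: "g = [:b, a:]" by blast
  \<comment> \<open>Because q is at least 2, the terms of \<open>X^q - X\<close> do not mix in
    degrees 1 and \<open>q + 1\<close>, and the two coefficients of the cofactor can be read off
    there.\<close>
  have "coeff p 1 = - b" using cv by (simp add: g ab coeff_mult)
  moreover have "coeff p (?q + 1) = a"
    using cv dv by (simp add: g ab coeff_eq_0)
  ultimately show ?thesis by (simp add: g ab v_def)
qed

section \<open>Tangent flats of space-filling hypersurfaces\<close>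

abbreviation to_ac_vec :: "(nat \<Rightarrow> 'a::field) \<Rightarrow> nat \<Rightarrow> 'a alg_closure" where
  "to_ac_vec x \<equiv> (\<lambda>i. to_ac (x i))"

lemma coord_vectors_iff: "x \<in> coord_vectors n \<longleftrightarrow> x \<in> vecs n \<and> x
    \<noteq> (\<lambda>_. 0)"
  by (auto simp: coord_vectors_def vecs_def fun_eq_iff) (meson not_le)

lemma proj_point_self: "x \<in> proj_point x"
  unfolding proj_point_def by (rule CollectI, rule exI[of _ 1]) simp

lemma proj_pointE:
  assumes "y \<in> proj_point x"
  obtains c where "c \<noteq> 0" "y = (\<lambda>i. c * x i)"
  using assms by (auto simp: proj_point_def)

lemma to_ac_vec_eq_0_iff: "to_ac_vec x = (\<lambda>_. 0) \<longleftrightarrow> x = (\<lambda>_. 0)"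
  by (auto simp: fun_eq_iff)

lemma to_ac_vec_in_vecs: "to_ac_vec x \<in> vecs n \<longleftrightarrow> x \<in> vecs n"
  by (auto simp: vecs_def)

lemma to_ac_vec_coord_vectors: "to_ac_vec x \<in> coord_vectors n \<longleftrightarrow> x \<in>
    coord_vectors n"
  by (simp add: coord_vectors_iff to_ac_vec_eq_0_iff to_ac_vec_in_vecs)

lemma proj_point_in_hypersurface_iff:
  assumes "homogeneous_form n d f" "y \<in> coord_vectors n"
  shows "proj_point y \<in> hypersurface n f \<longleftrightarrow> mpoly_eval f y = 0"
proof
  assume "proj_point y \<in> hypersurface n f"
  then show "mpoly_eval f y = 0" using proj_point_self[of y] by (simp add: hypersurface_def)
next
  assume "mpoly_eval f y = 0"
  then show "proj_point y \<in> hypersurface n f"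
    using assms(2)
    by (auto simp: hypersurface_def proj_space_def elim!: proj_pointE simp: mpoly_eval_scale[OF assms(1)])
qed

lemma space_filling_eval:
  assumes f: "homogeneous_form n d f" "d \<ge> 1" and sf: "space_filling n f" and x: "x \<in> vecs n"
  shows "mpoly_eval f (to_ac_vec x) = 0"
proof (cases "x = (\<lambda>_. 0)")
  case True
  then show ?thesis using mpoly_eval_scale[OF f(1), of 0 "\<lambda>_. 0"] f(2) by (simp add: zero_power)
next
  case False
  with x have x': "x \<in> coord_vectors n" by (simp add: coord_vectors_iff)
  then have "proj_point (to_ac_vec x) \<in> rational_points n" by (auto simp: rational_points_def)
  with sf have "proj_point (to_ac_vec x) \<in> hypersurface n f" by (auto simp: space_filling_def)
  then show ?thesis using proj_point_in_hypersurface_iff[OF f(1)] x' by (simp add: to_ac_vec_coord_vectors)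
qed

lemma smooth_hypersurfaceD:
  assumes f: "homogeneous_form n d f" and sm: "smooth_hypersurface n f"
    and y: "y \<in> vecs n" "y \<noteq> (\<lambda>_. 0)" "mpoly_eval f y = 0"
  shows "\<exists>i\<le>n. mpoly_eval (mpoly_pderiv i f) y \<noteq> 0"
proof -
  have "proj_point y \<in> hypersurface n f"
    using y by (subst proj_point_in_hypersurface_iff[OF f]) (auto simp: coord_vectors_iff)
  then have "smooth_at n f (proj_point y)" using sm by (auto simp: smooth_hypersurface_def)
  then show ?thesis using proj_point_self[of y] by (auto simp: smooth_at_def)
qed

lemma mpoly_eval_to_ac_vec: "\<exists>a. mpoly_eval f (to_ac_vec x) = to_ac a"
  by (rule exI[of _ "\<Sum>m\<in>Poly_Mapping.keys f. Poly_Mapping.lookup f m *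
      (\<Prod>i\<in>Poly_Mapping.keys m. x i ^ Poly_Mapping.lookup m i)"])
     (simp add: mpoly_eval_def to_ac_sum to_ac_prod)

text \<open>The gradient at a rational point as a covector over the base field; pulling back by
  \<open>of_ac\<close> is faithful because the partial derivatives take values in the embedded base
  field there.\<close>

definition rat_grad :: "'a::field mpoly \<Rightarrow> (nat \<Rightarrow> 'a) \<Rightarrow> nat
    \<Rightarrow> 'a" where
  "rat_grad f x i = of_ac (mpoly_eval (mpoly_pderiv i f) (to_ac_vec x))"

lemma to_ac_rat_grad: "to_ac (rat_grad f x i) = mpoly_eval (mpoly_pderiv i f) (to_ac_vec x)"
  using mpoly_eval_to_ac_vec[of "mpoly_pderiv i f" x] by (auto simp: rat_grad_def)

lemma dir_deriv_to_ac_vec: "dir_deriv n f (to_ac_vec x) (to_ac_vec h) = to_ac (dot n (rat_grad f x) h)"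
  by (simp add: dir_deriv_def dot_def to_ac_sum to_ac_rat_grad)

section \<open>Flats and tangency in coordinates\<close>

definition flat_of :: "nat \<Rightarrow> nat \<Rightarrow> (nat \<Rightarrow> nat \<Rightarrow>
    'a::field) \<Rightarrow> 'a ppoint set" where
  "flat_of n r l = {P \<in> proj_space n. \<forall>x\<in>P. \<forall>j<r. (\<Sum>i\<le>n. to_ac (l
      j i) * x i) = 0}"

lemma is_flat_iff:
  "is_flat n k \<pi> \<longleftrightarrow> 1 \<le> k \<and> k \<le> n - 1 \<and> (\<exists>l.
      lin_indep_forms n (n - k) l \<and> \<pi> = flat_of n (n - k) l)"
  by (simp add: is_flat_def flat_of_def)

lemma proj_point_in_flat_iff:
  assumes "y \<in> coord_vectors n"
  shows "proj_point y \<in> flat_of n r l \<longleftrightarrow> (\<forall>j<r. dot n (to_ac_vec (l j)) y = 0)"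
proof -
  have scale: "dot n (to_ac_vec (l j)) (\<lambda>i. c * y i) = c * dot n (to_ac_vec (l j)) y" for c j
    by (rule lin_functional_scale[OF lin_functional_dot])
  show ?thesis
  proof
    assume "proj_point y \<in> flat_of n r l"
    then show "\<forall>j<r. dot n (to_ac_vec (l j)) y = 0"
      using proj_point_self[of y] by (simp add: flat_of_def dot_def)
  next
    assume "\<forall>j<r. dot n (to_ac_vec (l j)) y = 0"
    then show "proj_point y \<in> flat_of n r l"
      using assms by (auto simp: flat_of_def proj_space_def scale dot_def[symmetric] elim!: proj_pointE)
  qed
qed

lemma dot_to_ac_vec: "dot n (to_ac_vec g) (to_ac_vec x) = to_ac (dot n g x)"
  by (simp add: dot_def to_ac_sum)

text \<open>A functional over the base field vanishing on the rational points of a flat is a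
  combination of the defining forms, so it vanishes on all points of the flat.\<close>

lemma tangent_flatI:
  assumes f: "homogeneous_form n d f" "d \<ge> 1" and sf: "space_filling n f"
    and x: "x \<in> solutions n r l" "x \<noteq> (\<lambda>_. 0)"
    and tan: "\<And>h. h \<in> solutions n r l \<Longrightarrow> dot n (rat_grad f x) h = 0"
  shows "tangent_flat n f (flat_of n r l)"
proof -
  let ?P = "proj_point (to_ac_vec x)"
  have x': "x \<in> coord_vectors n" using x by (auto simp: solutions_def coord_vectors_iff)
  then have xv: "x \<in> vecs n" by (simp add: coord_vectors_iff)
  have "?P \<in> hypersurface n f"
    using space_filling_eval[OF f sf xv] x'
    by (subst proj_point_in_hypersurface_iff[OF f(1)]) (auto simp: to_ac_vec_coord_vectors)
  moreover have "?P \<in> flat_of n r l"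
    using x x' by (subst proj_point_in_flat_iff) (auto simp: to_ac_vec_coord_vectors dot_to_ac_vec
        solutions_def)
  moreover have "flat_of n r l \<subseteq> tangent_space n f ?P"
  proof (cases "smooth_at n f ?P")
    case True
    obtain c where c: "\<forall>i\<le>n. rat_grad f x i = (\<Sum>j<r. c j * l j i)"
      using vanish_on_solutions_imp_combination[OF tan] by blast
    have "dir_deriv n f x' y = 0" if Q: "Q \<in> flat_of n r l" "x' \<in> ?P" "y \<in> Q" for x' y Q
    proof -
      from Q(2) obtain a where a: "x' = (\<lambda>i. a * to_ac_vec x i)" by (rule proj_pointE)
      have "dir_deriv n f (to_ac_vec x) y = (\<Sum>i\<le>n. to_ac (\<Sum>j<r. c j * l j i) * y i)"
        using c by (auto simp: dir_deriv_def to_ac_rat_grad[symmetric] intro!: sum.cong)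
      also have "\<dots> = (\<Sum>i\<le>n. \<Sum>j<r. to_ac (c j) * (to_ac (l j i) * y i))"
        by (simp add: to_ac_sum sum_distrib_right mult.assoc)
      also have "\<dots> = (\<Sum>j<r. to_ac (c j) * (\<Sum>i\<le>n. to_ac (l j i) * y i))"
        by (subst sum.swap) (simp add: sum_distrib_left)
      also have "\<dots> = 0" using Q by (auto simp: flat_of_def)
      finally show ?thesis unfolding a dir_deriv_scale[OF f(1)] by simp
    qed
    then show ?thesis using True by (auto simp: tangent_space_def dir_deriv_def flat_of_def)
  qed (auto simp: tangent_space_def flat_of_def)
  ultimately show ?thesis by (auto simp: tangent_flat_def)
qed

text \<open>Smoothness selects the gradient branch of \<open>tangent_space\<close>, so tangency
  becomes a linear condition on vectors. The point \<open>y\<close> has coordinates in the closure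
  and may be irrational.\<close>

lemma tangent_flatD:
  assumes f: "homogeneous_form n d f" and sm: "smooth_hypersurface n f"
    and tan: "tangent_flat n f (flat_of n r l)"
  obtains y where "y \<in> vecs n" "y \<noteq> (\<lambda>_. 0)" "\<forall>j<r. dot n (to_ac_vec (l j)) y = 0"
    "\<forall>h\<in>vecs n. (\<forall>j<r. dot n (to_ac_vec (l j)) h = 0) \<longrightarrow>
        dir_deriv n f y h = 0"
proof -
  from tan obtain P where P: "P \<in> hypersurface n f" "P \<in> flat_of n r l" "flat_of n r l
      \<subseteq> tangent_space n f P"
    by (auto simp: tangent_flat_def)
  then obtain y where y: "y \<in> coord_vectors n" "P = proj_point y" by (auto simp:
      hypersurface_def proj_space_def)
  have sm': "smooth_at n f P" using sm P(1) by (auto simp: smooth_hypersurface_def)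
  have "dir_deriv n f y h = 0" if h: "h \<in> vecs n" "\<And>j. j < r \<Longrightarrow> dot n
      (to_ac_vec (l j)) h = 0" for h
  proof (cases "h = (\<lambda>_. 0)")
    case True
    then show ?thesis by (simp add: dir_deriv_def)
  next
    case False
    with h(1) have h': "h \<in> coord_vectors n" by (simp add: coord_vectors_iff)
    then have "proj_point h \<in> flat_of n r l" using h(2) by (simp add: proj_point_in_flat_iff)
    then have "proj_point h \<in> tangent_space n f P" using P(3) by blast
    then show ?thesis using sm' proj_point_self[of h] proj_point_self[of y]
      unfolding tangent_space_def y(2) dir_deriv_def by auto
  qed
  moreover have "dot n (to_ac_vec (l j)) y = 0" if "j < r" for j
    using P(2) y that by (simp add: proj_point_in_flat_iff)
  ultimately show thesis using y(1) by (intro that[of y]) (auto simp: coord_vectors_iff)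
qed

section \<open>Space-filling forms on rational lines\<close>

text \<open>In degree \<open>q + 2\<close> the top coefficient is the value of \<open>f\<close> at
  the rational vector \<open>h\<close>, hence 0; so in both cases the degree is at most
  \<open>q + 1\<close> and divisibility by \<open>X^q - X\<close> leaves a linear cofactor.\<close>

lemma line_poly_base_field:
  fixes f :: "'a::{field, finite} mpoly"
  assumes f: "homogeneous_form n d f" "d = CARD('a) + 1 \<or> d = CARD('a) + 2" and sf: "space_filling n f"
    and x: "x \<in> vecs n" "h \<in> vecs n"
  shows "line_poly f (to_ac_vec x) (to_ac_vec h) = (monom 1 CARD('a) - [:0, 1:]) *
     [:- dir_deriv n f (to_ac_vec x) (to_ac_vec h), coeff (line_poly f (to_ac_vec x) (to_ac_vec h))
         (CARD('a) + 1):]"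
proof -
  let ?p = "line_poly f (to_ac_vec x) (to_ac_vec h)"
  have d: "d \<ge> 1" using f(2) by auto
  have "poly ?p (to_ac a) = 0" for a
  proof -
    have "(\<lambda>i. x i + a * h i) \<in> vecs n" using x by (auto simp: vecs_def)
    from space_filling_eval[OF f(1) d sf this] show ?thesis by (simp add: poly_line_poly)
  qed
  moreover have "degree ?p \<le> CARD('a) + 1"
  proof (rule degree_le, intro allI impI)
    fix i assume i: "CARD('a) + 1 < i"
    have "coeff ?p d = 0"
      using coeff_line_poly_top[OF f(1)] space_filling_eval[OF f(1) d sf x(2)] by simp
    then show "coeff ?p i = 0"
      using i f(2) degree_line_poly[OF f(1), of "to_ac_vec x" "to_ac_vec h"]
      by (cases "i = d") (auto intro!: coeff_eq_0)
  qed
  ultimately show ?thesis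
    using poly_vanish_on_base_field[of ?p] coeff_line_poly_1[OF f(1)] by simp
qed

text \<open>The derivative of \<open>X^q - X\<close> is -1, since q is 0 in the field. At a rational
  \<open>s\<close> the first term on the right disappears as well.\<close>

lemma poly_pderiv_line_factor:
  fixes s a b :: "'a::{field, finite} alg_closure"
  shows "poly (pderiv ((monom 1 CARD('a) - [:0, 1:]) * [:b, a:])) s
     = a * (s ^ CARD('a) - s) - (a * s + b)"
  unfolding pderiv_mult pderiv_diff pderiv_monom
  by (simp add: pderiv_pCons poly_monom of_nat_card_alg_closure algebra_simps)

text \<open>The cofactor of \<open>X^q - X\<close> is constant, because the coefficient in degree
  \<open>q + 1\<close> is the value of \<open>f\<close> at \<open>h\<close>. The derivative along
  the line is therefore constant, also at parameters \<open>t\<close> outside the base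
  field.\<close>

lemma dir_deriv_on_line_degree_q1:
  fixes f :: "'a::{field, finite} mpoly"
  assumes f: "homogeneous_form n (CARD('a) + 1) f" and sf: "space_filling n f"
    and x: "x \<in> vecs n" "h \<in> vecs n"
  shows "dir_deriv n f (\<lambda>i. to_ac (x i) + t * to_ac (h i)) (to_ac_vec h) = dir_deriv n f
      (to_ac_vec x) (to_ac_vec h)"
proof -
  let ?p = "line_poly f (to_ac_vec x) (to_ac_vec h)"
  have "coeff ?p (CARD('a) + 1) = 0"
    using coeff_line_poly_top[OF f] space_filling_eval[OF f _ sf x(2)] by simp
  then have p: "?p = (monom 1 CARD('a) - [:0, 1:]) * [:- dir_deriv n f (to_ac_vec x) (to_ac_vec h), 0:]"
    using line_poly_base_field[OF f _ sf x] by simp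
  have "dir_deriv n f (\<lambda>i. to_ac (x i) + t * to_ac (h i)) (to_ac_vec h) = poly (pderiv ?p) t"
    by (rule poly_pderiv_line_poly[OF f, symmetric])
  also have "\<dots> = dir_deriv n f (to_ac_vec x) (to_ac_vec h)"
    unfolding p poly_pderiv_line_factor by simp
  finally show ?thesis .
qed

text \<open>In a constant multiple of \<open>X^q - X\<close> the coefficients of degrees 1 and q are
  opposite. They are the derivatives at \<open>x\<close> along \<open>h\<close> and, by reversal, at
  \<open>h\<close> along \<open>x\<close>.\<close>

lemma rat_grad_antisym:
  fixes f :: "'a::{field, finite} mpoly"
  assumes f: "homogeneous_form n (CARD('a) + 1) f" and sf: "space_filling n f"
    and x: "x \<in> vecs n" "h \<in> vecs n"
  shows "dot n (rat_grad f x) h = - dot n (rat_grad f h) x"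
proof -
  let ?p = "line_poly f (to_ac_vec x) (to_ac_vec h)"
  have "coeff ?p (CARD('a) + 1) = 0"
    using coeff_line_poly_top[OF f] space_filling_eval[OF f _ sf x(2)] by simp
  then have p: "?p = (monom 1 CARD('a) - [:0, 1:]) * [:- dir_deriv n f (to_ac_vec x) (to_ac_vec h):]"
    using line_poly_base_field[OF f _ sf x] by simp
  have "coeff ?p CARD('a) = - dir_deriv n f (to_ac_vec x) (to_ac_vec h)"
    using card_field_ge_2[where 'a = 'a]
    by (subst p) (auto simp: mult.commute[of _ "[:_:]"] coeff_pCons split: nat.splits)
  moreover have "coeff ?p CARD('a) = dir_deriv n f (to_ac_vec h) (to_ac_vec x)"
    using coeff_line_poly_subtop[OF f] by simp
  ultimately have "to_ac (dot n (rat_grad f x) h) = to_ac (- dot n (rat_grad f h) x)"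
    by (simp add: dir_deriv_to_ac_vec)
  then show ?thesis by (simp only: to_ac_eq_iff)
qed

lemma rat_grad_self:
  assumes f: "homogeneous_form n d f" "d \<ge> 1" and sf: "space_filling n f" and x: "x \<in> vecs n"
  shows "dot n (rat_grad f x) x = 0"
  using dir_deriv_self[OF f(1) space_filling_eval[OF f sf x]] by (simp add: dir_deriv_to_ac_vec)

section \<open>Hypersurfaces of degree \<open>q + 1\<close>\<close>

theorem degree_q1_flat_transverse_free:
  fixes f :: "'a::{field, finite} mpoly"
  assumes "even k" "1 \<le> k" "k \<le> n - 1"
    and f: "homogeneous_form n (CARD('a) + 1) f" and sf: "space_filling n f"
  shows "flat_transverse_free n k f"
  unfolding flat_transverse_free_def
proof (intro allI impI)
  fix \<pi> :: "'a ppoint set" assume "is_flat n k \<pi>"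
  then obtain l where l: "lin_indep_forms n (n - k) l" "\<pi> = flat_of n (n - k) l" by (auto simp:
      is_flat_iff)
  let ?W = "solutions n (n - k) l"
  have card: "card ?W = CARD('a) ^ (k + 1)"
    using card_solutions[OF l(1)] assms by simp
  have fin: "finite ?W" by (rule finite_subset[OF _ finite_vecs[of n]]) (auto simp: solutions_def)
  have W: "w \<in> vecs n" if "w \<in> ?W" for w using that by (simp add: solutions_def)
  \<comment> \<open>A radical vector of the alternating form on \<open>?W\<close> is a point of
    tangency; it exists because the dimension \<open>k + 1\<close> is odd.\<close>
  have "\<exists>x\<in>?W. x \<noteq> (\<lambda>_. 0) \<and> (\<forall>y\<in>?W. dot n (rat_grad f x) y = 0)"
  proof (rule ccontr)
    assume neg: "\<not> ?thesis"
    have "\<exists>j. card ?W = CARD('a) ^ (2 * j)"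
    proof (rule card_nondegenerate_alternating[OF fin lin_subspace_solutions, where A =
        "\<lambda>x. dot n (rat_grad f x)"])
      fix x y assume "x \<in> ?W" "y \<in> ?W"
      then show "dot n (rat_grad f x) y = - dot n (rat_grad f y) x" by (intro rat_grad_antisym[OF f sf] W)
    qed (use neg rat_grad_self[OF f _ sf] W lin_functional_dot in auto)
    then obtain j where "CARD('a) ^ (k + 1) = CARD('a) ^ (2 * j)" using card by auto
    then have "k + 1 = 2 * j" using card_field_ge_2[where 'a = 'a] by (subst (asm) power_inject_exp) auto
    with \<open>even k\<close> show False by presburger
  qed
  then show "tangent_flat n f \<pi>"
    unfolding l(2) by (auto intro!: tangent_flatI[OF f _ sf])
qed

theorem degree_q1_not_line_transverse_free:
  fixes f :: "'a::{field, finite} mpoly"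
  assumes f: "homogeneous_form 3 (CARD('a) + 1) f" and sf: "space_filling 3 f" and sm:
      "smooth_hypersurface 3 f"
  shows "\<not> line_transverse_free 3 f"
proof
  assume ltf: "line_transverse_free 3 f"
  have e: "unit_vec j \<in> vecs 3" if "j \<le> 3" for j by (rule unit_vec_in_vecs[OF that])
  have "unit_vec 0 \<noteq> (\<lambda>_. 0 :: 'a)" by (auto simp: unit_vec_def fun_eq_iff)
  \<comment> \<open>Smoothness at the first coordinate point gives a nonzero partial derivative,
    hence a pair of unit vectors on which the alternating form does not vanish. The line through
    them will be transverse.\<close>
  with smooth_hypersurfaceD[OF f sm, of "to_ac_vec (unit_vec 0)"] e[of 0] space_filling_eval[OF f _
      sf, of "unit_vec 0"]
  obtain i where i: "i \<le> 3" "mpoly_eval (mpoly_pderiv i f) (to_ac_vec (unit_vec 0)) \<noteq> 0"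
    by (auto simp: to_ac_vec_eq_0_iff to_ac_vec_in_vecs)
  then have gi: "dot 3 (rat_grad f (unit_vec 0)) (unit_vec i) \<noteq> 0"
    by (simp add: dot_unit_vec flip: to_ac_rat_grad)
  have "i \<noteq> 0"
  proof
    assume "i = 0"
    with gi rat_grad_self[OF f _ sf e[of 0]] show False by simp
  qed
  then obtain a b where ab: "{..3} = {0, i, a, b}" "distinct [0, i, a, b]"
  proof -
    have S: "{..3} = {0, 1, 2, 3::nat}" by auto
    have "i = 1 \<or> i = 2 \<or> i = 3" using i \<open>i \<noteq> 0\<close> by linarith
    then show thesis
    proof (elim disjE)
      assume "i = 1" then show thesis using that[of 2 3] S by simp
    next
      assume "i = 2" then show thesis using that[of 1 3] S by (simp add: insert_commute)
    next
      assume "i = 3" then show thesis using that[of 1 2] S by (simp add: insert_commute)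
    qed
  qed
  have ab3: "a \<le> 3" "b \<le> 3" using ab(1) by (metis atMost_iff insertI1 insertI2)+
  \<comment> \<open>The line joining the coordinate points 0 and \<open>i\<close> is cut out by the
    two remaining coordinates \<open>a\<close> and \<open>b\<close>.\<close>
  define l where "l = (\<lambda>j :: nat. if j = 0 then unit_vec a else unit_vec b :: nat \<Rightarrow> 'a)"
  have two: "{..<2} = {0, 1 :: nat}" by auto
  have ind: "lin_indep_forms 3 2 l"
    unfolding lin_indep_forms_def
  proof (intro allI impI)
    fix c j assume c: "\<forall>i\<le>3. (\<Sum>j<2. c j * l j i) = 0" and "j < (2 :: nat)"
    then have "j = 0 \<or> j = 1" by auto
    with spec[OF c, of a] spec[OF c, of b] ab(2) ab3 show "c j = 0"
      by (auto simp: two l_def unit_vec_def)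
  qed
  have "is_flat 3 1 (flat_of 3 2 l)"
    unfolding is_flat_iff using ind by (auto intro!: exI[of _ l])
  with ltf have "tangent_flat 3 f (flat_of 3 2 l)" by (auto simp: flat_transverse_free_def)
  then obtain y where y: "y \<in> vecs 3" "y \<noteq> (\<lambda>_. 0)" "\<forall>j<2. dot 3
      (to_ac_vec (l j)) y = 0"
    and tan: "\<forall>h\<in>vecs 3. (\<forall>j<2. dot 3 (to_ac_vec (l j)) h = 0)
        \<longrightarrow> dir_deriv 3 f y h = 0"
    by (rule tangent_flatD[OF f sm])
  have dl: "dot 3 (to_ac_vec (unit_vec j)) h = h j" if "j \<le> 3" for j and h :: "nat
      \<Rightarrow> 'a alg_closure"
    using that by (simp add: dot_def unit_vec_def if_distrib[of to_ac] if_distrib[of "\<lambda>u. u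
        * _"] cong: if_cong)
  have ya: "y a = 0" "y b = 0"
    using y(3)[rule_format, of 0] y(3)[rule_format, of 1] by (simp_all add: l_def dl ab3)
  have t: "dir_deriv 3 f y (to_ac_vec (unit_vec j)) = 0" if "j = 0 \<or> j = i" for j
  proof (rule tan[rule_format])
    show "to_ac_vec (unit_vec j) \<in> vecs 3" using that i e by (auto simp: to_ac_vec_in_vecs)
    have "a \<noteq> j" "b \<noteq> j" using that ab(2) by auto
    then show "dot 3 (to_ac_vec (l k)) (to_ac_vec (unit_vec j)) = 0" for k
      by (cases "k = 0") (simp_all add: l_def dl ab3, simp_all add: unit_vec_def)
  qed
  define c\<^sub>0 where "c\<^sub>0 = y 0"
  define c where "c = y i"
  have ydec: "y = (\<lambda>k. c\<^sub>0 * to_ac_vec (unit_vec 0) k + c * to_ac_vec (unit_vec i) k)"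
  proof
    fix k
    have "k \<in> {0, i, a, b} \<or> k > 3" unfolding ab(1)[symmetric] by auto
    then consider "k = 0" | "k = i" | "k = a" | "k = b" | "k > 3" by blast
    then show "y k = c\<^sub>0 * to_ac_vec (unit_vec 0) k + c * to_ac_vec (unit_vec i) k"
      using ya y(1) ab(2) i by cases (simp_all add: c\<^sub>0_def c_def unit_vec_def vecs_def)
  qed
  have nz: "dir_deriv 3 f (to_ac_vec (unit_vec 0)) (to_ac_vec (unit_vec i)) \<noteq> 0"
    using gi by (simp add: dir_deriv_to_ac_vec)
  \<comment> \<open>If the coordinate \<open>y 0\<close> is nonzero, \<open>y\<close> is rescaled to
    a point \<open>e_0 + t e_i\<close>, where the derivative along \<open>e_i\<close> has the same
    nonzero value as at \<open>e_0\<close>. Otherwise \<open>y\<close> is a multiple of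
    \<open>e_i\<close>, and antisymmetry makes the derivative along \<open>e_0\<close>
    nonzero.\<close>
  show False
  proof (cases "c\<^sub>0 = 0")
    case False
    then have "y = (\<lambda>k. c\<^sub>0 * (to_ac_vec (unit_vec 0) k + (c / c\<^sub>0) * to_ac_vec
        (unit_vec i) k))"
      unfolding ydec by (simp add: algebra_simps)
    then have "dir_deriv 3 f y (to_ac_vec (unit_vec i)) = c\<^sub>0 ^ CARD('a) *
      dir_deriv 3 f (\<lambda>k. to_ac_vec (unit_vec 0) k + (c / c\<^sub>0) * to_ac_vec (unit_vec
          i) k) (to_ac_vec (unit_vec i))"
      using dir_deriv_scale[OF f] by simp
    also have "\<dots> \<noteq> 0"
      unfolding dir_deriv_on_line_degree_q1[OF f sf e[of 0, simplified] e[OF i(1)]] using False nz by simp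
    finally show False using t[of i] by simp
  next
    case True
    with ydec have yc: "y = (\<lambda>k. c * to_ac_vec (unit_vec i) k)" by simp
    with y(2) have "c \<noteq> 0" by auto
    have "dir_deriv 3 f y (to_ac_vec (unit_vec 0)) = c ^ CARD('a) *
      dir_deriv 3 f (to_ac_vec (unit_vec i)) (to_ac_vec (unit_vec 0))"
      unfolding yc by (simp add: dir_deriv_scale[OF f])
    moreover have "dir_deriv 3 f (to_ac_vec (unit_vec i)) (to_ac_vec (unit_vec 0)) \<noteq> 0"
      using rat_grad_antisym[OF f sf e[of 0] e[OF i(1)]] gi by (simp add: dir_deriv_to_ac_vec)
    ultimately show False using t[of 0] \<open>c \<noteq> 0\<close> by simp
  qed
qed

section \<open>Lines and hypersurfaces of degree \<open>q + 2\<close>\<close>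

theorem degree_q2_line_transverse_free:
  fixes f :: "'a::{field, finite} mpoly"
  assumes n: "n \<ge> 2"
    and f: "homogeneous_form n (CARD('a) + 2) f" and sf: "space_filling n f"
  shows "line_transverse_free n f"
  unfolding flat_transverse_free_def
proof (intro allI impI)
  fix \<pi> :: "'a ppoint set" assume "is_flat n 1 \<pi>"
  then obtain l where l: "lin_indep_forms n (n - 1) l" "\<pi> = flat_of n (n - 1) l" by (auto simp:
      is_flat_iff)
  let ?W = "solutions n (n - 1) l"
  have "card ?W = CARD('a) ^ 2"
    using card_solutions[OF l(1)] n by (simp add: numeral_2_eq_2)
  then obtain u v where uv: "u \<in> ?W" "v \<in> ?W"
    and indep: "\<forall>s t. (\<lambda>i. s * u i + t * v i) = (\<lambda>_. 0) \<longrightarrow> s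
        = 0 \<and> t = 0"
    and spans: "\<forall>w\<in>?W. \<exists>s t. w = (\<lambda>i. s * u i + t * v i)"
    by (rule two_dim_subspace_basis[OF lin_subspace_solutions])
  have W: "w \<in> vecs n" if "w \<in> ?W" for w using that by (simp add: solutions_def)
  let ?p = "line_poly f (to_ac_vec u) (to_ac_vec v)"
  \<comment> \<open>These are the coefficients of the linear cofactor: \<alpha> is the coefficient
    of degree \<open>q + 1\<close>, a derivative at \<open>v\<close> by reversal, and \<beta> is
    minus the coefficient of degree 1.\<close>
  define \<alpha> where "\<alpha> = dot n (rat_grad f v) u"
  define \<beta> where "\<beta> = - dot n (rat_grad f u) v"
  have "coeff ?p (CARD('a) + 1) = to_ac \<alpha>"
    using coeff_line_poly_subtop[OF f, of "to_ac_vec u" "to_ac_vec v"] by (simp add: \<alpha>_def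
        dir_deriv_to_ac_vec)
  then have p: "?p = (monom 1 CARD('a) - [:0, 1:]) * [:to_ac \<beta>, to_ac \<alpha>:]"
    using line_poly_base_field[OF f _ sf W[OF uv(1)] W[OF uv(2)]] by (simp add: \<beta>_def
        dir_deriv_to_ac_vec)
  have combo: "dot n g (\<lambda>i. s * x i + t * y i) = s * dot n g x + t * dot n g y" for g s t
      and x y :: "nat \<Rightarrow> 'a"
    by (simp add: dot_def sum.distrib sum_distrib_left algebra_simps)
  show "tangent_flat n f \<pi>"
  proof (cases "\<alpha> = 0")
    case True
    \<comment> \<open>The cofactor has its root at infinity, so \<open>v\<close> is the point of
      tangency: its gradient kills \<open>u\<close> by assumption and \<open>v\<close>
      always.\<close>
    have "dot n (rat_grad f v) w = 0" if "w \<in> ?W" for w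
      using bspec[OF spans that] True rat_grad_self[OF f _ sf W[OF uv(2)]] by (auto simp: combo \<alpha>_def)
    moreover have "v \<noteq> (\<lambda>_. 0)" using indep[rule_format, of 0 1] by auto
    ultimately show ?thesis unfolding l(2) by (intro tangent_flatI[OF f _ sf uv(2)]) auto
  next
    case False
    \<comment> \<open>At the rational root of the cofactor the restriction of \<open>f\<close> has a
      double root.\<close>
    define s where "s = - \<beta> / \<alpha>"
    define x where "x = (\<lambda>i. u i + s * v i)"
    have x: "x \<in> ?W" unfolding x_def by (rule lin_subspaceD(2)[OF lin_subspace_solutions uv])
    have "to_ac (dot n (rat_grad f x) v) = poly (pderiv ?p) (to_ac s)"
      unfolding poly_pderiv_line_poly[OF f] by (simp add: x_def flip: dir_deriv_to_ac_vec)
    also have "\<dots> = - to_ac (\<alpha> * s + \<beta>)"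
      unfolding p poly_pderiv_line_factor by simp
    also have "\<alpha> * s + \<beta> = 0" using False by (simp add: s_def)
    finally have xv: "dot n (rat_grad f x) v = 0" by simp
    have xx: "dot n (rat_grad f x) x = 0" by (rule rat_grad_self[OF f _ sf W[OF x]]) simp
    \<comment> \<open>The gradient at \<open>x = u + s v\<close> kills \<open>x\<close> and
      \<open>v\<close>, hence also \<open>u\<close> and the whole line.\<close>
    have "dot n (rat_grad f x) x = dot n (rat_grad f x) u + s * dot n (rat_grad f x) v"
      using combo[of _ 1 u s v] by (simp add: x_def)
    with xv xx have "dot n (rat_grad f x) u = 0" by simp
    with xv have "dot n (rat_grad f x) w = 0" if "w \<in> ?W" for w
      using bspec[OF spans that] by (auto simp: combo)
    moreover have "x \<noteq> (\<lambda>_. 0)" using indep[rule_format, of 1 s] by (auto simp: x_def)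
    ultimately show ?thesis unfolding l(2) by (intro tangent_flatI[OF f _ sf x]) auto
  qed
qed

section \<open>Trilinear representation in degree \<open>q + 2\<close>\<close>

definition tri :: "nat \<Rightarrow> (nat \<Rightarrow> nat \<Rightarrow> nat \<Rightarrow>
    'k::field) \<Rightarrow> (nat \<Rightarrow> 'k) \<Rightarrow> (nat \<Rightarrow> 'k)
    \<Rightarrow> (nat \<Rightarrow> 'k) \<Rightarrow> 'k" where
  "tri n T a b c = (\<Sum>i\<le>n. \<Sum>j\<le>n. \<Sum>k\<le>n. T i j k * a i * b j * c k)"

lemma tri_lin1: "tri n T (\<lambda>i. a i + s * a' i) b c = tri n T a b c + s * tri n T a' b c"
  by (simp add: tri_def sum.distrib sum_distrib_left algebra_simps)

lemma tri_lin2: "tri n T a (\<lambda>i. b i + s * b' i) c = tri n T a b c + s * tri n T a b' c"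
  by (simp add: tri_def sum.distrib sum_distrib_left algebra_simps)

lemma tri_lin3: "tri n T a b (\<lambda>i. c i + s * c' i) = tri n T a b c + s * tri n T a b c'"
  by (simp add: tri_def sum.distrib sum_distrib_left algebra_simps)

lemma tri_scale1: "tri n T (\<lambda>i. s * a i) b c = s * tri n T a b c"
  by (simp add: tri_def sum_distrib_left mult_ac)

lemma tri_scale2: "tri n T a (\<lambda>i. s * b i) c = s * tri n T a b c"
  by (simp add: tri_def sum_distrib_left mult_ac)

lemma tri_sym23:
  assumes "\<And>i j k. T i j k = T i k j"
  shows "tri n T a b c = tri n T a c b"
proof -
  have "tri n T a b c = (\<Sum>i\<le>n. \<Sum>j\<le>n. \<Sum>k\<le>n. T i k j * a i * b j * c k)"
    unfolding tri_def by (intro sum.cong refl) (simp only: assms)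
  also have "\<dots> = tri n T a c b"
    unfolding tri_def by (rule sum.cong[OF refl], subst sum.swap) (simp add: mult_ac)
  finally show ?thesis .
qed

lemma to_ac_tri: "tri n (\<lambda>i j k. to_ac (T i j k)) (to_ac_vec a) (to_ac_vec b) (to_ac_vec c)
    = to_ac (tri n T a b c)"
  by (simp add: tri_def to_ac_sum)

lemma tri_add: "tri n (\<lambda>i j k. T i j k + S i j k) a b c = tri n T a b c + tri n S a b c"
  by (simp add: tri_def sum.distrib algebra_simps)

lemma tri_scale: "tri n (\<lambda>i j k. s * T i j k) a b c = s * tri n T a b c"
  by (simp add: tri_def sum_distrib_left mult_ac)

lemma tri_indicator:
  assumes "i \<le> n" "j \<le> n" "k \<le> n"
  shows "tri n (\<lambda>i' j' k'. if i' = i \<and> j' = j \<and> k' = k then s else 0) a b c = s *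
      a i * b j * c k"
proof -
  have *: "(if i' = i \<and> j' = j \<and> k' = k then s else 0) * a i' * b j' * c k' =
     (if i' = i then if j' = j then if k' = k then s * a i * b j * c k else 0 else 0 else 0)" for i' j' k'
    by simp
  have "(\<Sum>k'\<le>n. if i' = i then if j' = j then if k' = k then s * a i * b j * c k else 0
      else 0 else 0) =
     (if i' = i then if j' = j then s * a i * b j * c k else 0 else 0)" for i' j'
    using assms by simp
  moreover have "(\<Sum>j'\<le>n. if i' = i then if j' = j then s * a i * b j * c k else 0 else 0) =
     (if i' = i then s * a i * b j * c k else 0)" for i'
    using assms by simp
  ultimately show ?thesis unfolding tri_def * using assms by simp
qed

section \<open>Monomials of forms vanishing at all rational points\<close>

lemma prod_sum_PiE_UNIV:
  fixes F :: "'b \<Rightarrow> 'c \<Rightarrow> 'd::comm_semiring_1"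
  assumes "finite A" "finite (UNIV :: 'c set)"
  shows "(\<Prod>i\<in>A. \<Sum>a\<in>UNIV. F i a) = (\<Sum>g\<in>PiE A (\<lambda>_. UNIV).
      \<Prod>i\<in>A. F i (g i))"
  using assms(1) prod_sum_PiE[OF assms(1), of "\<lambda>_. UNIV" F] assms(2) by auto

lemma monomial_eval_to_ac_vec: "monomial_eval (to_ac_vec x) m = to_ac (monomial_eval x m)"
  by (simp add: monomial_eval_def to_ac_prod)

definition total_degree :: "('b \<Rightarrow>\<^sub>0 nat) \<Rightarrow> nat" where
  "total_degree m = (\<Sum>i\<in>Poly_Mapping.keys m. Poly_Mapping.lookup m i)"

lemma total_degree_superset:
  "finite A \<Longrightarrow> Poly_Mapping.keys m \<subseteq> A \<Longrightarrow> total_degree m =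
      (\<Sum>i\<in>A. Poly_Mapping.lookup m i)"
  unfolding total_degree_def by (rule sum.mono_neutral_left) (auto simp: in_keys_iff)

text \<open>The power sums over the base field isolate the coefficient of \<open>m\<close>, as in
    the proof of the
  combinatorial Nullstellensatz.\<close>

lemma vanishing_form_has_large_exponent:
  fixes f :: "'a::{field, finite} mpoly"
  assumes f: "homogeneous_form n d f" and van: "\<And>x. x \<in> vecs n \<Longrightarrow>
      mpoly_eval f (to_ac_vec x) = 0"
    and m: "m \<in> Poly_Mapping.keys f"
  shows "\<exists>i\<le>n. Poly_Mapping.lookup m i \<ge> CARD('a)"
proof (rule ccontr)
  assume neg: "\<not> ?thesis"
  have small: "Poly_Mapping.lookup m i \<le> CARD('a) - 1" if "i \<le> n" for i
  proof -
    from that neg have "Poly_Mapping.lookup m i < CARD('a)" by (meson not_le)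
    then show ?thesis by linarith
  qed
  let ?q = "CARD('a)"
  let ?E = "PiE {..n} (\<lambda>_. UNIV :: 'a set)"
  let ?c = "Poly_Mapping.lookup f"
  let ?l = "Poly_Mapping.lookup"
  have zero: "(\<Sum>m'\<in>Poly_Mapping.keys f. ?c m' * (\<Prod>i\<le>n. g i ^ ?l m' i)) = 0" for
      g :: "nat \<Rightarrow> 'a"
  proof -
    define x where "x = (\<lambda>i. if i \<le> n then g i else 0)"
    have "x \<in> vecs n" by (auto simp: x_def vecs_def)
    from van[OF this] have "to_ac (\<Sum>m'\<in>Poly_Mapping.keys f. ?c m' * monomial_eval x m') = 0"
      by (simp add: mpoly_eval_alt to_ac_sum monomial_eval_to_ac_vec)
    then have "(\<Sum>m'\<in>Poly_Mapping.keys f. ?c m' * monomial_eval x m') = 0" by simp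
    moreover have "monomial_eval x m' = (\<Prod>i\<le>n. g i ^ ?l m' i)" if "m' \<in>
        Poly_Mapping.keys f" for m'
      using homogeneous_formD(1)[OF f that]
      by (subst monomial_eval_superset[where A = "{..n}"]) (auto simp: x_def intro!: prod.cong)
    ultimately show ?thesis by simp
  qed
  \<comment> \<open>The weights complement the exponents of \<open>m\<close> to
    \<open>q - 1\<close>. The monomial \<open>m\<close> then contributes a product of power sums
    equal to -1, while all other monomials will drop out.\<close>
  have "0 = (\<Sum>g\<in>?E. (\<Sum>m'\<in>Poly_Mapping.keys f. ?c m' * (\<Prod>i\<le>n. g i ^ ?l
      m' i)) * (\<Prod>i\<le>n. g i ^ (?q - 1 - ?l m i)))"
    by (simp add: zero)
  also have "\<dots> = (\<Sum>g\<in>?E. \<Sum>m'\<in>Poly_Mapping.keys f. ?c m' * (\<Prod>i\<le>n.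
      g i ^ (?l m' i + (?q - 1 - ?l m i))))"
    by (simp add: sum_distrib_right power_add prod.distrib mult.assoc)
  also have "\<dots> = (\<Sum>m'\<in>Poly_Mapping.keys f. ?c m' * (\<Sum>g\<in>?E. \<Prod>i\<le>n.
      g i ^ (?l m' i + (?q - 1 - ?l m i))))"
    by (subst sum.swap) (simp add: sum_distrib_left)
  also have "\<dots> = (\<Sum>m'\<in>Poly_Mapping.keys f. ?c m' * (\<Prod>i\<le>n.
      \<Sum>a\<in>UNIV. a ^ (?l m' i + (?q - 1 - ?l m i))))"
    by (subst prod_sum_PiE_UNIV) auto
  also have "\<dots> = (\<Sum>m'\<in>{m}. ?c m' * (\<Prod>i\<le>n. \<Sum>a\<in>UNIV. a ^ (?l m' i +
      (?q - 1 - ?l m i))))"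
  proof (rule sum.mono_neutral_right)
    show "\<forall>m'\<in>Poly_Mapping.keys f - {m}. ?c m' * (\<Prod>i\<le>n. \<Sum>a\<in>UNIV. a ^
        (?l m' i + (?q - 1 - ?l m i))) = 0"
    proof
      fix m' assume m': "m' \<in> Poly_Mapping.keys f - {m}"
      \<comment> \<open>Distinct monomials of the same degree cannot dominate one another, so some
        exponent of \<open>m'\<close> is smaller and leads to a power sum that is 0.\<close>
      have "\<exists>i\<le>n. ?l m' i < ?l m i"
      proof (rule ccontr)
        assume neg: "\<not> ?thesis"
        have k: "Poly_Mapping.keys m \<subseteq> {..n}" "Poly_Mapping.keys m' \<subseteq> {..n}"
          using homogeneous_formD(1)[OF f] m m' by auto
        have "(\<Sum>i\<le>n. ?l m i) = (\<Sum>i\<le>n. ?l m' i)"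
          using homogeneous_formD(2)[OF f, folded total_degree_def] m m' k
          by (simp add: total_degree_superset[where A = "{..n}", symmetric])
        then have "?l m i = ?l m' i" if "i \<le> n" for i
          using neg that sum_strict_mono_ex1[of "{..n}" "?l m" "?l m'"] by (force simp: not_less)
        then have "?l m i = ?l m' i" for i
          using k by (cases "i \<le> n") (metis atMost_iff in_keys_iff subset_iff)+
        then have "m = m'" by (intro poly_mapping_eqI) auto
        with m' show False by simp
      qed
      then obtain i where i: "i \<le> n" "?l m' i < ?l m i" by auto
      then have "?l m' i + (?q - 1 - ?l m i) < ?q - 1" using small[OF i(1)] by linarith
      then have "(\<Sum>a\<in>UNIV. (a :: 'a) ^ (?l m' i + (?q - 1 - ?l m i))) = 0" by (rule sum_power_card)
      with i(1) show "?c m' * (\<Prod>i\<le>n. \<Sum>a\<in>UNIV. a ^ (?l m' i + (?q - 1 - ?l m i))) = 0"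
        by (subst prod_zero) auto
    qed
  qed (use m in auto)
  also have "\<dots> = ?c m * (\<Prod>i\<le>n. \<Sum>a\<in>UNIV. a ^ (?l m i + (?q - 1 - ?l m i)))" by simp
  also have "(\<Prod>i\<le>n. \<Sum>a\<in>UNIV. a ^ (?l m i + (?q - 1 - ?l m i))) =
      (\<Prod>i\<le>n. (-1 :: 'a))"
  proof (rule prod.cong)
    fix i assume "i \<in> {..n}"
    then have "?l m i + (?q - 1 - ?l m i) = ?q - 1" using small[of i] by simp
    then show "(\<Sum>a\<in>UNIV. a ^ (?l m i + (?q - 1 - ?l m i))) = (-1 :: 'a)" by (simp only:
        sum_power_card_minus_1)
  qed simp
  finally show False using m by (simp add: in_keys_iff)
qed

lemma total_degree_split:
  fixes m :: "'b \<Rightarrow>\<^sub>0 nat"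
  assumes "c \<le> Poly_Mapping.lookup m i" "0 < c"
  obtains m' where "m = Poly_Mapping.single i c + m'" "total_degree m = c + total_degree m'"
      "Poly_Mapping.keys m' \<subseteq> Poly_Mapping.keys m"
proof -
  let ?m' = "m - Poly_Mapping.single i c"
  have m: "m = Poly_Mapping.single i c + ?m'"
    using assms by (intro poly_mapping_eqI) (auto simp: lookup_add lookup_minus lookup_single when_def)
  have keys: "Poly_Mapping.keys ?m' \<subseteq> Poly_Mapping.keys m"
    by (auto simp: in_keys_iff lookup_minus)
  have i: "i \<in> Poly_Mapping.keys m" using assms by (auto simp: in_keys_iff)
  have "total_degree m = (\<Sum>j\<in>Poly_Mapping.keys m. (if j = i then c else 0) +
      Poly_Mapping.lookup ?m' j)"
    unfolding total_degree_def using assms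
    by (intro sum.cong) (auto simp: lookup_minus lookup_single when_def)
  also have "\<dots> = c + total_degree ?m'"
    using i by (simp add: sum.distrib total_degree_superset[OF _ keys])
  finally show thesis using that m keys by blast
qed

lemma total_degree_pos_obtains:
  fixes m :: "'b \<Rightarrow>\<^sub>0 nat"
  assumes "total_degree m > 0"
  obtains i m' where "i \<in> Poly_Mapping.keys m" "m = Poly_Mapping.single i 1 + m'"
    "total_degree m = 1 + total_degree m'" "Poly_Mapping.keys m' \<subseteq> Poly_Mapping.keys m"
proof -
  from assms obtain i where i: "i \<in> Poly_Mapping.keys m"
    by (metis total_degree_def sum.empty less_irrefl ex_in_conv)
  then have "1 \<le> Poly_Mapping.lookup m i" by (auto simp: in_keys_iff Suc_le_eq)
  from total_degree_split[OF this] i show thesis using that by (metis zero_less_one)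
qed

lemma total_degree_0_imp: "total_degree m = 0 \<Longrightarrow> m = 0"
  by (auto simp: total_degree_def in_keys_iff intro!: poly_mapping_eqI)

text \<open>Removing the q-th power leaves total degree 2, which is used up by two variables; the
  indices may coincide with each other or with \<open>i\<close>.\<close>

lemma quadratic_cofactor:
  assumes "total_degree m = q + 2" "q \<le> Poly_Mapping.lookup m i" "0 < q"
  obtains j k where "j \<in> Poly_Mapping.keys m" "k \<in> Poly_Mapping.keys m"
    "m = Poly_Mapping.single i q + (Poly_Mapping.single j 1 + Poly_Mapping.single k 1)"
proof -
  from total_degree_split[OF assms(2,3)] obtain m1 where m1: "m = Poly_Mapping.single i q + m1"
    "total_degree m = q + total_degree m1" "Poly_Mapping.keys m1 \<subseteq> Poly_Mapping.keys m" .
  then have t1: "total_degree m1 = 2" using assms(1) by simp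
  then obtain j m2 where j: "j \<in> Poly_Mapping.keys m1" "m1 = Poly_Mapping.single j 1 + m2"
    "total_degree m1 = 1 + total_degree m2" "Poly_Mapping.keys m2 \<subseteq> Poly_Mapping.keys m1"
    using total_degree_pos_obtains[of m1] by (metis zero_less_numeral)
  then have t2: "total_degree m2 = 1" using t1 by simp
  then obtain k m3 where k: "k \<in> Poly_Mapping.keys m2" "m2 = Poly_Mapping.single k 1 + m3"
    "total_degree m2 = 1 + total_degree m3"
    using total_degree_pos_obtains[of m2] by (metis zero_less_one)
  then have "m3 = 0" using t2 total_degree_0_imp[of m3] by simp
  with m1 j k show thesis using that[of j k] by auto
qed

text \<open>An odd q equals 1 in a field where 2 is 0, but q itself is 0 there.\<close>

lemma two_neq_zero:
  assumes "odd CARD('a::{field, finite})"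
  shows "(2 :: 'a) \<noteq> 0"
proof
  assume 2: "(2 :: 'a) = 0"
  from assms obtain k where "CARD('a) = 2 * k + 1" by (auto elim: oddE)
  then have "(of_nat CARD('a) :: 'a) = 2 * of_nat k + 1" by simp
  with 2 of_nat_card_field[where 'a = 'a] show False by simp
qed

section \<open>From forms of degree \<open>q + 2\<close> to trilinear forms\<close>

text \<open>A large exponent in every monomial gives the shape \<open>x_i^q x_j x_k\<close>; the
  q-th power goes into the first slot of \<open>T\<close>, one indicator tensor per
  monomial.\<close>

lemma trilinear_representation:
  fixes f :: "'a::{field, finite} mpoly"
  assumes f: "homogeneous_form n (CARD('a) + 2) f" and sf: "space_filling n f" and q: "odd CARD('a)"
  obtains T where "\<forall>i j k. T i j k = T i k j"
    "\<forall>x. mpoly_eval f x = tri n (\<lambda>i j k. to_ac (T i j k)) (\<lambda>i. x i ^ CARD('a)) x x"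
proof -
  have "\<exists>T. \<forall>x. (\<Sum>m\<in>S. to_ac (Poly_Mapping.lookup f m) * monomial_eval x m)
         = tri n (\<lambda>i j k. to_ac (T i j k)) (\<lambda>i. x i ^ CARD('a)) x x"
    if "finite S" "S \<subseteq> Poly_Mapping.keys f" for S
    using that
  proof (induction S)
    case empty
    show ?case by (rule exI[of _ "\<lambda>_ _ _. 0"]) (simp add: tri_def)
  next
    case (insert m S)
    then obtain T where T: "\<And>x. (\<Sum>m\<in>S. to_ac (Poly_Mapping.lookup f m) * monomial_eval x m)
         = tri n (\<lambda>i j k. to_ac (T i j k)) (\<lambda>i. x i ^ CARD('a)) x x" by auto
    have m: "m \<in> Poly_Mapping.keys f" using insert by simp
    obtain i where i: "i \<le> n" "CARD('a) \<le> Poly_Mapping.lookup m i"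
      using vanishing_form_has_large_exponent[OF f space_filling_eval[OF f _ sf] m] by auto
    have "total_degree m = CARD('a) + 2"
      using homogeneous_formD(2)[OF f m] by (simp add: total_degree_def)
    then obtain j k where jk: "j \<in> Poly_Mapping.keys m" "k \<in> Poly_Mapping.keys m"
      "m = Poly_Mapping.single i CARD('a) + (Poly_Mapping.single j 1 + Poly_Mapping.single k 1)"
      using quadratic_cofactor[OF _ i(2)] by auto
    have le: "j \<le> n" "k \<le> n" using jk homogeneous_formD(1)[OF f m] by auto
    let ?c = "Poly_Mapping.lookup f m"
    let ?S = "\<lambda>i' j' k'. if i' = i \<and> j' = j \<and> k' = k then ?c else 0"
    have e: "monomial_eval x m = x i ^ CARD('a) * x j * x k" for x :: "nat \<Rightarrow> 'a alg_closure"
      by (subst jk(3)) (simp add: monomial_eval_add monomial_eval_single)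
    have "tri n (\<lambda>i j k. to_ac (?S i j k)) a b c = to_ac ?c * a i * b j * c k" for a b c
      using tri_indicator[OF i(1) le, of "to_ac ?c" a b c] by (simp add: if_distrib cong: if_cong)
    then have "(\<Sum>m\<in>insert m S. to_ac (Poly_Mapping.lookup f m) * monomial_eval x m)
       = tri n (\<lambda>i j k. to_ac (?S i j k + T i j k)) (\<lambda>i. x i ^ CARD('a)) x x" for x
      using insert.hyps by (simp add: T e tri_add mult.assoc)
    then show ?case by (intro exI[of _ "\<lambda>i j k. ?S i j k + T i j k"] allI)
  qed
  from this[OF finite_keys order.refl] obtain T where
    T: "\<And>x. mpoly_eval f x = tri n (\<lambda>i j k. to_ac (T i j k)) (\<lambda>i. x i ^ CARD('a)) x x"
    by (auto simp: mpoly_eval_alt)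
  \<comment> \<open>Averaging the last two slots makes the tensor symmetric; this divides by 2,
    hence odd q.\<close>
  define S where "S = (\<lambda>i j k. inverse 2 * (T i j k + T i k j))"
  have two: "(2 :: 'a) \<noteq> 0" by (rule two_neq_zero[OF q])
  then have two': "(2 :: 'a alg_closure) \<noteq> 0" by (metis to_ac_eq_0_iff to_ac_numeral)
  have swap: "tri n (\<lambda>i j k. to_ac (T i k j)) a x x = tri n (\<lambda>i j k. to_ac (T i j
      k)) a x x" for a x
    unfolding tri_def by (rule sum.cong[OF refl], subst sum.swap) (simp add: mult_ac)
  have "mpoly_eval f x = tri n (\<lambda>i j k. to_ac (S i j k)) (\<lambda>i. x i ^ CARD('a)) x x" for x
  proof -
    have "(\<lambda>i j k. to_ac (S i j k)) = (\<lambda>i j k. inverse 2 * (to_ac (T i j k) + to_ac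
        (T i k j)))"
      by (intro ext) (simp only: S_def to_ac_mult to_ac_add to_ac_inverse to_ac_numeral)
    then show ?thesis unfolding T using two' by (simp only: tri_scale tri_add swap) simp
  qed
  then show thesis using that[of S] by (simp add: S_def add.commute)
qed

text \<open>Along \<open>x + t h\<close> the first slot becomes \<open>x^q + t^q h^q\<close>, so
  only the last two slots contribute to the coefficient of \<open>t\<close>, equally by
  symmetry.\<close>

lemma dir_deriv_trilinear:
  fixes f :: "'a::{field, finite} mpoly" and T :: "nat \<Rightarrow> nat \<Rightarrow> nat \<Rightarrow> 'a"
  assumes f: "homogeneous_form n (CARD('a) + 2) f" and sym: "\<And>i j k. T i j k = T i k j"
    and T: "\<And>x. mpoly_eval f x = tri n (\<lambda>i j k. to_ac (T i j k)) (\<lambda>i. x i ^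
        CARD('a)) x x"
  shows "dir_deriv n f x h = 2 * tri n (\<lambda>i j k. to_ac (T i j k)) (\<lambda>i. x i ^ CARD('a)) x h"
proof -
  let ?t = "tri n (\<lambda>i j k. to_ac (T i j k))"
  let ?F = "\<lambda>x i. x i ^ CARD('a) :: 'a alg_closure"
  have s: "?t a b c = ?t a c b" for a b c by (rule tri_sym23) (simp add: sym)
  let ?P = "\<lambda>a. [:?t a x x, 2 * ?t a x h, ?t a h h:]"
  have "line_poly f x h = ?P (?F x) + monom 1 CARD('a) * ?P (?F h)"
  proof (rule poly_eqI_infinite[OF infinite_UNIV_alg_closed])
    fix t
    have "poly (line_poly f x h) t = ?t (\<lambda>i. x i ^ CARD('a) + t ^ CARD('a) * h i ^
        CARD('a)) (\<lambda>i. x i + t * h i) (\<lambda>i. x i + t * h i)"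
      by (simp add: poly_line_poly T power_card_add power_mult_distrib)
    also have "\<dots> = poly (?P (?F x) + monom 1 CARD('a) * ?P (?F h)) t"
      unfolding tri_lin1 tri_lin2 tri_lin3 by (simp add: s[of _ h x] poly_monom algebra_simps)
    finally show "poly (line_poly f x h) t = poly (?P (?F x) + monom 1 CARD('a) * ?P (?F h)) t" .
  qed
  then have "coeff (line_poly f x h) 1 = coeff (?P (?F x) + monom 1 CARD('a) * ?P (?F h)) 1" by
      (rule arg_cong)
  also have "\<dots> = 2 * ?t (?F x) x h"
    using card_field_ge_2[where 'a = 'a] by (simp add: coeff_monom_mult del: mult_pCons_right)
  finally show ?thesis using coeff_line_poly_1[OF f] by simp
qed

text \<open>Polarisation of \<open>T(x, x, x) = 0\<close>. The parameters 1 and -1 suffice to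
  separate the mixed terms, so no lower bound on the size of the field enters beyond
  \<open>2 \<noteq> 0\<close>.\<close>

lemma tri_cyclic:
  fixes T :: "nat \<Rightarrow> nat \<Rightarrow> nat \<Rightarrow> 'k::field"
  assumes two: "(2 :: 'k) \<noteq> 0" and sym: "\<And>i j k. T i j k = T i k j"
    and van: "\<And>x. x \<in> vecs n \<Longrightarrow> tri n T x x x = 0"
    and V: "a \<in> vecs n" "b \<in> vecs n" "c \<in> vecs n"
  shows "tri n T a b c + tri n T b a c + tri n T c a b = 0"
proof -
  have s: "tri n T a b c = tri n T a c b" for a b c by (rule tri_sym23[OF sym])
  have V': "(\<lambda>i. x i + t * y i) \<in> vecs n" if "x \<in> vecs n" "y \<in> vecs n" for x y t
    by (rule lin_subspaceD(2)[OF lin_subspace_vecs that])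
  have *: "tri n T a b b + 2 * tri n T b a b = 0" if ab: "a \<in> vecs n" "b \<in> vecs n" for a b
  proof -
    define u where "u = tri n T a b b + 2 * tri n T b a b"
    define v where "v = tri n T b a a + 2 * tri n T a a b"
    have e: "tri n T (\<lambda>i. a i + t * b i) (\<lambda>i. a i + t * b i) (\<lambda>i. a i + t * b i) =
      tri n T a a a + t * v + t ^ 2 * u + t ^ 3 * tri n T b b b" for t
      unfolding tri_lin1 tri_lin2 tri_lin3
      by (simp add: u_def v_def s[of _ b a] algebra_simps power2_eq_square power3_eq_cube)
    have "v + u = 0" "u - v = 0"
      using van[OF V'[OF ab, of 1]] van[OF V'[OF ab, of "-1"]] unfolding e
      using van[OF ab(1)] van[OF ab(2)] by simp_all
    then have "2 * u = 0" by simp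
    with two have "u = 0" by (simp only: mult_eq_0_iff simp_thms)
    then show ?thesis by (simp add: u_def)
  qed
  \<comment> \<open>A second polarisation: the two-vector identity for \<open>b + c\<close>, minus
    those for \<open>b\<close> and \<open>c\<close>, is twice the cyclic sum.\<close>
  let ?b = "\<lambda>i. b i + 1 * c i"
  have "2 * (tri n T a b c + tri n T b a c + tri n T c a b) = (tri n T a ?b ?b + 2 * tri n T ?b a ?b)
      - (tri n T a b b + 2 * tri n T b a b) - (tri n T a c c + 2 * tri n T c a c)"
    unfolding tri_lin1 tri_lin2 tri_lin3 by (simp add: s[of a c b] algebra_simps)
  also have "\<dots> = 0"
    using *[OF V(1) V'[OF V(2,3), of 1]] *[OF V(1,2)] *[OF V(1,3)] by (simp only: diff_0_right)
  finally have "2 * (tri n T a b c + tri n T b a c + tri n T c a b) = 0" .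
  with two show ?thesis by (simp only: mult_eq_0_iff simp_thms)
qed

section \<open>Singular points of plane sections\<close>

definition cross :: "(nat \<Rightarrow> 'k::field) \<Rightarrow> (nat \<Rightarrow> 'k)
    \<Rightarrow> nat \<Rightarrow> 'k" where
  "cross x y i = (if i = 0 then x 1 * y 2 - x 2 * y 1 else if i = 1 then x 2 * y 0 - x 0 * y 2
     else if i = 2 then x 0 * y 1 - x 1 * y 0 else 0)"

definition mat_vec :: "(nat \<Rightarrow> nat \<Rightarrow> 'k::field) \<Rightarrow> (nat
    \<Rightarrow> 'k) \<Rightarrow> nat \<Rightarrow> 'k" where
  "mat_vec B x i = (if i \<le> 2 then dot 2 (B i) x else 0)"

lemma dot2: "dot 2 x y = x 0 * y 0 + x 1 * y 1 + x 2 * y 2"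
  by (simp add: dot_def numeral_2_eq_2)

lemma cross_simps:
  "cross x y 0 = x 1 * y 2 - x 2 * y 1"
  "cross x y 1 = x 2 * y 0 - x 0 * y 2"
  "cross x y 2 = x 0 * y 1 - x 1 * y 0"
  by (simp_all add: cross_def)

lemma mat_vec_simps:
  "mat_vec B x 0 = dot 2 (B 0) x" "mat_vec B x 1 = dot 2 (B 1) x" "mat_vec B x 2 = dot 2 (B 2) x"
  by (simp_all add: mat_vec_def)

lemmas expand3 = dot2[unfolded One_nat_def] cross_simps[unfolded One_nat_def]
    mat_vec_simps[unfolded One_nat_def]

lemma le_2_cases:
  assumes "i \<le> (2 :: nat)" "P 0" "P 1" "P 2"
  shows "P i"
proof -
  have "i = 0 \<or> i = 1 \<or> i = 2" using assms(1) by linarith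
  with assms show ?thesis by blast
qed

lemma vecs2_eqI:
  assumes "x \<in> vecs 2" "y \<in> vecs 2" "x 0 = y 0" "x 1 = y 1" "x 2 = y 2"
  shows "x = y"
proof
  fix i
  show "x i = y i"
  proof (cases "i \<le> 2")
    case True
    then show ?thesis by (rule le_2_cases) (use assms in auto)
  qed (use assms in \<open>auto simp: vecs_def\<close>)
qed

lemma cross_in_vecs: "cross x y \<in> vecs 2"
  by (auto simp: cross_def vecs_def)

lemma mat_vec_in_vecs: "mat_vec B x \<in> vecs 2"
  by (auto simp: mat_vec_def vecs_def)

lemma vecs2_nonzero_obtains_dual:
  assumes "m \<in> vecs 2" "m \<noteq> (\<lambda>_. 0)"
  obtains w where "w \<in> vecs 2" "dot 2 w m = 1"
proof -
  obtain i where i: "m i \<noteq> 0" using assms(2) by auto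
  then have "i \<le> 2" using assms(1) by (force simp: vecs_def not_le[symmetric])
  define w where "w = (\<lambda>j. inverse (m i) * unit_vec i j)"
  have "w \<in> vecs 2" unfolding w_def
    by (rule lin_subspace_scale[OF lin_subspace_vecs unit_vec_in_vecs[OF \<open>i \<le> 2\<close>]])
  moreover have "dot 2 w m = dot 2 m w" by (simp add: dot_def mult.commute)
  then have "dot 2 w m = 1"
    using i \<open>i \<le> 2\<close> by (simp add: w_def lin_functional_scale[OF
        lin_functional_dot] dot_unit_vec)
  ultimately show thesis by (rule that)
qed

text \<open>Cramer's rule with denominators cleared; each coefficient is a 3 by 3
  determinant.\<close>

lemma cramer3:
  assumes "v \<in> vecs 2" "s \<in> vecs 2" "p \<in> vecs 2" "w \<in> vecs 2"
  shows "(\<lambda>i. dot 2 w (cross s p) * v i) = (\<lambda>i. dot 2 w (cross v p) * s i + dot 2 w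
      (cross s v) * p i
      + dot 2 v (cross s p) * w i)"
  by (rule vecs2_eqI) (use assms in \<open>auto simp: vecs_def expand3 algebra_simps\<close>)

text \<open>Expanding the triple product shows \<open>cross n m = 0\<close>; expanding
  \<open>cross w (cross n m)\<close> then expresses \<open>n\<close> through \<open>m\<close>, as
  \<open>dot 2 w m = 1\<close>.\<close>

lemma parallel_if_orthogonal:
  assumes s: "s \<in> vecs 2" and p: "p \<in> vecs 2" and n: "n \<in> vecs 2" and w: "dot 2 w (cross s p) = 1"
    and ortho: "dot 2 n s = 0" "dot 2 n p = 0"
  shows "n = (\<lambda>i. dot 2 w n * cross s p i)"
proof -
  define m where "m = cross s p"
  have "cross n m = (\<lambda>i. dot 2 n p * s i - dot 2 n s * p i)"
    by (rule vecs2_eqI) (use s p in \<open>auto simp: vecs_def m_def cross_def expand3 algebra_simps\<close>)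
  then have nm: "cross n m = (\<lambda>_. 0)" using ortho by simp
  have "(\<lambda>i. dot 2 w m * n i - dot 2 w n * m i) = cross w (cross n m)"
    by (rule vecs2_eqI) (use n in \<open>auto simp: vecs_def m_def cross_def expand3 algebra_simps\<close>)
  also have "\<dots> = (\<lambda>_. 0)" unfolding nm by (auto simp: cross_def)
  finally have "dot 2 w m * n i - dot 2 w n * m i = 0" for i by (rule fun_cong)
  then show ?thesis using w by (auto simp: m_def)
qed

text \<open>A form of degree \<open>q + 2\<close> on the plane is \<open>det (x, x\<^sup>q, B
    x)\<close> for a \<open>3 \<times> 3\<close> matrix \<open>B\<close>,
  unique up to adding scalar matrices; we normalise \<open>B 0 0 = 0\<close>.\<close>

definition plane_matrix :: "(nat \<Rightarrow> nat \<Rightarrow> nat \<Rightarrow> 'k::field)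
    \<Rightarrow> nat \<Rightarrow> nat \<Rightarrow> 'k" where
  "plane_matrix T i j =
    (if i = 0 then if j = 0 then 0 else if j = 1 then T 2 1 1 else - T 1 2 2
     else if i = 1 then if j = 0 then - T 2 0 0 else if j = 1 then - (2 * T 2 0 1) else T 0 2 2
     else if j = 0 then T 1 0 0 else if j = 1 then - T 0 1 1 else 2 * T 1 0 2)"

lemma tri2: "tri 2 T a b c = (\<Sum>i\<in>{0, 1, 2}. \<Sum>j\<in>{0, 1, 2}. \<Sum>k\<in>{0, 1, 2}.
    T i j k * a i * b j * c k)"
proof -
  have "{..2} = {0, 1, 2 :: nat}" by auto
  then show ?thesis by (simp add: tri_def)
qed

text \<open>This is the polarised form of the determinant with rows \<open>e\<close>,
  \<open>B x\<close>, \<open>x\<close>. After the symmetries of \<open>T\<close> are used to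
  eliminate dependent entries, it is a polynomial identity.\<close>

lemma tri_plane_matrix:
  fixes T :: "nat \<Rightarrow> nat \<Rightarrow> nat \<Rightarrow> 'k::field"
  assumes sym: "\<And>i j k. T i j k = T i k j" and diag: "\<And>i. T i i i = 0"
    and cyc: "\<And>i j k. T i j k + T j i k + T k i j = 0"
  shows "2 * tri 2 T e x h = dot 2 e (cross (mat_vec (plane_matrix T) x) h) + dot 2 e (cross
      (mat_vec (plane_matrix T) h) x)"
proof -
  have d: "T 0 0 0 = 0" "T 1 1 1 = 0" "T 2 2 2 = 0" using diag by auto
  have sm: "T i 1 0 = T i 0 1" "T i 2 0 = T i 0 2" "T i 2 1 = T i 1 2" for i using sym by auto
  have c2: "T i j j = - (2 * T j i j)" for i j
    using cyc[of i j j] by (subst eq_neg_iff_add_eq_0) (simp only: mult_2 add.assoc)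
  have c3: "T 0 1 2 = - (T 1 0 2 + T 2 0 1)"
    using cyc[of 0 1 2] by (subst eq_neg_iff_add_eq_0) (simp only: add.assoc)
  note c = c2[of 0 1] c2[of 0 2] c2[of 1 2] c2[of 1 0] c2[of 2 0] c2[of 2 1] c3
  have tri: "tri 2 T e x h = (\<Sum>i\<in>{0, 1, 2}. e i * (
      T i 0 0 * x 0 * h 0 + T i 1 1 * x 1 * h 1 + T i 2 2 * x 2 * h 2
      + T i 0 1 * (x 0 * h 1 + x 1 * h 0) + T i 0 2 * (x 0 * h 2 + x 2 * h 0) + T i 1 2 * (x 1 * h
          2 + x 2 * h 1)))"
    by (simp add: tri2 sm[unfolded One_nat_def] algebra_simps)
  \<comment> \<open>Eight entries of \<open>T\<close> stay free, matching the dimension of 3 by 3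
    matrices modulo scalar matrices.\<close>
  define p where "p = T 0 0 1"
  define q where "q = T 0 0 2"
  define r where "r = T 1 0 1"
  define s where "s = T 1 1 2"
  define t where "t = T 2 0 2"
  define u where "u = T 2 1 2"
  define v where "v = T 1 0 2"
  define w where "w = T 2 0 1"
  note defs = p_def q_def r_def s_def t_def u_def v_def w_def
  have vals: "T 0 0 0 = 0" "T 0 0 1 = p" "T 0 0 2 = q" "T 0 1 1 = - (2 * r)" "T 0 1 2 = - (v + w)"
      "T 0 2 2 = - (2 * t)"
     "T 1 0 0 = - (2 * p)" "T 1 0 1 = r" "T 1 0 2 = v" "T 1 1 1 = 0" "T 1 1 2 = s" "T 1 2 2 = - (2 * u)"
     "T 2 0 0 = - (2 * q)" "T 2 0 1 = w" "T 2 0 2 = t" "T 2 1 1 = - (2 * s)" "T 2 1 2 = u" "T 2 2 2 = 0"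
    by (simp_all only: defs d c sm)
  have B: "plane_matrix T 0 0 = 0" "plane_matrix T 0 1 = - (2 * s)" "plane_matrix T 0 2 = 2 * u"
    "plane_matrix T 1 0 = 2 * q" "plane_matrix T 1 1 = - (2 * w)" "plane_matrix T 1 2 = - (2 * t)"
    "plane_matrix T 2 0 = - (2 * p)" "plane_matrix T 2 1 = 2 * r" "plane_matrix T 2 2 = 2 * v"
    using vals by (simp_all add: plane_matrix_def)
  have "(\<Sum>i\<in>{0, 1, 2 :: nat}. g i) = g 0 + g 1 + g 2" for g :: "nat \<Rightarrow> 'k"
    by (simp add: add.assoc)
  then show ?thesis
    unfolding tri by (simp only: vals B dot2 cross_simps mat_vec_simps) (simp add: algebra_simps)
qed

section \<open>The q-power map and eigenvectors of rational matrices\<close>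

lemma dot_power_card:
  fixes x y :: "nat \<Rightarrow> 'a::{field, finite} alg_closure"
  shows "dot 2 (\<lambda>i. x i ^ CARD('a)) (\<lambda>i. y i ^ CARD('a)) = dot 2 x y ^ CARD('a)"
  by (simp add: dot2 power_card_add power_mult_distrib)

lemma mat_vec_power_card:
  fixes x :: "nat \<Rightarrow> 'a::{field, finite} alg_closure" and B :: "nat \<Rightarrow> nat
      \<Rightarrow> 'a"
  shows "mat_vec (\<lambda>i j. to_ac (B i j)) (\<lambda>i. x i ^ CARD('a)) = (\<lambda>i. mat_vec
      (\<lambda>i j. to_ac (B i j)) x i ^ CARD('a))"
  using dot_power_card[of "\<lambda>j. to_ac (B _ j)" x]
  by (auto simp: mat_vec_def zero_power)

lemma dot_transpose: "dot 2 (mat_vec (\<lambda>i j. A j i) m) h = dot 2 m (mat_vec A h)"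
  by (simp add: expand3 algebra_simps)

lemma triple_product:
  "dot 2 p (cross v s) = dot 2 v (cross s p)" "dot 2 p (cross s h) = - dot 2 (cross s p) h"
  by (simp_all add: expand3 algebra_simps)

lemma vecs2_eqI_dot:
  assumes "x \<in> vecs 2" "y \<in> vecs 2" "\<And>h. h \<in> vecs 2 \<Longrightarrow> dot 2 x h = dot 2 y h"
  shows "x = y"
  using assms(3)[OF unit_vec_in_vecs[of 0]] assms(3)[OF unit_vec_in_vecs[of 1]] assms(3)[OF
      unit_vec_in_vecs[of 2]]
  by (intro vecs2_eqI assms(1,2)) (simp_all add: dot_unit_vec)

lemma rational_eigenvector:
  fixes B :: "nat \<Rightarrow> nat \<Rightarrow> 'a::{field, finite}" and m :: "nat \<Rightarrow>
      'a alg_closure"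
  assumes m: "m \<in> vecs 2" "m \<noteq> (\<lambda>_. 0)"
    and eig: "mat_vec (\<lambda>i j. to_ac (B j i)) m = (\<lambda>i. to_ac a * m i)"
  shows "\<exists>x\<in>vecs 2. x \<noteq> (\<lambda>_. 0) \<and> mat_vec B x = (\<lambda>i. a * x i)"
proof (rule ccontr)
  assume neg: "\<not> ?thesis"
  define g where "g = (\<lambda>x i. mat_vec B x i - a * x i)"
  have g_diff: "g (\<lambda>i. x i - y i) = (\<lambda>i. g x i - g y i)" for x y
    by (auto simp: g_def mat_vec_def dot_def sum_subtractf algebra_simps)
  have "inj_on g (vecs 2)"
  proof (rule inj_onI)
    fix x y assume xy: "x \<in> vecs 2" "y \<in> vecs 2" "g x = g y"
    then have "(\<lambda>i. x i - y i) \<in> vecs 2" by (auto simp: vecs_def)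
    moreover have "mat_vec B (\<lambda>i. x i - y i) = (\<lambda>i. a * (x i - y i))"
    proof
      fix i show "mat_vec B (\<lambda>i. x i - y i) i = a * (x i - y i)"
        using fun_cong[OF g_diff[of x y], of i] fun_cong[OF xy(3), of i] by (simp add: g_def)
    qed
    ultimately have "(\<lambda>i. x i - y i) = (\<lambda>_. 0)" using neg by blast
    then show "x = y" by (auto simp: fun_eq_iff)
  qed
  moreover have "g ` vecs 2 \<subseteq> vecs 2" by (auto simp: g_def vecs_def mat_vec_def)
  ultimately have surj: "g ` vecs 2 = vecs 2" by (intro endo_inj_surj) auto
  have "m i = 0" if i2: "i \<le> 2" for i
  proof -
    obtain x where x: "x \<in> vecs 2" "g x = unit_vec i"
      using surj unit_vec_in_vecs[OF i2] by (metis imageE)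
    have "m i = dot 2 m (to_ac_vec (g x))"
      using i2 by (simp add: x(2) dot_def unit_vec_def if_distrib[of to_ac] if_distrib[of
          "\<lambda>u. _ * u"] cong: if_cong)
    also have "\<dots> = dot 2 m (mat_vec (\<lambda>i j. to_ac (B i j)) (to_ac_vec x)) - to_ac a *
        dot 2 m (to_ac_vec x)"
      by (simp add: g_def expand3 algebra_simps)
    also have "\<dots> = 0"
      unfolding dot_transpose[of "\<lambda>i j. to_ac (B i j)", symmetric] eig
      by (simp add: dot2 algebra_simps)
    finally show ?thesis .
  qed
  with m show False by (auto simp: vecs_def fun_eq_iff) (metis not_le)
qed

text \<open>Descent from the closure to the base field. If the singular point \<open>s\<close> is
  parallel to its q-power \<open>p\<close>, it is already rational up to scaling. Otherwise
  \<open>m = cross s p\<close> is an eigenvector of the transposed matrix with rational eigenvalue,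
  and a rational eigenvector of \<open>B\<close> is the point sought.\<close>

lemma ternary_singular_point:
  fixes T :: "nat \<Rightarrow> nat \<Rightarrow> nat \<Rightarrow> 'a::{field, finite}" and s ::
      "nat \<Rightarrow> 'a alg_closure"
  assumes two: "(2 :: 'a) \<noteq> 0"
    and sym: "\<And>i j k. T i j k = T i k j" and diag: "\<And>i. T i i i = 0"
    and cyc: "\<And>i j k. T i j k + T j i k + T k i j = 0"
    and s: "s \<in> vecs 2" "s \<noteq> (\<lambda>_. 0)"
    and sing: "\<And>h. h \<in> vecs 2 \<Longrightarrow> tri 2 (\<lambda>i j k. to_ac (T i j k))
        (\<lambda>i. s i ^ CARD('a)) s h = 0"
  shows "\<exists>x\<in>vecs 2. x \<noteq> (\<lambda>_. 0) \<and> (\<forall>h\<in>vecs 2. tri 2 T h x x = 0)"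
proof -
  define B where "B = plane_matrix T"
  define A where "A = (\<lambda>i j. to_ac (B i j))"
  define p where "p = (\<lambda>i. s i ^ CARD('a))"
  define m where "m = cross s p"
  have two': "(2 :: 'a alg_closure) \<noteq> 0" using two by (metis to_ac_eq_0_iff to_ac_numeral)
  have p: "p \<in> vecs 2" using s(1) by (auto simp: p_def vecs_def zero_power)
  have m: "m \<in> vecs 2" unfolding m_def by (rule cross_in_vecs)
  have polar: "2 * tri 2 T e x h = dot 2 e (cross (mat_vec B x) h) + dot 2 e (cross (mat_vec B h)
      x)" for e x h
    unfolding B_def by (rule tri_plane_matrix[OF sym diag cyc])
  have "plane_matrix (\<lambda>i j k. to_ac (T i j k)) = A"
    by (intro ext) (simp add: plane_matrix_def A_def B_def)
  then have polar': "2 * tri 2 (\<lambda>i j k. to_ac (T i j k)) e x h = dot 2 e (cross (mat_vec A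
      x) h) + dot 2 e (cross (mat_vec A h) x)" for e x h
    using tri_plane_matrix[of "\<lambda>i j k. to_ac (T i j k)" e x h] sym diag cyc
    by (metis (no_types, lifting) to_ac_add to_ac_0)
  have C: "dot 2 p (cross (mat_vec A s) h) + dot 2 p (cross (mat_vec A h) s) = 0" if "h \<in> vecs 2" for h
    using polar'[of p s h] sing[OF that] by (simp add: p_def)
  show ?thesis
  proof (cases "m = (\<lambda>_. 0)")
    case True
    \<comment> \<open>Parallelism of \<open>s\<close> and \<open>p\<close> means that all ratios of
      coordinates of \<open>s\<close> are fixed by the q-power map, so they lie in the base
      field.\<close>
    have par: "s i * p j = s j * p i" if "i \<le> 2" "j \<le> 2" for i j
    proof -
      have "s 1 * p 2 = s 2 * p 1" "s 2 * p 0 = s 0 * p 2" "s 0 * p 1 = s 1 * p 0"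
        using fun_cong[OF True, of 0] fun_cong[OF True, of 1] fun_cong[OF True, of 2]
        by (simp_all add: m_def cross_def)
      then show ?thesis using that(2) by (rule_tac le_2_cases[OF that(1)]; rule_tac le_2_cases[OF
          that(2)]) simp_all
    qed
    obtain i where i: "s i \<noteq> 0" using s(2) by auto
    then have i2: "i \<le> 2" using s(1) by (force simp: vecs_def not_le[symmetric])
    have sj0: "s j = 0" if "\<not> j \<le> 2" for j using s(1) that by (simp add: vecs_def)
    have fix_j: "(s j / s i) ^ CARD('a) = s j / s i" for j
    proof (cases "j \<le> 2")
      case True
      then show ?thesis using par[OF i2 True] i by (simp add: p_def power_divide field_simps)
    qed (simp add: sj0 zero_power)
    define x where "x = (\<lambda>j. of_ac (s j / s i))"
    have x: "to_ac (x j) = s j / s i" for j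
      unfolding x_def by (rule to_ac_of_ac[OF power_card_eq_self_imp_range[OF fix_j]])
    have s_eq: "s = (\<lambda>j. s i * to_ac (x j))" using i by (simp add: x)
    have p_eq: "p = (\<lambda>j. s i ^ CARD('a) * to_ac (x j))"
      unfolding p_def using i by (auto simp: fun_eq_iff fix_j[unfolded power_divide, symmetric] x)
    have "x j = 0" if "\<not> j \<le> 2" for j
    proof -
      have "to_ac (x j) = 0" by (simp add: x sj0[OF that])
      then show ?thesis by simp
    qed
    then have xv: "x \<in> vecs 2" by (auto simp: vecs_def)
    have "to_ac (x i) = 1" using i by (simp add: x)
    then have xi: "x \<noteq> (\<lambda>_. 0)" by auto
    have "tri 2 T h x x = 0" if h: "h \<in> vecs 2" for h
    proof -
      have "0 = tri 2 (\<lambda>i j k. to_ac (T i j k)) p s (to_ac_vec h)"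
        unfolding p_def by (rule sing[symmetric]) (simp add: to_ac_vec_in_vecs h)
      also have "\<dots> = s i ^ CARD('a) * (s i * to_ac (tri 2 T x x h))"
        by (subst s_eq, subst p_eq) (simp only: tri_scale1 tri_scale2 to_ac_tri)
      finally have "tri 2 T x x h = 0" using i by simp
      then have "dot 2 x (cross (mat_vec B x) h) + dot 2 x (cross (mat_vec B h) x) = 0"
        using polar[of x x h] by simp
      \<comment> \<open>This moves \<open>h\<close> into the first slot: the second determinant
        repeats \<open>x\<close>, and the first is a permutation of the one for
        \<open>tri 2 T h x x\<close>.\<close>
      moreover have "dot 2 x (cross (mat_vec B x) h) + dot 2 x (cross (mat_vec B h) x) = - dot 2 h
          (cross (mat_vec B x) x)"
        by (simp add: expand3 algebra_simps)
      ultimately have "2 * tri 2 T h x x = 0" using polar[of h x x] by simp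
      with two show ?thesis by simp
    qed
    with xv xi show ?thesis by blast
  next
    case False
    obtain w where w: "w \<in> vecs 2" "dot 2 w m = 1" by (rule vecs2_nonzero_obtains_dual[OF m False])
    define v where "v = mat_vec A s"
    define \<alpha> where "\<alpha> = dot 2 w (cross v p)"
    define \<beta> where "\<beta> = dot 2 w (cross s v)"
    have vv: "v \<in> vecs 2" unfolding v_def by (rule mat_vec_in_vecs)
    \<comment> \<open>Taking \<open>h = s\<close> in \<open>C\<close> puts \<open>v\<close> into the
      plane spanned by \<open>s\<close> and \<open>p\<close>.\<close>
    have "2 * dot 2 v m = 0"
      using C[OF s(1), folded v_def] unfolding triple_product(1)[of p v s] m_def by (simp only: mult_2)
    then have vm: "dot 2 v m = 0" using two' by (simp only: mult_eq_0_iff simp_thms)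
    have v_eq: "v = (\<lambda>i. \<alpha> * s i + \<beta> * p i)"
      using cramer3[OF vv s(1) p w(1)]
      unfolding m_def[symmetric] w(2) vm \<alpha>_def[symmetric] \<beta>_def[symmetric] mult_1
          mult_zero_left add_0_right .
    let ?At = "mat_vec (\<lambda>i j. A j i)"
    \<comment> \<open>With \<open>v\<close> written in \<open>s\<close> and \<open>p\<close>,
      condition \<open>C\<close> pairs the transposed matrix applied to \<open>m\<close>, minus
      \<alpha> times \<open>m\<close>, to 0 with every \<open>h\<close>.\<close>
    have At_m: "?At m = (\<lambda>i. \<alpha> * m i)"
    proof (rule vecs2_eqI_dot)
      fix h :: "nat \<Rightarrow> 'a alg_closure" assume h: "h \<in> vecs 2"
      have "dot 2 p (cross v h) = - \<alpha> * dot 2 m h"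
        by (subst v_eq) (simp add: m_def expand3 algebra_simps)
      moreover have "dot 2 p (cross (mat_vec A h) s) = dot 2 (?At m) h"
        by (simp add: m_def expand3 algebra_simps)
      ultimately have "dot 2 (?At m) h = \<alpha> * dot 2 m h" using C[OF h] by (simp add: v_def)
      also have "\<dots> = dot 2 (\<lambda>i. \<alpha> * m i) h" by (simp add: dot2 algebra_simps)
      finally show "dot 2 (?At m) h = dot 2 (\<lambda>i. \<alpha> * m i) h" .
    qed (use m in \<open>auto intro: mat_vec_in_vecs lin_subspace_scale[OF lin_subspace_vecs]\<close>)
    \<comment> \<open>Otherwise the q-power \<open>n\<close> of \<open>m\<close> is an eigenvector
      for the different eigenvalue \<open>\<alpha> ^ q\<close>. It turns out orthogonal to both
      \<open>s\<close> and \<open>p\<close>, hence parallel to \<open>m\<close>, which forces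
      \<open>n = 0\<close>.\<close>
    have "\<alpha> ^ CARD('a) = \<alpha>"
    proof (rule ccontr)
      assume neq: "\<alpha> ^ CARD('a) \<noteq> \<alpha>"
      define n where "n = (\<lambda>i. m i ^ CARD('a))"
      have nv: "n \<in> vecs 2" using m by (auto simp: n_def vecs_def zero_power)
      have At_n: "?At n = (\<lambda>i. \<alpha> ^ CARD('a) * n i)"
        using mat_vec_power_card[of "\<lambda>i j. B j i" m] At_m by (simp add: n_def A_def
            power_mult_distrib)
      have "dot 2 m s = 0" by (simp add: m_def expand3 algebra_simps)
      then have np: "dot 2 n p = 0" unfolding n_def p_def dot_power_card by (simp add: zero_power)
      \<comment> \<open>Both eigenvalues are compared by moving the matrix across the pairing of
        \<open>n\<close> with \<open>s\<close>.\<close>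
      have "\<alpha> ^ CARD('a) * dot 2 n s = dot 2 (?At n) s"
        unfolding At_n by (simp add: dot2 algebra_simps)
      also have "\<dots> = dot 2 n v" unfolding dot_transpose v_def ..
      also have "\<dots> = \<alpha> * dot 2 n s + \<beta> * dot 2 n p"
        by (subst v_eq) (simp add: dot2 algebra_simps)
      finally have "dot 2 n s = 0" using np neq by simp
      then have n_eq: "n = (\<lambda>i. dot 2 w n * m i)"
        unfolding m_def
        using parallel_if_orthogonal[OF s(1) p nv] w(2) np by (simp add: m_def)
      define c where "c = dot 2 w n"
      have "?At n = (\<lambda>i. c * ?At m i)"
        unfolding n_eq[folded c_def] by (auto simp: mat_vec_def dot2 algebra_simps)
      also have "\<dots> = (\<lambda>i. \<alpha> * n i)" unfolding At_m n_eq[folded c_def] by (simp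
          add: mult_ac)
      finally have "\<alpha> ^ CARD('a) * n i = \<alpha> * n i" for i unfolding At_n by (rule fun_cong)
      then have "n i = 0" for i using neq by simp
      then have "m i = 0" for i by (simp add: n_def)
      with False show False by auto
    qed
    then obtain a where a: "\<alpha> = to_ac a" using power_card_eq_self_imp_range by blast
    obtain x where x: "x \<in> vecs 2" "x \<noteq> (\<lambda>_. 0)" "mat_vec B x = (\<lambda>i. a * x i)"
      using rational_eigenvector[OF m False, of B a] At_m by (auto simp: A_def a)
    \<comment> \<open>For an eigenvector the determinants in \<open>polar\<close> have two parallel
      rows.\<close>
    have "2 * tri 2 T h x x = 0" for h
      unfolding polar x(3) by (simp add: expand3 algebra_simps)
    with two x show ?thesis by auto
  qed
qed

section \<open>Rational coordinates on planes in three-space\<close>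

text \<open>The equation is solved for a coordinate \<open>p\<close> with
  \<open>l p \<noteq> 0\<close>. The map \<sigma> enumerates the other three coordinates by skipping
  \<open>p\<close>, and these serve as coordinates on the plane.\<close>

lemma plane_coordinates:
  fixes l :: "nat \<Rightarrow> 'a::field"
  assumes l: "l \<in> vecs 3" "l \<noteq> (\<lambda>_. 0)"
  obtains u :: "nat \<Rightarrow> nat \<Rightarrow> 'a" and \<sigma> :: "nat \<Rightarrow> nat"
      where "\<forall>i. u i \<in> vecs 3 \<and> dot 3 l (u i) = 0"
    "\<forall>i\<le>2. \<forall>j\<le>2. u i (\<sigma> j) = (if i = j then 1 else 0)"
    "\<forall>z\<in>vecs 3. dot 3 (to_ac_vec l) z = 0 \<longrightarrow> z = (\<lambda>k.
        \<Sum>i\<le>2. z (\<sigma> i) * to_ac (u i k))"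
proof -
  obtain p where p: "l p \<noteq> 0" using l(2) by auto
  then have p3: "p \<le> 3" using l(1) by (force simp: vecs_def not_le[symmetric])
  define \<sigma> where "\<sigma> = (\<lambda>i::nat. if i < p then i else i + 1)"
  \<comment> \<open>Basis vectors with index above 2 are set to 0, so that membership in the plane
    holds for every index.\<close>
  define u where "u = (\<lambda>i k. if 2 < i then 0 else if k = \<sigma> i then 1 else if k = p
      then - l (\<sigma> i) / l p else 0)"
  have \<sigma>_ne: "\<sigma> i \<noteq> p" for i by (auto simp: \<sigma>_def)
  have \<sigma>_le: "\<sigma> i \<le> 3" if "i \<le> 2" for i using that by (auto simp: \<sigma>_def)
  have \<sigma>_inj: "\<sigma> i = \<sigma> j \<longleftrightarrow> i = j" for i j by (auto simp:
      \<sigma>_def)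
  have \<sigma>_img: "{..3} = insert p (\<sigma> ` {..2})"
  proof (rule Set.set_eqI)
    fix k
    have "k \<in> \<sigma> ` {..2}" if "k \<le> 3" "k \<noteq> p"
    proof (cases "k < p")
      case True
      then have "k = \<sigma> k" "k \<le> 2" using p3 by (auto simp: \<sigma>_def)
      then show ?thesis by blast
    next
      case False
      then have "k = \<sigma> (k - 1)" "k - 1 \<le> 2" using that by (auto simp: \<sigma>_def)
      then show ?thesis by blast
    qed
    then show "k \<in> {..3} \<longleftrightarrow> k \<in> insert p (\<sigma> ` {..2})" using p3
        \<sigma>_le by auto
  qed
  have sum_split: "(\<Sum>k\<le>3. g k) = g p + (\<Sum>i\<le>2. g (\<sigma> i))" for g :: "nat
      \<Rightarrow> 'b::comm_monoid_add"
  proof -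
    have "p \<notin> \<sigma> ` {..2}" using \<sigma>_ne by blast
    then have "(\<Sum>k\<in>insert p (\<sigma> ` {..2}). g k) = g p + (\<Sum>k\<in>\<sigma> `
        {..2}. g k)" by simp
    also have "(\<Sum>k\<in>\<sigma> ` {..2}. g k) = (\<Sum>i\<le>2. g (\<sigma> i))"
      by (subst sum.reindex) (auto simp: inj_on_def \<sigma>_inj)
    finally show ?thesis unfolding \<sigma>_img .
  qed
  show thesis
  proof (rule that[of u \<sigma>])
    show "\<forall>i. u i \<in> vecs 3 \<and> dot 3 l (u i) = 0"
    proof (intro allI conjI)
      fix i
      show "u i \<in> vecs 3" using \<sigma>_le p3 by (auto simp: u_def vecs_def not_less)
      have "(\<Sum>j\<le>2. l (\<sigma> j) * u i (\<sigma> j)) = (if i \<le> 2 then l (\<sigma> i) else 0)"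
        using \<sigma>_ne by (simp add: u_def \<sigma>_inj if_distrib[of "\<lambda>t. _ * t"] cong: if_cong)
      then show "dot 3 l (u i) = 0"
        using p \<sigma>_ne[of i] by (auto simp: dot_def sum_split u_def)
    qed
    show "\<forall>i\<le>2. \<forall>j\<le>2. u i (\<sigma> j) = (if i = j then 1 else 0)"
      using \<sigma>_ne by (auto simp: u_def \<sigma>_inj)
    show "\<forall>z\<in>vecs 3. dot 3 (to_ac_vec l) z = 0 \<longrightarrow> z = (\<lambda>k.
        \<Sum>i\<le>2. z (\<sigma> i) * to_ac (u i k))"
    proof (intro ballI impI ext)
      fix z :: "nat \<Rightarrow> 'a alg_closure" and k assume z: "z \<in> vecs 3" "dot 3 (to_ac_vec l) z = 0"
      have "to_ac (l p) * z p = - (\<Sum>i\<le>2. to_ac (l (\<sigma> i)) * z (\<sigma> i))"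
        using z(2) by (simp add: dot_def sum_split eq_neg_iff_add_eq_0)
      then have zp: "z p = (\<Sum>i\<le>2. z (\<sigma> i) * (- to_ac (l (\<sigma> i)) / to_ac (l p)))"
        using p by (simp add: field_simps sum_negf sum_divide_distrib[symmetric])
      have "k = p \<or> (\<exists>j\<le>2. k = \<sigma> j) \<or> k > 3" using \<sigma>_img by
          (metis atMost_iff imageE insertE not_le)
      then show "z k = (\<Sum>i\<le>2. z (\<sigma> i) * to_ac (u i k))"
      proof (elim disjE exE conjE)
        assume "k = p"
        have "(\<Sum>i\<le>2. z (\<sigma> i) * to_ac (u i p)) = (\<Sum>i\<le>2. z (\<sigma> i) * (-
            to_ac (l (\<sigma> i)) / to_ac (l p)))"
          by (intro sum.cong refl) (auto simp: u_def \<sigma>_ne[symmetric])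
        with zp \<open>k = p\<close> show ?thesis by simp
      next
        fix j assume j: "j \<le> 2" "k = \<sigma> j"
        have "(\<Sum>i\<le>2. z (\<sigma> i) * to_ac (u i k)) = (\<Sum>i\<le>2. if i = j then z k else 0)"
          using j \<sigma>_ne by (intro sum.cong refl) (auto simp: u_def \<sigma>_inj)
        then show ?thesis using j by simp
      next
        assume "k > 3"
        then have "u i k = 0" for i using \<sigma>_le[of i] p3 by (auto simp: u_def not_less)
        with z(1) \<open>k > 3\<close> show ?thesis by (simp add: vecs_def)
      qed
    qed
  qed
qed

lemma tri_sum1: "tri n T (\<lambda>k. \<Sum>i\<in>I. a i * u i k) b c = (\<Sum>i\<in>I. a i * tri n
    T (u i) b c)"
proof (induction I rule: infinite_finite_induct)
  case (insert i I)
  then show ?case using tri_lin1[of n T "\<lambda>k. \<Sum>i\<in>I. a i * u i k" "a i" "u i"]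
    by (simp add: add.commute)
qed (simp_all add: tri_def)

lemma tri_sum2: "tri n T b (\<lambda>k. \<Sum>i\<in>I. a i * u i k) c = (\<Sum>i\<in>I. a i * tri n
    T b (u i) c)"
proof (induction I rule: infinite_finite_induct)
  case (insert i I)
  then show ?case using tri_lin2[of n T b "\<lambda>k. \<Sum>i\<in>I. a i * u i k" "a i" "u i"]
    by (simp add: add.commute)
qed (simp_all add: tri_def)

lemma tri_sum3: "tri n T b c (\<lambda>k. \<Sum>i\<in>I. a i * u i k) = (\<Sum>i\<in>I. a i * tri n
    T b c (u i))"
proof (induction I rule: infinite_finite_induct)
  case (insert i I)
  then show ?case using tri_lin3[of n T b c "\<lambda>k. \<Sum>i\<in>I. a i * u i k" "a i" "u i"]
    by (simp add: add.commute)
qed (simp_all add: tri_def)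

lemma tri_pullback:
  "tri n T (\<lambda>k. \<Sum>i\<le>m. a i * u i k) (\<lambda>k. \<Sum>i\<le>m. b i * u i k)
      (\<lambda>k. \<Sum>i\<le>m. c i * u i k)
     = tri m (\<lambda>i j k. tri n T (u i) (u j) (u k)) a b c"
  unfolding tri_sum1 tri_sum2 tri_sum3
  unfolding tri_def[of m] sum_distrib_left by (simp add: mult_ac)

lemma power_card_sum:
  fixes g :: "'b \<Rightarrow> 'a::{field, finite} alg_closure"
  shows "(\<Sum>i\<in>I. g i) ^ CARD('a) = (\<Sum>i\<in>I. g i ^ CARD('a))"
  by (induction I rule: infinite_finite_induct) (simp_all add: power_card_add zero_power)

text \<open>The tensor is pulled back to plane coordinates, where the ternary case applies, and the
  rational singular point found there is pushed forward.\<close>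

lemma plane_rational_singular_point:
  fixes T :: "nat \<Rightarrow> nat \<Rightarrow> nat \<Rightarrow> 'a::{field, finite}" and y ::
      "nat \<Rightarrow> 'a alg_closure"
  assumes two: "(2 :: 'a) \<noteq> 0"
    and sym: "\<And>i j k. T i j k = T i k j" and van: "\<And>x. x \<in> vecs 3 \<Longrightarrow>
        tri 3 T x x x = 0"
    and l: "l \<in> vecs 3" "l \<noteq> (\<lambda>_. 0)"
    and y: "y \<in> vecs 3" "y \<noteq> (\<lambda>_. 0)" "dot 3 (to_ac_vec l) y = 0"
    and sing: "\<And>h. h \<in> vecs 3 \<Longrightarrow> dot 3 (to_ac_vec l) h = 0 \<Longrightarrow>
       tri 3 (\<lambda>i j k. to_ac (T i j k)) (\<lambda>i. y i ^ CARD('a)) y h = 0"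
  shows "\<exists>x\<in>vecs 3. x \<noteq> (\<lambda>_. 0) \<and> (\<forall>h\<in>vecs 3. dot 3 l h
      = 0 \<longrightarrow> tri 3 T h x x = 0)"
proof -
  obtain u :: "nat \<Rightarrow> nat \<Rightarrow> 'a" and \<sigma> :: "nat \<Rightarrow> nat"
      where u: "\<forall>i. u i \<in> vecs 3 \<and> dot 3 l (u i) = 0"
    and dual: "\<forall>i\<le>2. \<forall>j\<le>2. u i (\<sigma> j) = (if i = j then 1 else 0)"
    and coords: "\<forall>z\<in>vecs 3. dot 3 (to_ac_vec l) z = 0 \<longrightarrow> z =
        (\<lambda>k. \<Sum>i\<le>2. z (\<sigma> i) * to_ac (u i k))"
    by (rule plane_coordinates[OF l])
  define t where "t = (\<lambda>i j k. tri 3 T (u i) (u j) (u k))"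
  define s where "s = (\<lambda>i. if i \<le> 2 then y (\<sigma> i) else 0)"
  have y_eq: "y = (\<lambda>k. \<Sum>i\<le>2. s i * to_ac (u i k))"
    using coords[rule_format, OF y(1,3)] by (simp add: s_def)
  \<comment> \<open>The basis of the plane is rational, so the q-power map acts only on the
    coordinates.\<close>
  have yq: "(\<lambda>k. y k ^ CARD('a)) = (\<lambda>k. \<Sum>i\<le>2. s i ^ CARD('a) * to_ac (u i k))"
    by (subst y_eq) (simp add: power_card_sum power_mult_distrib)
  have pull: "tri 3 (\<lambda>i j k. to_ac (T i j k)) (\<lambda>k. \<Sum>i\<le>2. a i * to_ac (u i
      k)) (\<lambda>k. \<Sum>i\<le>2. b i * to_ac (u i k))
      (\<lambda>k. \<Sum>i\<le>2. c i * to_ac (u i k)) = tri 2 (\<lambda>i j k. to_ac (t i j k)) a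
          b c" for a b c
    unfolding tri_pullback by (simp only: to_ac_tri t_def)
  have "\<exists>x\<in>vecs 2. x \<noteq> (\<lambda>_. 0) \<and> (\<forall>h\<in>vecs 2. tri 2 t h x x = 0)"
  proof (rule ternary_singular_point[OF two, of t s])
    show "t i j k = t i k j" for i j k unfolding t_def by (rule tri_sym23[OF sym])
    show "t i i i = 0" for i unfolding t_def using u by (intro van) auto
    show "t i j k + t j i k + t k i j = 0" for i j k
      unfolding t_def using u by (intro tri_cyclic[OF two sym van]) auto
    show "s \<in> vecs 2" by (auto simp: s_def vecs_def)
    show "s \<noteq> (\<lambda>_. 0)"
    proof
      assume "s = (\<lambda>_. 0)"
      with y_eq y(2) show False by simp
    qed
    fix h :: "nat \<Rightarrow> 'a alg_closure" assume h: "h \<in> vecs 2"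
    let ?H = "\<lambda>k. \<Sum>i\<le>2. h i * to_ac (u i k)"
    have "?H \<in> vecs 3" using u by (auto simp: vecs_def)
    moreover have "dot 3 (to_ac_vec l) ?H = (\<Sum>i\<le>2. h i * dot 3 (to_ac_vec l) (to_ac_vec (u i)))"
      unfolding dot_def sum_distrib_left by (subst sum.swap) (simp add: mult_ac)
    then have "dot 3 (to_ac_vec l) ?H = 0" using u by (simp add: dot_to_ac_vec)
    ultimately have "tri 3 (\<lambda>i j k. to_ac (T i j k)) (\<lambda>i. y i ^ CARD('a)) y ?H = 0"
        by (rule sing)
    then show "tri 2 (\<lambda>i j k. to_ac (t i j k)) (\<lambda>i. s i ^ CARD('a)) s h = 0"
      unfolding yq by (subst (asm) y_eq) (simp only: pull)
  qed
  then obtain x where x: "x \<in> vecs 2" "x \<noteq> (\<lambda>_. 0)" "\<And>h. h \<in> vecs 2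
      \<Longrightarrow> tri 2 t h x x = 0" by blast
  define p where "p = (\<lambda>k. \<Sum>i\<le>2. x i * u i k)"
  have "p \<in> vecs 3" using u by (auto simp: p_def vecs_def)
  moreover have "p \<noteq> (\<lambda>_. 0)"
  proof
    assume p0: "p = (\<lambda>_. 0)"
    obtain j where j: "x j \<noteq> 0" using x(2) by auto
    then have j2: "j \<le> 2" using x(1) by (force simp: vecs_def not_le[symmetric])
    have "p (\<sigma> j) = (\<Sum>i\<le>2. if i = j then x j else 0)"
      unfolding p_def using dual j2 by (intro sum.cong) auto
    with p0 j j2 show False by simp
  qed
  moreover have "tri 3 T h p p = 0" if h: "h \<in> vecs 3" "dot 3 l h = 0" for h
  proof -
    have "to_ac_vec h \<in> vecs 3" "dot 3 (to_ac_vec l) (to_ac_vec h) = 0"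
      using h by (simp_all add: to_ac_vec_in_vecs dot_to_ac_vec)
    then have "to_ac_vec h = (\<lambda>k. \<Sum>i\<le>2. to_ac (h (\<sigma> i)) * to_ac (u i k))"
        using coords by blast
    then have "to_ac (h k) = to_ac (\<Sum>i\<le>2. h (\<sigma> i) * u i k)" for k
      unfolding to_ac_sum to_ac_mult by (rule fun_cong)
    then have hk: "h k = (\<Sum>i\<le>2. h (\<sigma> i) * u i k)" for k unfolding to_ac_eq_iff .
    have h_eq: "h = (\<lambda>k. \<Sum>i\<le>2. (if i \<le> 2 then h (\<sigma> i) else 0) * u i k)"
      by (intro ext, rule trans[OF hk], intro sum.cong) simp_all
    have "tri 3 T h p p = tri 2 t (\<lambda>i. if i \<le> 2 then h (\<sigma> i) else 0) x x"
      unfolding p_def t_def by (subst h_eq) (rule tri_pullback)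
    also have "\<dots> = 0" by (rule x(3)) (auto simp: vecs_def)
    finally show ?thesis .
  qed
  ultimately show ?thesis by blast
qed

section \<open>Bijective Gauss maps\<close>

text \<open>Outside the hyperplane \<open>K\<close> orthogonal to \<open>y\<close>, each line in
  direction \<open>y\<close> has exactly one zero, so \<open>Z - K\<close> has
  \<open>q^3 - q^2\<close> elements. A total of \<open>q^3\<close> would leave only
  \<open>q^2\<close> zeros in \<open>K\<close>, filling a plane spanned by \<open>y\<close> and some
  \<open>w\<close>. Then \<open>w\<close> is orthogonal to all of \<open>K\<close>, which makes it
  proportional to \<open>y\<close> by nondegeneracy.\<close>

lemma card_singular_quadric:
  fixes V :: "(nat \<Rightarrow> 'k::{field, finite}) set"
  assumes two: "(2 :: 'k) \<noteq> 0" and V: "lin_subspace V" "card V = CARD('k) ^ 4"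
    and lin: "\<And>a. lin_functional (N a)" and sym: "\<And>a b. N a b = N b a"
    and nondeg: "\<And>a. a \<in> V \<Longrightarrow> a \<noteq> (\<lambda>_. 0) \<Longrightarrow>
        \<exists>b\<in>V. N a b \<noteq> 0"
    and y: "y \<in> V" "y \<noteq> (\<lambda>_. 0)" "N y y = 0"
  shows "card {x \<in> V. N x x = 0} \<noteq> CARD('k) ^ 3"
proof
  let ?q = "CARD('k)"
  define Z where "Z = {x \<in> V. N x x = 0}"
  define K where "K = {x \<in> V. N y x = 0}"
  assume "card {x \<in> V. N x x = 0} = ?q ^ 3"
  then have cZ: "card Z = ?q ^ 3" by (simp add: Z_def)
  have q: "?q \<ge> 2" by (rule card_field_ge_2)
  have fin: "finite V" by (rule card_ge_0_finite) (simp add: V(2))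
  have l: "N a (\<lambda>i. b i + t * c i) = N a b + t * N a c" for a b c t
    using lin[of a] by (simp add: lin_functional_def)
  have l': "N (\<lambda>i. b i + t * c i) a = N b a + t * N c a" for a b c t
    unfolding sym[of _ a] by (rule l)
  have comb: "(\<lambda>i. a i + t * b i) \<in> V" if "a \<in> V" "b \<in> V" for a b t
    by (rule lin_subspaceD(2)[OF V(1) that])
  obtain v where v: "v \<in> V" "N y v \<noteq> 0" using nondeg[OF y(1,2)] by blast
  have "?q ^ 4 = ?q * card K" unfolding V(2)[symmetric] K_def by (rule card_kernel[OF V(1) lin v])
  then have cK: "card K = ?q ^ 3" using q by (simp add: power_Suc[symmetric] eval_nat_numeral)
  have KV: "K \<subseteq> V" and ZV: "Z \<subseteq> V" by (auto simp: K_def Z_def)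
  have "bij_betw (\<lambda>(x, t). (\<lambda>i. x i + t * y i)) ((Z - K) \<times> UNIV) (V - K)"
  \<comment> \<open>Since \<open>N y y = 0\<close>, the form at \<open>x - t y\<close> is
    \<open>N x x - 2 t N y x\<close>, linear in \<open>t\<close>; off \<open>K\<close> it has the
    root used here.\<close>
  proof (rule bij_betw_byWitness[where f' = "\<lambda>x. let t = N x x / (2 * N y x) in
      ((\<lambda>i. x i + (- t) * y i), t)"])
    show "\<forall>a\<in>(Z - K) \<times> UNIV. (let t = N (case a of (x, t) \<Rightarrow>
        \<lambda>i. x i + t * y i) (case a of (x, t) \<Rightarrow> \<lambda>i. x i + t * y i) /
           (2 * N y (case a of (x, t) \<Rightarrow> \<lambda>i. x i + t * y i))
       in (\<lambda>i. (case a of (x, t) \<Rightarrow> \<lambda>i. x i + t * y i) i + - t * y i, t)) = a"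
    proof (clarify, goal_cases)
      case (1 x t)
      then have "N x x = 0" "N y x \<noteq> 0" by (auto simp: Z_def K_def)
      then have "N (\<lambda>i. x i + t * y i) (\<lambda>i. x i + t * y i) / (2 * N y (\<lambda>i.
          x i + t * y i)) = t"
        unfolding l l' using two y(3) sym[of x y] by (simp add: field_simps)
      then show ?case by (simp add: Let_def)
    qed
    show "\<forall>a'\<in>V - K. (case let t = N a' a' / (2 * N y a') in (\<lambda>i. a' i + - t *
        y i, t) of (x, t) \<Rightarrow> \<lambda>i. x i + t * y i) = a'"
      by (simp add: Let_def)
    show "(\<lambda>(x, t) i. x i + t * y i) ` ((Z - K) \<times> UNIV) \<subseteq> V - K"
      using comb y ZV by (auto simp: K_def l)
    show "(\<lambda>x. let t = N x x / (2 * N y x) in (\<lambda>i. x i + - t * y i, t)) ` (V - K)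
        \<subseteq> (Z - K) \<times> UNIV"
    proof (clarify, goal_cases)
      case (1 _ _ x)
      then have x: "x \<in> V" "N y x \<noteq> 0" by (auto simp: K_def)
      define t where "t = N x x / (2 * N y x)"
      have "N x x - 2 * t * N y x = 0" using x two by (simp add: t_def)
      then have "N (\<lambda>i. x i + - t * y i) (\<lambda>i. x i + - t * y i) = 0"
        unfolding l l' using y(3) sym[of x y] by (simp add: algebra_simps)
      moreover have "N y (\<lambda>i. x i + - t * y i) \<noteq> 0" unfolding l using x y(3) by simp
      ultimately have "(\<lambda>i. x i + - t * y i) \<in> Z - K" using comb[OF x(1) y(1), of "-
          t"] by (simp add: Z_def K_def)
      with 1 show ?case by (auto simp: Let_def t_def)
    qed
  qed
  then have "card (Z - K) * ?q = ?q ^ 4 - ?q ^ 3"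
    using bij_betw_same_card[of _ "(Z - K) \<times> (UNIV :: 'k set)" "V - K"] card_Diff_subset[OF
        finite_subset[OF KV fin] KV]
    by (simp add: card_cartesian_product V(2) cK)
  also have "\<dots> = (?q ^ 3 - ?q ^ 2) * ?q" by (simp add: diff_mult_distrib eval_nat_numeral)
  finally have "card (Z - K) = ?q ^ 3 - ?q ^ 2" using q by simp
  moreover have "card Z = card (Z \<inter> K) + card (Z - K)"
    by (rule card_Int_Diff[OF finite_subset[OF ZV fin]])
  moreover have "?q ^ 2 \<le> ?q ^ 3" using q by (intro power_increasing) auto
  ultimately have cZK: "card (Z \<inter> K) = ?q ^ 2" using cZ by simp
  have finZK: "finite (Z \<inter> K)" using finite_subset[OF ZV fin] by blast
  have "\<not> Z \<inter> K \<subseteq> range (\<lambda>c i. c * y i)"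
  proof
    assume "Z \<inter> K \<subseteq> range (\<lambda>c i. c * y i)"
    then have "card (Z \<inter> K) \<le> card (range (\<lambda>c i. c * y i))" by (intro card_mono) auto
    also have "\<dots> \<le> ?q" by (intro card_image_le) auto
    finally show False using cZK q by (simp add: power2_eq_square)
  qed
  then obtain w where w: "w \<in> Z" "w \<in> K" "\<And>c. w \<noteq> (\<lambda>i. c * y i)" by blast
  have wV: "w \<in> V" and ww: "N w w = 0" and yw: "N y w = 0" using w by (auto simp: Z_def K_def)
  have wy: "N w y = 0" using yw sym[of w y] by simp
  let ?F = "\<lambda>(c, d). (\<lambda>i. c * y i + d * w i)"
  \<comment> \<open>The vectors \<open>y\<close> and \<open>w\<close> are isotropic and mutually
    orthogonal, so their span is totally isotropic and lies in \<open>K\<close>.\<close>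
  have FZK: "(\<lambda>i. c * y i + d * w i) \<in> Z \<inter> K" for c d
  proof -
    have s: "N (\<lambda>i. c * y i) a = c * N y a" "N a (\<lambda>i. c * y i) = c * N a y" for a
      using lin_functional_scale[OF lin[of a], of c y] sym[of a] by auto
    have "(\<lambda>i. c * y i + d * w i) \<in> V"
      by (rule comb[OF lin_subspace_scale[OF V(1) y(1)] wV])
    then show ?thesis unfolding Z_def K_def by (simp add: l l' s y(3) yw wy ww)
  qed
  have "inj ?F"
  proof (rule injI, clarsimp)
    fix c d c' d' assume eq: "(\<lambda>i. c * y i + d * w i) = (\<lambda>i. c' * y i + d' * w i)"
    have e: "(d - d') * w i = (c' - c) * y i" for i using fun_cong[OF eq, of i] by (simp add: algebra_simps)
    have "d = d'"
    proof (rule ccontr)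
      assume "d \<noteq> d'"
      then have "w = (\<lambda>i. ((c' - c) / (d - d')) * y i)" using e by (auto simp: field_simps)
      with w(3) show False by blast
    qed
    moreover obtain i where "y i \<noteq> 0" using y(2) by auto
    ultimately show "c = c' \<and> d = d'" using e[of i] by simp
  qed
  then have "card (range ?F) = ?q ^ 2" by (simp add: card_image power2_eq_square)
  moreover have "range ?F \<subseteq> Z \<inter> K" using FZK by auto
  ultimately have ZK: "Z \<inter> K = range ?F" using card_subset_eq[OF finZK, of "range ?F"] cZK by simp
  have wK: "N w u = 0" if u: "u \<in> K" for u
  proof (rule ccontr)
    assume ne: "N w u \<noteq> 0"
    \<comment> \<open>This choice makes \<open>u + t w\<close> isotropic. It stays in
      \<open>K\<close>, hence lies in the span of \<open>y\<close> and \<open>w\<close>, where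
      \<open>N w\<close> vanishes.\<close>
    define t where "t = - N u u / (2 * N w u)"
    have uV: "u \<in> V" and yu: "N y u = 0" using u by (auto simp: K_def)
    have "N u u + 2 * t * N w u = 0" using ne two by (simp add: t_def)
    then have "N (\<lambda>i. u i + t * w i) (\<lambda>i. u i + t * w i) = 0"
      unfolding l l' using ww sym[of u w] by (simp add: algebra_simps)
    moreover have "N y (\<lambda>i. u i + t * w i) = 0" unfolding l using yu yw by simp
    ultimately have "(\<lambda>i. u i + t * w i) \<in> Z \<inter> K" using comb[OF uV wV] by (simp
        add: Z_def K_def)
    then obtain c d where cd: "(\<lambda>i. u i + t * w i) = (\<lambda>i. c * y i + d * w i)"
        unfolding ZK by auto
    have "N w (\<lambda>i. u i + t * w i) = 0"
      unfolding cd l using lin_functional_scale[OF lin[of w], of c y] by (simp add: wy ww)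
    with ne ww show False unfolding l by simp
  qed
  \<comment> \<open>Both \<open>N w\<close> and \<open>N y\<close> vanish on \<open>K\<close>, so
    they are proportional; the ratio is read off at \<open>v\<close>, and \<open>w - c y\<close>
    lies in the radical.\<close>
  define c where "c = N w v / N y v"
  define a where "a = (\<lambda>i. w i + (- c) * y i)"
  have aV: "a \<in> V" unfolding a_def by (rule comb[OF wV y(1)])
  have "N a b = 0" if b: "b \<in> V" for b
  proof -
    have "(\<lambda>i. b i + (- (N y b / N y v)) * v i) \<in> K"
    proof -
      have "N y b + (- (N y b / N y v)) * N y v = 0" using v(2) by simp
      then show ?thesis unfolding K_def using comb[OF b v(1)] by (simp only: mem_Collect_eq l simp_thms)
    qed
    from wK[OF this] have "N w b = c * N y b" unfolding l using v(2) by (simp add: c_def)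
    then show ?thesis unfolding a_def l' by simp
  qed
  with nondeg[OF aV] have "a = (\<lambda>_. 0)" by blast
  then have "w = (\<lambda>i. c * y i)" by (auto simp: a_def fun_eq_iff)
  with w(3) show False by blast
qed

section \<open>The Gauss map of a trilinear form\<close>

lemma tri_unit_vec:
  assumes "i \<le> n"
  shows "tri n T (unit_vec i) b c = (\<Sum>j\<le>n. \<Sum>k\<le>n. T i j k * b j * c k)"
proof -
  have "tri n T (unit_vec i) b c = (\<Sum>i'\<le>n. if i' = i then (\<Sum>j\<le>n. \<Sum>k\<le>n. T
      i j k * b j * c k) else 0)"
    unfolding tri_def unit_vec_def by (intro sum.cong refl) auto
  with assms show ?thesis by simp
qed

lemma tri_eq_dot: "tri n T h b c = dot n (\<lambda>i. if i \<le> n then tri n T (unit_vec i) b c else 0) h"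
proof -
  have "dot n (\<lambda>i. if i \<le> n then tri n T (unit_vec i) b c else 0) h
      = (\<Sum>i\<le>n. (\<Sum>j\<le>n. \<Sum>k\<le>n. T i j k * b j * c k) * h i)"
    unfolding dot_def by (intro sum.cong refl) (simp add: tri_unit_vec)
  then show ?thesis by (simp add: tri_def sum_distrib_left sum_distrib_right mult_ac)
qed

text \<open>The covector of \<open>h \<mapsto> T(h, a, b)\<close>; the diagonal \<open>a = b\<close>
  will be the gradient of the surface up to sign.\<close>

definition grad_map :: "nat \<Rightarrow> (nat \<Rightarrow> nat \<Rightarrow> nat \<Rightarrow>
    'k::field) \<Rightarrow> (nat \<Rightarrow> 'k) \<Rightarrow> (nat \<Rightarrow> 'k)
    \<Rightarrow> nat \<Rightarrow> 'k" where
  "grad_map n T a b i = (if i \<le> n then tri n T (unit_vec i) a b else 0)"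

lemma dot_grad_map: "dot n (grad_map n T a b) h = tri n T h a b"
  by (simp add: tri_eq_dot[of n T h] grad_map_def[abs_def])

lemma grad_map_in_vecs: "grad_map n T a b \<in> vecs n"
  by (auto simp: grad_map_def vecs_def)

lemma grad_map_lin: "grad_map n T a (\<lambda>i. b i + c * b' i) = (\<lambda>i. grad_map n T a b i
    + c * grad_map n T a b' i)"
  by (intro ext) (simp add: grad_map_def tri_lin3)

lemma grad_map_scale: "grad_map n T (\<lambda>i. c * x i) (\<lambda>i. c * x i) = (\<lambda>i. c ^
    2 * grad_map n T x x i)"
  by (intro ext) (simp add: grad_map_def tri_unit_vec sum_distrib_left power2_eq_square mult_ac)

lemma proj_point_scale:
  assumes "c \<noteq> 0"
  shows "proj_point (\<lambda>i. c * x i) = proj_point x"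
proof -
  have "\<exists>d. d \<noteq> 0 \<and> (\<lambda>i. e * x i) = (\<lambda>i. d * (c * x i))" if "e
      \<noteq> 0" for e
    using that assms by (intro exI[of _ "e / c"]) auto
  moreover have "\<exists>d. d \<noteq> 0 \<and> (\<lambda>i. e * (c * x i)) = (\<lambda>i. d * x
      i)" if "e \<noteq> 0" for e
    using that assms by (intro exI[of _ "e * c"]) (auto simp: mult.assoc)
  ultimately show ?thesis unfolding proj_point_def by (intro Set.set_eqI) (auto; metis)
qed

text \<open>A lift to vectors of a section of the Gauss map on projective points.\<close>

lemma gauss_section:
  fixes T :: "nat \<Rightarrow> nat \<Rightarrow> nat \<Rightarrow> 'a::{field, finite}"
  defines "V \<equiv> vecs 3 - {\<lambda>_. 0 :: 'a}" and "Q \<equiv> (\<lambda>x. grad_map 3 T x x)"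
  assumes ex: "\<And>l. l \<in> V \<Longrightarrow> \<exists>x\<in>V. \<exists>c. c \<noteq> 0
      \<and> Q x = (\<lambda>i. c * l i)"
  obtains \<gamma> where "bij_betw \<gamma> V V" "\<forall>z\<in>V. \<exists>d. d \<noteq> 0 \<and>
      Q (\<gamma> z) = (\<lambda>i. d * z i)"
    "\<forall>z\<in>V. \<forall>c. c \<noteq> 0 \<longrightarrow> (\<exists>d. \<gamma>
        (\<lambda>i. c * z i) = (\<lambda>i. d * \<gamma> z i))"
proof -
  obtain \<xi> where \<xi>: "\<And>l. l \<in> V \<Longrightarrow> \<xi> l \<in> V \<and>
      (\<exists>c. c \<noteq> 0 \<and> Q (\<xi> l) = (\<lambda>i. c * l i))"
    using ex by metis
  \<comment> \<open>One representative is fixed on each projective point, and \<kappa> records the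
    scalar relating a vector to its representative.\<close>
  define \<rho> where "\<rho> = (\<lambda>z :: nat \<Rightarrow> 'a. SOME r. r \<in> proj_point z)"
  have \<rho>_in: "\<rho> z \<in> proj_point z" for z
    unfolding \<rho>_def by (rule someI[of "\<lambda>r. r \<in> proj_point z", OF proj_point_self])
  have "\<exists>c. c \<noteq> 0 \<and> z = (\<lambda>i. c * \<rho> z i)" for z
  proof -
    obtain c where c: "c \<noteq> 0" "\<rho> z = (\<lambda>i. c * z i)" using \<rho>_in[of z] by
        (rule proj_pointE)
    then show ?thesis by (intro exI[of _ "inverse c"]) (simp add: field_simps)
  qed
  then obtain \<kappa> where \<kappa>: "\<And>z. \<kappa> z \<noteq> 0 \<and> z = (\<lambda>i.
      \<kappa> z * \<rho> z i)" by metis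
  have \<rho>_scale: "\<rho> (\<lambda>i. c * z i) = \<rho> z" if "c \<noteq> 0" for c z
    by (simp add: \<rho>_def proj_point_scale[OF that])
  have scale_V: "(\<lambda>i. c * z i) \<in> V" if "c \<noteq> 0" "z \<in> V" for c z
    using that unfolding V_def by (auto simp: vecs_def fun_eq_iff)
  have \<rho>_V: "\<rho> z \<in> V" if z: "z \<in> V" for z
  proof -
    obtain c where "c \<noteq> 0" "\<rho> z = (\<lambda>i. c * z i)" using \<rho>_in[of z] by (rule
        proj_pointE)
    then show ?thesis using scale_V[OF _ z] by simp
  qed
  \<comment> \<open>The factor \<kappa> distinguishes vectors on the same projective point, which
    makes the lift injective on vectors and not merely on points.\<close>
  define \<gamma> where "\<gamma> = (\<lambda>z i. \<kappa> z * \<xi> (\<rho> z) i)"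
  have \<gamma>_V: "\<gamma> z \<in> V" if z: "z \<in> V" for z
    unfolding \<gamma>_def using \<kappa>[of z] \<xi>[OF \<rho>_V[OF z]] by (intro scale_V) auto
  have Q\<gamma>: "\<exists>d. d \<noteq> 0 \<and> Q (\<gamma> z) = (\<lambda>i. d * z i)" if z: "z
      \<in> V" for z
  proof -
    obtain c where c: "c \<noteq> 0" "Q (\<xi> (\<rho> z)) = (\<lambda>i. c * \<rho> z i)" using
        \<xi>[OF \<rho>_V[OF z]] by blast
    have "Q (\<gamma> z) = (\<lambda>i. \<kappa> z ^ 2 * (c * \<rho> z i))"
      unfolding Q_def \<gamma>_def grad_map_scale using c(2) by (simp add: Q_def)
    also have "\<dots> = (\<lambda>i. (\<kappa> z * c) * (\<kappa> z * \<rho> z i))" by (simp add: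
        power2_eq_square mult_ac)
    also have "\<dots> = (\<lambda>i. (\<kappa> z * c) * z i)" using \<kappa>[of z] by metis
    finally show ?thesis using c(1) \<kappa>[of z] by (intro exI[of _ "\<kappa> z * c"]) auto
  qed
  have same: "\<exists>d. \<gamma> (\<lambda>i. c * z i) = (\<lambda>i. d * \<gamma> z i)" if "c
      \<noteq> 0" for c z
    using that \<kappa>[of z] by (intro exI[of _ "\<kappa> (\<lambda>i. c * z i) / \<kappa> z"])
        (auto simp: \<gamma>_def \<rho>_scale)
  have inj: "inj_on \<gamma> V"
  proof (rule inj_onI)
    fix z z' assume z: "z \<in> V" "z' \<in> V" "\<gamma> z = \<gamma> z'"
    obtain d where d: "d \<noteq> 0" "Q (\<gamma> z) = (\<lambda>i. d * z i)" using Q\<gamma>[OF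
        z(1)] by blast
    obtain d' where d': "d' \<noteq> 0" "Q (\<gamma> z') = (\<lambda>i. d' * z' i)" using
        Q\<gamma>[OF z(2)] by blast
    have e: "d * z i = d' * z' i" for i using d(2) d'(2) z(3) by metis
    have "z = (\<lambda>i. (d' / d) * z' i)" using e d(1) by (simp add: fun_eq_iff field_simps)
    then have \<rho>_eq: "\<rho> z = \<rho> z'" using \<rho>_scale[of "d' / d" z'] d d' by simp
    have "\<xi> (\<rho> z') \<in> V" using \<xi>[OF \<rho>_V[OF z(2)]] by blast
    then obtain i where "\<xi> (\<rho> z') i \<noteq> 0" by (auto simp: V_def fun_eq_iff)
    moreover have "\<kappa> z * \<xi> (\<rho> z') i = \<kappa> z' * \<xi> (\<rho> z') i"
      using fun_cong[OF z(3), of i] by (simp add: \<gamma>_def \<rho>_eq)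
    ultimately have "\<kappa> z = \<kappa> z'" by simp
    then show "z = z'" using \<kappa>[of z] \<kappa>[of z'] \<rho>_eq by metis
  qed
  have "finite V" by (simp add: V_def)
  with inj \<gamma>_V have "\<gamma> ` V = V" by (intro endo_inj_surj) auto
  with inj have "bij_betw \<gamma> V V" by (simp add: bij_betw_def)
  with Q\<gamma> same show thesis by (intro that[of \<gamma>]) auto
qed

lemma no_surjective_gauss_map:
  fixes T :: "nat \<Rightarrow> nat \<Rightarrow> nat \<Rightarrow> 'a::{field, finite}"
  assumes two: "(2 :: 'a) \<noteq> 0"
    and sym: "\<And>i j k. T i j k = T i k j" and van: "\<And>x. x \<in> vecs 3 \<Longrightarrow>
        tri 3 T x x x = 0"
    and smooth: "\<And>x. x \<in> vecs 3 \<Longrightarrow> x \<noteq> (\<lambda>_. 0)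
        \<Longrightarrow> \<exists>h\<in>vecs 3. tri 3 T h x x \<noteq> 0"
    and planes: "\<And>l. l \<in> vecs 3 \<Longrightarrow> l \<noteq> (\<lambda>_. 0) \<Longrightarrow>
      \<exists>x\<in>vecs 3. x \<noteq> (\<lambda>_. 0) \<and> (\<forall>h\<in>vecs 3. dot 3 l h =
          0 \<longrightarrow> tri 3 T h x x = 0)"
  shows False
proof -
  let ?V = "vecs 3 - {\<lambda>_. 0 :: 'a}"
  define Q where "Q = (\<lambda>x. grad_map 3 T x x)"
  have s: "tri 3 T a b c = tri 3 T a c b" for a b c by (rule tri_sym23[OF sym])
  \<comment> \<open>Tangency of the plane \<open>l\<close> at a rational \<open>x\<close> makes
    \<open>Q x\<close> a multiple of \<open>l\<close>; smoothness excludes the multiple 0.\<close>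
  have "\<exists>x\<in>?V. \<exists>c. c \<noteq> 0 \<and> Q x = (\<lambda>i. c * l i)" if l: "l
      \<in> ?V" for l
  proof -
    obtain x where x: "x \<in> ?V" "\<forall>h\<in>vecs 3. dot 3 l h = 0 \<longrightarrow> tri 3 T h x x = 0"
      using planes[of l] l by auto
    have "dot 3 (Q x) h = 0" if "h \<in> solutions 3 1 (\<lambda>_. l)" for h
      using that x(2) by (auto simp: Q_def dot_grad_map solutions_def)
    then obtain c where c: "\<forall>i\<le>3. Q x i = (\<Sum>j<(1::nat). c j * l i)"
      using vanish_on_solutions_imp_combination by blast
    have Qx: "Q x = (\<lambda>i. c 0 * l i)"
    proof
      fix i show "Q x i = c 0 * l i"
        using c l grad_map_in_vecs[of 3 T x x] by (cases "i \<le> 3") (auto simp: Q_def vecs_def)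
    qed
    obtain h where "tri 3 T h x x \<noteq> 0" using smooth[of x] x(1) by auto
    then have "dot 3 (Q x) h \<noteq> 0" by (simp add: Q_def dot_grad_map)
    then have "c 0 \<noteq> 0" by (auto simp: Qx dot_def)
    with Qx x(1) show ?thesis by blast
  qed
  then obtain \<gamma> where bij: "bij_betw \<gamma> ?V ?V" and Q\<gamma>: "\<forall>z\<in>?V.
      \<exists>d. d \<noteq> 0 \<and> Q (\<gamma> z) = (\<lambda>i. d * z i)"
    and \<gamma>_scale: "\<forall>z\<in>?V. \<forall>c. c \<noteq> 0 \<longrightarrow> (\<exists>d.
        \<gamma> (\<lambda>i. c * z i) = (\<lambda>i. d * \<gamma> z i))"
    unfolding Q_def by (rule gauss_section)
  \<comment> \<open>The section \<gamma> is onto, so both points are values of it; equal images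
    under \<open>Q\<close> make the arguments, and hence the values, proportional.\<close>
  have Q_inj: "\<exists>c. x' = (\<lambda>i. c * x i)" if x: "x \<in> ?V" "x' \<in> ?V" "Q x = Q x'" for x x'
  proof -
    obtain z where z: "z \<in> ?V" "x = \<gamma> z" using bij x(1) unfolding bij_betw_def by blast
    obtain z' where z': "z' \<in> ?V" "x' = \<gamma> z'" using bij x(2) unfolding bij_betw_def by blast
    obtain d where d: "d \<noteq> 0" "Q x = (\<lambda>i. d * z i)" using Q\<gamma> z by blast
    obtain d' where d': "d' \<noteq> 0" "Q x' = (\<lambda>i. d' * z' i)" using Q\<gamma> z' by blast
    have e: "d * z i = d' * z' i" for i using d(2) d'(2) x(3) by metis
    have "z' = (\<lambda>i. (d / d') * z i)" using e d'(1) by (simp add: fun_eq_iff field_simps)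
    then show ?thesis using \<gamma>_scale[rule_format, OF z(1), of "d / d'"] d(1) d'(1) z(2) z'(2) by simp
  qed
  \<comment> \<open>If \<open>T(h, a, b)\<close> vanished for all \<open>h\<close>, then
    \<open>Q\<close> would agree at \<open>a + b\<close> and \<open>a - b\<close>. These would be
    proportional with a factor of square 1, forcing \<open>a\<close> or \<open>b\<close> to be
    0.\<close>
  have polar: "\<exists>h\<in>vecs 3. tri 3 T h a b \<noteq> 0" if ab: "a \<in> ?V" "b \<in> ?V" for a b
  proof (rule ccontr)
    assume neg: "\<not> ?thesis"
    define x where "x = (\<lambda>i. a i + 1 * b i)"
    define x' where "x' = (\<lambda>i. a i + (-1) * b i)"
    have xv: "x \<in> vecs 3" "x' \<in> vecs 3"
      unfolding x_def x'_def using ab by (auto simp: vecs_def)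
    have "tri 3 T h x x = tri 3 T h x' x'" if "h \<in> vecs 3" for h
      unfolding x_def x'_def tri_lin2 tri_lin3 using neg that s[of h b a] by simp
    then have Qe: "Q x = Q x'" by (auto simp: Q_def grad_map_def unit_vec_in_vecs)
    have nz: "Q u \<noteq> (\<lambda>_. 0)" if "u \<in> ?V" for u
    proof
      assume "Q u = (\<lambda>_. 0)"
      then have "tri 3 T h u u = 0" for h using dot_grad_map[of 3 T u u h] by (simp add: Q_def dot_def)
      with smooth[of u] that show False by auto
    qed
    have Q0: "Q (\<lambda>_. 0) = (\<lambda>_. 0)" by (auto simp: Q_def grad_map_def tri_def)
    have sum: "x i + x' i = 2 * a i" "x i - x' i = 2 * b i" for i by (simp_all add: x_def x'_def)
    have "x \<noteq> (\<lambda>_. 0)"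
    proof
      assume x0: "x = (\<lambda>_. 0)"
      then have "x' = (\<lambda>_. 0)" using nz[of x'] Qe Q0 xv by auto
      with x0 sum(1) two ab(1) show False by (auto simp: fun_eq_iff)
    qed
    moreover from this have "x' \<noteq> (\<lambda>_. 0)" using nz[of x] Qe Q0 xv by auto
    ultimately have xV: "x \<in> ?V" "x' \<in> ?V" using xv by auto
    then obtain c where c: "x' = (\<lambda>i. c * x i)" using Q_inj[OF xV Qe] by blast
    have "Q x = Q (\<lambda>i. c * x i)" using Qe unfolding c .
    also have "\<dots> = (\<lambda>i. c ^ 2 * Q x i)" by (simp add: Q_def grad_map_scale)
    finally have Qc: "Q x = (\<lambda>i. c ^ 2 * Q x i)" .
    obtain i where i: "Q x i \<noteq> 0" using nz[OF xV(1)] by auto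
    have "1 * Q x i = c ^ 2 * Q x i" unfolding mult_1 by (rule fun_cong[OF Qc])
    then have "c ^ 2 = 1" using i by (metis mult_cancel_right)
    then have "c = 1 \<or> c = -1" by (simp add: power2_eq_1_iff)
    then show False
    proof
      assume "c = 1"
      then have "b i = 0" for i using sum(2)[of i] c two by simp
      with ab show False by auto
    next
      assume "c = -1"
      then have "a i = 0" for i using sum(1)[of i] c two by simp
      with ab show False by auto
    qed
  qed
  \<comment> \<open>A unit vector is chosen so that \<open>dot 3 y y = 1\<close>; over a finite
    field this value can be 0 for other nonzero vectors.\<close>
  define y :: "nat \<Rightarrow> 'a" where "y = unit_vec 0"
  have y: "y \<in> vecs 3" "y \<noteq> (\<lambda>_. 0)"
    by (simp_all add: y_def unit_vec_in_vecs unit_vec_nonzero)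
  \<comment> \<open>By \<open>polar\<close> the linear map \<open>grad_map 3 T a\<close> is
    injective on a finite space, hence onto; a preimage \<open>b\<close> of \<open>y\<close>
    satisfies \<open>T(y, a, b) = dot 3 y y = 1\<close>.\<close>
  have nondeg: "\<exists>b\<in>vecs 3. tri 3 T y a b \<noteq> 0" if a: "a \<in> vecs 3" "a \<noteq>
      (\<lambda>_. 0)" for a
  proof -
    let ?L = "grad_map 3 T a"
    have "inj_on ?L (vecs 3)"
    proof (rule inj_onI, rule ccontr)
      fix b b' assume b: "b \<in> vecs 3" "b' \<in> vecs 3" "?L b = ?L b'" "b \<noteq> b'"
      define e where "e = (\<lambda>i. b i + (-1) * b' i)"
      have e: "e \<in> vecs 3" unfolding e_def by (rule lin_subspaceD(2)[OF lin_subspace_vecs b(1,2)])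
      have "e \<noteq> (\<lambda>_. 0)" using b(4) by (auto simp: e_def fun_eq_iff)
      with e have eV: "e \<in> ?V" by simp
      have aV: "a \<in> ?V" using a by simp
      obtain h where "tri 3 T h a e \<noteq> 0" using polar[OF aV eV] by blast
      moreover have "?L e = (\<lambda>_. 0)" unfolding e_def grad_map_lin b(3) by simp
      then have "tri 3 T h a e = 0" using dot_grad_map[of 3 T a e h] by (simp add: dot_def)
      ultimately show False by simp
    qed
    then have "?L ` vecs 3 = vecs 3" by (intro endo_inj_surj) (auto intro: grad_map_in_vecs)
    then obtain b where b: "b \<in> vecs 3" "?L b = y" using y(1) by (metis imageE)
    have "tri 3 T y a b = 1"
      using dot_grad_map[of 3 T a b y] dot_unit_vec[of 0 3 y] by (simp add: b(2) y_def unit_vec_def)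
    with b(1) show ?thesis by (intro bexI[of _ b]) auto
  qed
  have "card (\<gamma> ` {z \<in> ?V. dot 3 y z = 0}) = card {z \<in> ?V. dot 3 y z = 0}"
    using bij by (intro card_image inj_on_subset[OF bij_betw_imp_inj_on]) auto
  moreover have "\<gamma> ` {z \<in> ?V. dot 3 y z = 0} = {x \<in> ?V. tri 3 T y x x = 0}"
  proof -
    \<comment> \<open>As \<open>Q (\<gamma> z)\<close> is proportional to \<open>z\<close>, the
      bijection \<gamma> carries the hyperplane orthogonal to \<open>y\<close> to the zeros of the
      quadratic form of \<open>y\<close>.\<close>
    have iff: "tri 3 T y (\<gamma> z) (\<gamma> z) = 0 \<longleftrightarrow> dot 3 y z = 0" if z:
        "z \<in> ?V" for z
    proof -
      obtain d where d: "d \<noteq> 0" "Q (\<gamma> z) = (\<lambda>i. d * z i)" using bspec[OF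
          Q\<gamma> z] by blast
      have "tri 3 T y (\<gamma> z) (\<gamma> z) = dot 3 (Q (\<gamma> z)) y" by (simp add: Q_def dot_grad_map)
      also have "\<dots> = d * dot 3 y z" by (simp add: d(2) dot_def sum_distrib_left mult_ac)
      finally show ?thesis using d(1) by simp
    qed
    have surj: "\<gamma> ` ?V = ?V" by (rule bij_betw_imp_surj_on[OF bij])
    show ?thesis
    proof (intro Set.equalityI subsetI)
      fix x assume "x \<in> \<gamma> ` {z \<in> ?V. dot 3 y z = 0}"
      then obtain z where z: "z \<in> ?V" "dot 3 y z = 0" "x = \<gamma> z" by (elim imageE CollectE conjE)
      have "\<gamma> z \<in> ?V" using imageI[OF z(1), of \<gamma>] by (simp only: surj)
      then show "x \<in> {x \<in> ?V. tri 3 T y x x = 0}" using iff[OF z(1)] z(2,3) by simp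
    next
      fix x assume "x \<in> {x \<in> ?V. tri 3 T y x x = 0}"
      then have x: "x \<in> ?V" "tri 3 T y x x = 0" by simp_all
      from x(1) have "x \<in> \<gamma> ` ?V" by (simp only: surj)
      then obtain z where z: "x = \<gamma> z" "z \<in> ?V" by (rule imageE)
      show "x \<in> \<gamma> ` {z \<in> ?V. dot 3 y z = 0}"
        unfolding z(1) by (rule imageI, rule CollectI, rule conjI[OF z(2)]) (use iff[OF z(2)] x(2)
            z(1) in simp)
    qed
  qed
  ultimately have V_eq: "card {x \<in> ?V. tri 3 T y x x = 0} = card {z \<in> ?V. dot 3 y z = 0}" by simp
  have with_zero: "card {x \<in> vecs 3. P x} = Suc (card {x \<in> ?V. P x})" if "P (\<lambda>_. 0)" for P
  proof -
    have "{x \<in> vecs 3. P x} = insert (\<lambda>_. 0) {x \<in> ?V. P x}" using that by (auto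
        simp: vecs_def)
    then show ?thesis by simp
  qed
  have "card {x \<in> vecs 3. tri 3 T y x x = 0} = Suc (card {x \<in> ?V. tri 3 T y x x = 0})"
    by (rule with_zero) (simp add: tri_def)
  also have "\<dots> = card {z \<in> vecs 3. dot 3 y z = 0}"
    unfolding V_eq by (rule with_zero[symmetric]) (simp add: dot_def)
  finally have eq: "card {x \<in> vecs 3. tri 3 T y x x = 0} = card {z \<in> vecs 3. dot 3 y z = 0}" .
  have "dot 3 y y = 1" by (simp add: y_def dot_unit_vec) (simp add: unit_vec_def)
  then have "card (vecs 3 :: (nat \<Rightarrow> 'a) set) = CARD('a) * card {z \<in> vecs 3. dot 3 y z = 0}"
    by (intro card_kernel[OF lin_subspace_vecs lin_functional_dot y(1)]) simp
  then have "CARD('a) * CARD('a) ^ 3 = CARD('a) * card {z \<in> vecs 3. dot 3 y z = 0}"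
    using card_vecs[of 3, where 'k = 'a] by (simp add: eval_nat_numeral)
  then have "card {x \<in> vecs 3. tri 3 T y x x = 0} = CARD('a) ^ 3"
    unfolding eq by simp
  moreover have "card {x \<in> vecs 3. tri 3 T y x x = 0} \<noteq> CARD('a) ^ 3"
  proof (rule card_singular_quadric[OF two lin_subspace_vecs, where N = "tri 3 T y" and y = y])
    show "card (vecs 3 :: (nat \<Rightarrow> 'a) set) = CARD('a) ^ 4" using card_vecs[of 3, where
        'k = 'a] by simp
    show "lin_functional (tri 3 T y a)" for a by (simp add: lin_functional_def tri_lin3)
  qed (use nondeg y van s in auto)
  ultimately show False by simp
qed

section \<open>Planes and surfaces of degree \<open>q + 2\<close>\<close>

theorem degree_q2_not_plane_transverse_free:
  fixes f :: "'a::{field, finite} mpoly"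
  assumes q: "odd CARD('a)" and f: "homogeneous_form 3 (CARD('a) + 2) f"
    and sm: "smooth_hypersurface 3 f" and sf: "space_filling 3 f"
  shows "\<not> plane_transverse_free 3 f"
proof
  assume ptf: "plane_transverse_free 3 f"
  have two: "(2 :: 'a) \<noteq> 0" by (rule two_neq_zero[OF q])
  then have two': "(2 :: 'a alg_closure) \<noteq> 0" by (metis to_ac_eq_0_iff to_ac_numeral)
  obtain T :: "nat \<Rightarrow> nat \<Rightarrow> nat \<Rightarrow> 'a" where "\<forall>i j k. T i
      j k = T i k j"
    "\<forall>x. mpoly_eval f x = tri 3 (\<lambda>i j k. to_ac (T i j k)) (\<lambda>i. x i ^ CARD('a)) x x"
    by (rule trilinear_representation[OF f sf q])
  then have sym: "T i j k = T i k j"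
    and T: "mpoly_eval f x = tri 3 (\<lambda>i j k. to_ac (T i j k)) (\<lambda>i. x i ^ CARD('a)) x
        x" for i j k x
    by blast+
  have D: "dir_deriv 3 f x h = 2 * tri 3 (\<lambda>i j k. to_ac (T i j k)) (\<lambda>i. x i ^
      CARD('a)) x h" for x h
    by (rule dir_deriv_trilinear[OF f sym T])
  have van: "tri 3 T x x x = 0" if "x \<in> vecs 3" for x
    using space_filling_eval[OF f _ sf that] by (simp add: T to_ac_tri)
  have s: "tri 3 T a b c = tri 3 T a c b" for a b c by (rule tri_sym23[OF sym])
  \<comment> \<open>The q-power is the identity on rational \<open>x\<close>, so the gradient is
    \<open>2 T(x, x, h)\<close>; the cyclic relation turns this into \<open>- T(h, x, x)\<close>,
    the form used by the Gauss map.\<close>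
  have grad: "dot 3 (rat_grad f x) h = - tri 3 T h x x" if xh: "x \<in> vecs 3" "h \<in> vecs 3" for x h
  proof -
    have "to_ac (dot 3 (rat_grad f x) h) = to_ac (2 * tri 3 T x x h)"
      unfolding dir_deriv_to_ac_vec[symmetric] D by (simp add: to_ac_tri)
    then have "dot 3 (rat_grad f x) h = 2 * tri 3 T x x h" by (simp only: to_ac_eq_iff)
    moreover have "tri 3 T h x x + tri 3 T x h x + tri 3 T x h x = 0"
      by (rule tri_cyclic[OF two sym van]) (use xh in auto)
    then have "tri 3 T h x x = - (2 * tri 3 T x x h)"
      unfolding s[of x h x] by (simp only: eq_neg_iff_add_eq_0 mult_2 add.assoc)
    ultimately show ?thesis by simp
  qed
  show False
  proof (rule no_surjective_gauss_map[OF two sym van])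
    fix x :: "nat \<Rightarrow> 'a" assume x: "x \<in> vecs 3" "x \<noteq> (\<lambda>_. 0)"
    obtain i where i: "i \<le> 3" "mpoly_eval (mpoly_pderiv i f) (to_ac_vec x) \<noteq> 0"
      using smooth_hypersurfaceD[OF f sm, of "to_ac_vec x"] x space_filling_eval[OF f _ sf x(1)]
      by (auto simp: to_ac_vec_eq_0_iff to_ac_vec_in_vecs)
    have "dot 3 (rat_grad f x) (unit_vec i) \<noteq> 0"
      using i by (simp add: dot_unit_vec flip: to_ac_rat_grad)
    then show "\<exists>h\<in>vecs 3. tri 3 T h x x \<noteq> 0"
      using grad[OF x(1) unit_vec_in_vecs[OF i(1)]] unit_vec_in_vecs[OF i(1)] by auto
  next
    fix l :: "nat \<Rightarrow> 'a" assume l: "l \<in> vecs 3" "l \<noteq> (\<lambda>_. 0)"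
    have "lin_indep_forms 3 1 (\<lambda>_. l)"
      using l by (auto simp: lin_indep_forms_def vecs_def fun_eq_iff) (metis not_le)
    then have "is_flat 3 2 (flat_of 3 1 (\<lambda>_. l))" by (auto simp: is_flat_iff)
    with ptf have "tangent_flat 3 f (flat_of 3 1 (\<lambda>_. l))" by (auto simp: flat_transverse_free_def)
    then obtain y where y: "y \<in> vecs 3" "y \<noteq> (\<lambda>_. 0)" "\<forall>j<(1::nat). dot
        3 (to_ac_vec l) y = 0"
      and tan: "\<forall>h\<in>vecs 3. (\<forall>j<(1::nat). dot 3 (to_ac_vec l) h = 0)
          \<longrightarrow> dir_deriv 3 f y h = 0"
      by (rule tangent_flatD[OF f sm])
    show "\<exists>x\<in>vecs 3. x \<noteq> (\<lambda>_. 0) \<and> (\<forall>h\<in>vecs 3. dot 3 l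
        h = 0 \<longrightarrow> tri 3 T h x x = 0)"
    \<comment> \<open>The tangency point \<open>y\<close> may be irrational and is replaced by a
      rational one in the same plane.\<close>
    proof (rule plane_rational_singular_point[OF two sym van l y(1,2)])
      fix h :: "nat \<Rightarrow> 'a alg_closure" assume "h \<in> vecs 3" "dot 3 (to_ac_vec l) h = 0"
      with tan have "dir_deriv 3 f y h = 0" by simp
      with two' show "tri 3 (\<lambda>i j k. to_ac (T i j k)) (\<lambda>i. y i ^ CARD('a)) y h = 0"
          by (simp add: D)
    qed (use y(3) in auto)
  qed
qed

theorem theorem1p1:
  fixes q :: nat
  assumes "CARD('a::{field,finite}) = q"
  shows
    "(\<forall>f :: 'a mpoly. hypersurface_form 3 (q + 1) f
          \<and> smooth_hypersurface 3 f \<and> space_filling 3 f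
        \<longrightarrow> \<not> line_transverse_free 3 f) \<and>
     (\<forall>n k. odd n \<and> even k \<and> 2 \<le> k \<and> k \<le> n - 1 \<longrightarrow>
        (\<forall>f :: 'a mpoly. hypersurface_form n (q + 1) f
          \<and> smooth_hypersurface n f \<and> space_filling n f
           \<longrightarrow> flat_transverse_free n k f)) \<and>
     (\<forall>n\<ge>2. \<forall>f :: 'a mpoly. hypersurface_form n (q + 2) f
          \<and> smooth_hypersurface n f \<and> space_filling n f
        \<longrightarrow> line_transverse_free n f) \<and>
     (odd q \<longrightarrow>
        (\<forall>f :: 'a mpoly. hypersurface_form 3 (q + 2) f
          \<and> smooth_hypersurface 3 f \<and> space_filling 3 f
           \<longrightarrow> \<not> plane_transverse_free 3 f))"
  unfolding hypersurface_form_def assms[symmetric]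
proof (intro conjI allI impI; (elim conjE)?)
  fix f :: "'a mpoly"
  assume "homogeneous_form 3 (CARD('a) + 1) f" "smooth_hypersurface 3 f" "space_filling 3 f"
  then show "\<not> line_transverse_free 3 f" by (intro degree_q1_not_line_transverse_free)
next
  fix n k :: nat and f :: "'a mpoly"
  assume "even k" "2 \<le> k" "k \<le> n - 1" "homogeneous_form n (CARD('a) + 1) f" "space_filling n f"
  then show "flat_transverse_free n k f" by (intro degree_q1_flat_transverse_free) simp_all
next
  fix n :: nat and f :: "'a mpoly"
  assume "2 \<le> n" "homogeneous_form n (CARD('a) + 2) f" "space_filling n f"
  then show "line_transverse_free n f" by (intro degree_q2_line_transverse_free)
next
  fix f :: "'a mpoly"
  assume "odd CARD('a)" "homogeneous_form 3 (CARD('a) + 2) f" "smooth_hypersurface 3 f" "space_filling 3 f"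
  then show "\<not> plane_transverse_free 3 f" by (intro degree_q2_not_plane_transverse_free)
qed

end
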